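(* Let $\alpha\in\mathcal{K}$ and $\gamma\in\mathbb{R}$. For $\beta,\delta\in\mathbb{R}$ and $N\in\mathbb{N}$, write $\widetilde{\mathcal{N}}(\alpha,\beta,\gamma,\delta,N)$ for the number of integers $n$ with $2\le n\le N$ such that $$\|n\alpha-\gamma\|\cdot\|n\beta-\delta\|\le\frac{1}{n\log n}.$$ Let $\mathcal{R}(\alpha,\gamma)$ be the set of $(\beta,\delta)\in\mathcal{B}$ such that $\widetilde{\mathcal{N}}(\alpha,\beta,\gamma,\delta,N)\gg\log\log N$ holds for all sufficiently large $N$. Then $\dim_{\mathrm{H}}\mathcal{R}(\alpha,\gamma)=2$.
   Context: For $x\in\mathbb{R}$, $\|x\|$ denotes the distance from $x$ to the nearest integer. $\dim_{\mathrm{H}}$ denotes Hausdorff dimension. For $\alpha\in\mathbb{R}\setminus\mathbb{Q}$, $q_1(\alpha),q_2(\alpha),\ldots$ is the sequence of continued fraction denominators (denominators of the convergents) of $\alpha$, and $\mathcal{K}$ is the set of irrational real $\alpha$ with $\sup_{k\ge1}k^{-1}\log q_k(\alpha)<\infty$. $\mathbf{Bad} = \{\alpha \in \mathbb{R} : \inf_{n\in\mathbb{N}} n\|n\alpha\| > 0\}$, $\mathbf{Bad}_\gamma = \{\alpha\in\mathbb{R} : \inf_{n\in\mathbb{N}} n\|n\alpha-\gamma\|>0\}$ for $\gamma\in\mathbb{R}$, and $\mathcal{B} = \{(\alpha,\gamma)\in\mathbb{R}^2 : \alpha\in\mathbf{Bad}\cap\mathbf{Bad}_\gamma\}$. The notation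 $f(N)\gg g(N)$ means that $f(N)\ge c\,g(N)$ for some constant $c>0$ independent of $N$. *)

theory Defs
  imports "HOL-Analysis.Analysis"
begin

definition dist_int :: "real \<Rightarrow> real" where
  "dist_int x = infdist x \<int>"

subsection \<open>Continued fraction denominators\<close>

text \<open>
  For irrational \<open>\<alpha>\<close> the complete quotients are never integers, so the division below
  is proper and \<open>\<lfloor>complete_quotient \<alpha> k\<rfloor>\<close> is the partial quotient \<open>a\<^sub>k\<close> of
  \<open>\<alpha> = [a\<^sub>0; a\<^sub>1, a\<^sub>2, \<dots>]\<close>. Indexing is \<open>q\<^sub>0 = 1\<close>, \<open>q\<^sub>1 = a\<^sub>1\<close>.
\<close>

primrec complete_quotient :: "real \<Rightarrow> nat \<Rightarrow> real" where
  "complete_quotient \<alpha> 0 = \<alpha>"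
| "complete_quotient \<alpha> (Suc k) = 1 / frac (complete_quotient \<alpha> k)"

definition partial_quotient :: "real \<Rightarrow> nat \<Rightarrow> int" where
  "partial_quotient \<alpha> k = \<lfloor>complete_quotient \<alpha> k\<rfloor>"

fun cf_denom :: "real \<Rightarrow> nat \<Rightarrow> int" where
  "cf_denom \<alpha> 0 = 1"
| "cf_denom \<alpha> (Suc 0) = partial_quotient \<alpha> 1"
| "cf_denom \<alpha> (Suc (Suc k)) =
     partial_quotient \<alpha> (Suc (Suc k)) * cf_denom \<alpha> (Suc k) + cf_denom \<alpha> k"

definition K_set :: "real set" where
  "K_set = {\<alpha>. \<alpha> \<notin> \<rat> \<and> bdd_above ((\<lambda>k. ln (real_of_int (cf_denom \<alpha> k)) / real k) ` {1..})}"

subsection \<open>Badly approximable numbers and pairs\<close>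

definition Bad :: "real set" where
  "Bad = {\<alpha>. (INF n\<in>{1::nat..}. real n * dist_int (real n * \<alpha>)) > 0}"

definition Bad_inhom :: "real \<Rightarrow> real set" where
  "Bad_inhom \<gamma> = {\<alpha>. (INF n\<in>{1::nat..}. real n * dist_int (real n * \<alpha> - \<gamma>)) > 0}"

definition Bad_pairs :: "(real \<times> real) set" where
  "Bad_pairs = {(\<alpha>, \<gamma>). \<alpha> \<in> Bad \<inter> Bad_inhom \<gamma>}"

subsection \<open>Hausdorff measure and dimension\<close>

text \<open>
  The usual convention at exponent \<open>0\<close> is that every nonempty set has weight \<open>1\<close>
  (so that \<open>0\<close>-dimensional measure is counting measure). It is spelled out because
  \<open>0 powr 0 = 0\<close> in HOL.
\<close>

definition hausdorff_weight :: "real \<Rightarrow> 'a::metric_space set \<Rightarrow> ennreal" where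
  "hausdorff_weight s U =
     (if U = {} then 0 else if s = 0 then 1 else ennreal (diameter U powr s))"

text \<open>
  Boundedness is required of the covering sets because \<open>diameter\<close> is unspecified on
  unbounded sets. Finite covers are included by padding with the empty set.
\<close>

definition hausdorff_premeasure :: "real \<Rightarrow> real \<Rightarrow> 'a::metric_space set \<Rightarrow> ennreal" where
  "hausdorff_premeasure s \<epsilon> E =
     (INF U \<in> {U :: nat \<Rightarrow> 'a set. E \<subseteq> (\<Union>i. U i) \<and> (\<forall>i. bounded (U i) \<and> diameter (U i) \<le> \<epsilon>)}.
        \<Sum>i. hausdorff_weight s (U i))"

definition hausdorff_measure :: "real \<Rightarrow> 'a::metric_space set \<Rightarrow> ennreal" where
  "hausdorff_measure s E = (SUP \<epsilon>\<in>{0<..}. hausdorff_premeasure s \<epsilon> E)"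

definition hausdorff_dim :: "'a::metric_space set \<Rightarrow> ennreal" where
  "hausdorff_dim E = (INF s\<in>{s. 0 \<le> s \<and> hausdorff_measure s E = 0}. ennreal s)"

subsection \<open>The counting function\<close>

definition N_tilde :: "real \<Rightarrow> real \<Rightarrow> real \<Rightarrow> real \<Rightarrow> nat \<Rightarrow> nat" where
  "N_tilde \<alpha> \<beta> \<gamma> \<delta> N =
     card {n::nat. 2 \<le> n \<and> n \<le> N \<and>
       dist_int (real n * \<alpha> - \<gamma>) * dist_int (real n * \<beta> - \<delta>) \<le> 1 / (real n * ln (real n))}"

definition R_set :: "real \<Rightarrow> real \<Rightarrow> (real \<times> real) set" where
  "R_set \<alpha> \<gamma> =
     {(\<beta>, \<delta>) \<in> Bad_pairs.
        \<exists>c>0. \<forall>\<^sub>F N in sequentially. real (N_tilde \<alpha> \<beta> \<gamma> \<delta> N) \<ge> c * ln (ln (real N))}"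

end

theory Submission
  imports Defs
begin

text \<open>
  The dimension is at most \<open>2\<close> because every subset of the plane has measure zero in dimension
  \<open>s > 2\<close> (\<open>hausdorff_measure_plane_above_2\<close>). For the lower bound fix \<open>s < 2\<close> and a large integer \<open>R\<close>.
  The proof builds a tree of rectangles in the \<open>(\<beta>, \<delta>)\<close>-plane, of width \<open>R\<close> to the power \<open>-2k\<close> and of
  height \<open>R\<close> to the power \<open>-k\<close> at level \<open>k\<close>, whose limit points all belong to the set in question.

  At most levels almost all children are kept. A column of level \<open>k\<close> is so narrow that at most one
  fraction with denominator of order \<open>R\<^sup>k\<close> endangers it, and avoiding a neighbourhood of that fraction
  costs at most three of its \<open>R\<^sup>2\<close> subcolumns; this makes \<open>\<beta>\<close> badly approximable
  (\<open>good_subcolumns\<close>). Once \<open>\<beta>\<close> is known to be badly approximable, the points \<open>q\<beta>\<close> modulo \<open>1\<close> with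
  \<open>q\<close> of order \<open>R\<^sup>k\<close> are so far apart that at most three of the \<open>R\<close> subrows come near one of them;
  avoiding these gives \<open>\<beta> \<in> Bad_inhom \<delta>\<close> (\<open>good_subrows\<close>). The different scales in the two directions
  are forced by this second step: to place \<open>q\<beta>\<close> to within \<open>1/q\<close> one must know \<open>\<beta>\<close> to within \<open>1/q\<^sup>2\<close>.
  Counting rectangles that meet a square shows that the limit set has positive \<open>s\<close>-dimensional measure
  (\<open>anisotropic_tree_measure\<close>).

  Since the denominators of \<open>\<alpha>\<close> grow at most exponentially, on every scale \<open>X\<close> there is \<open>n\<close> with \<open>ln n\<close>
  comparable to \<open>X\<close> and with distance at most \<open>6/n\<close> from \<open>n\<alpha> - \<gamma>\<close> to the integers
  (\<open>good_approximations_at_every_scale\<close>). Such an \<open>n\<close> is counted as soon as \<open>n\<beta> - \<delta>\<close> is within a small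
  multiple of \<open>1 / ln n\<close> of an integer. To reach a count of order \<open>ln (ln N)\<close> it suffices to achieve
  this for one \<open>n\<close> on each of the scales \<open>X = B\<^sup>t\<close>. These scales are so sparse that at the levels involved
  one may afford to keep a single column of each rectangle (\<open>special_level_count\<close>, \<open>product_growth\<close>).

  The heart of the proof is \<open>bad_number_in_strip\<close>: when the tree reaches cells somewhat longer than \<open>1/n\<close>,
  each cell contains a number \<open>\<tau>\<close> for which \<open>n\<tau>\<close> is close to \<open>\<delta>\<close> modulo \<open>1\<close> and which is still badly
  approximable, with a constant that does not deteriorate from one scale to the next. The candidates
  for \<open>\<tau>\<close> are the numbers \<open>M x\<close>, where \<open>M\<close> is the Moebius map of a Farey pair lying in one of many
  subcells and \<open>x\<close> runs through a large finite set of badly approximable numbers; unimodular maps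
  preserve bad approximability. If no candidate were suitable, some exponential sum with the phases
  \<open>h n (M x)\<close> would be large. The Cauchy-Schwarz inequality removes the sum over \<open>x\<close>, after which \<open>x\<close> may be
  allowed to run through a full grid, and van der Corput's method shows that different maps \<open>M\<close> are
  nearly orthogonal. Passing to the full grid costs a power of \<open>R\<^sup>2 / (R\<^sup>2 - 3)\<close>, which for large \<open>R\<close> is
  less than what is gained.
\<close>

section \<open>Exponential sums and oscillatory integrals\<close>

definition unit_exp :: "real \<Rightarrow> complex" where
  "unit_exp t = cis (2 * pi * t)"

lemma norm_unit_exp [simp]: "norm (unit_exp t) = 1"
  by (simp add: unit_exp_def)

lemma unit_exp_add: "unit_exp (s + t) = unit_exp s * unit_exp t"
  by (simp add: unit_exp_def cis_mult distrib_left)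

lemma unit_exp_minus: "unit_exp (- t) = cnj (unit_exp t)"
  by (simp add: unit_exp_def cis_cnj)

lemma unit_exp_diff: "unit_exp (s - t) = unit_exp s * cnj (unit_exp t)"
  using unit_exp_add[of s "-t"] by (simp add: unit_exp_minus)

lemma unit_exp_0 [simp]: "unit_exp 0 = 1"
  by (simp add: unit_exp_def)

lemma unit_exp_of_int [simp]: "unit_exp (of_int n) = 1"
  using cis_multiple_2pi[of "of_int n"] by (simp add: unit_exp_def)

lemma unit_exp_power: "unit_exp t ^ n = unit_exp (real n * t)"
  by (simp add: unit_exp_def Complex.DeMoivre mult_ac)

lemma unit_exp_has_derivative:
  assumes "(f has_real_derivative f') (at x within S)"
  shows "((\<lambda>x. unit_exp (f x)) has_vector_derivative (2 * pi * f') *\<^sub>R (\<i> * unit_exp (f x))) (at x within S)"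
proof -
  have "((\<lambda>x. 2 * pi * f x) has_derivative (\<lambda>t. t *\<^sub>R (2 * pi * f'))) (at x within S)"
    using assms[THEN DERIV_cmult[of _ _ _ _ "2 * pi"]] unfolding has_field_derivative_def
    by (rule has_derivative_eq_rhs) (auto simp: fun_eq_iff)
  from has_derivative_cis[OF this] show ?thesis
    by (simp add: unit_exp_def has_vector_derivative_def)
qed

lemma continuous_on_unit_exp:
  assumes "\<And>x. x \<in> S \<Longrightarrow> (f has_real_derivative f1 x) (at x within S)"
  shows "continuous_on S (\<lambda>x. unit_exp (f x))"
  unfolding continuous_on_eq_continuous_within
  using unit_exp_has_derivative[OF assms] has_vector_derivative_continuous by blast

text \<open>
  Integration by parts: the integrand is the derivative of \<open>unit_exp (f x) / (2 \<pi> i f1 x)\<close>, up to an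
  error controlled by \<open>f2 / f1\<^sup>2\<close>.
\<close>

lemma oscillatory_integral_first_derivative:
  fixes f f1 f2 :: "real \<Rightarrow> real"
  assumes ab: "a \<le> b" and mu: "\<mu> > 0" and nu: "\<nu> \<ge> 0"
    and d1: "\<And>x. x \<in> {a..b} \<Longrightarrow> (f has_real_derivative f1 x) (at x within {a..b})"
    and d2: "\<And>x. x \<in> {a..b} \<Longrightarrow> (f1 has_real_derivative f2 x) (at x within {a..b})"
    and low: "\<And>x. x \<in> {a..b} \<Longrightarrow> \<mu> \<le> \<bar>f1 x\<bar>"
    and up: "\<And>x. x \<in> {a..b} \<Longrightarrow> \<bar>f2 x\<bar> \<le> \<nu>"
  shows "norm (integral {a..b} (\<lambda>x. unit_exp (f x))) \<le> 1 / (pi * \<mu>) + (b - a) * \<nu> / (2 * pi * \<mu>\<^sup>2)"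
proof -
  let ?u = "\<lambda>x. unit_exp (f x)"
  define G where "G x = (1 / (2 * pi * f1 x)) *\<^sub>R (- \<i> * ?u x)" for x
  define E where "E x = (f2 x / (2 * pi * (f1 x)\<^sup>2)) *\<^sub>R (\<i> * ?u x)" for x
  have nz: "f1 x \<noteq> 0" if "x \<in> {a..b}" for x using low[OF that] mu by auto
  have "(G has_vector_derivative (?u x + E x)) (at x within {a..b})" if x: "x \<in> {a..b}" for x
  proof -
    have r: "((\<lambda>x. 1 / (2 * pi * f1 x)) has_real_derivative (- f2 x / (2 * pi * (f1 x)\<^sup>2))) (at x within {a..b})"
      using nz[OF x] by (auto intro!: derivative_eq_intros d2[OF x] simp: field_simps power2_eq_square)
    have v: "((\<lambda>x. - \<i> * ?u x) has_vector_derivative - \<i> * ((2 * pi * f1 x) *\<^sub>R (\<i> * ?u x))) (at x within {a..b})"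
      by (intro has_vector_derivative_mult_right unit_exp_has_derivative d1 x)
    have "(1 / (2 * pi * f1 x)) *\<^sub>R (- \<i> * ((2 * pi * f1 x) *\<^sub>R (\<i> * ?u x)))
        + (- f2 x / (2 * pi * (f1 x)\<^sup>2)) *\<^sub>R (- \<i> * ?u x) = ?u x + E x"
      using nz[OF x] by (simp add: E_def scaleR_conv_of_real)
    with has_vector_derivative_scaleR[OF r v] show ?thesis unfolding G_def by simp
  qed
  then have 1: "((\<lambda>x. ?u x + E x) has_integral (G b - G a)) {a..b}"
    by (intro fundamental_theorem_of_calculus ab)
  have 2: "(?u has_integral integral {a..b} ?u) {a..b}"
    by (intro integrable_integral integrable_continuous_interval continuous_on_unit_exp[OF d1])
  from has_integral_diff[OF 1 2] have 3: "(E has_integral (G b - G a - integral {a..b} ?u)) {a..b}" by simp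
  have "norm (E x) \<le> \<nu> / (2 * pi * \<mu>\<^sup>2)" if x: "x \<in> {a..b}" for x
  proof -
    have "norm (E x) = \<bar>f2 x\<bar> / (2 * pi * (f1 x)\<^sup>2)" by (simp add: E_def norm_mult abs_mult)
    also have "\<dots> \<le> \<nu> / (2 * pi * \<mu>\<^sup>2)"
      using up[OF x] power_mono[OF low[OF x], of 2] mu nu by (intro frac_le mult_left_mono) auto
    finally show ?thesis .
  qed
  then have 4: "norm (G b - G a - integral {a..b} ?u) \<le> \<nu> / (2 * pi * \<mu>\<^sup>2) * (b - a)"
    using has_integral_bound_real[OF _ finite.emptyI 3, where B = "\<nu> / (2 * pi * \<mu>\<^sup>2)"] nu ab by simp
  have 5: "norm (G x) \<le> 1 / (2 * pi * \<mu>)" if x: "x \<in> {a..b}" for x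
  proof -
    have "norm (G x) = 1 / (2 * pi * \<bar>f1 x\<bar>)" by (simp add: G_def norm_mult abs_mult)
    also have "\<dots> \<le> 1 / (2 * pi * \<mu>)" using low[OF x] mu by (intro divide_left_mono) auto
    finally show ?thesis .
  qed
  have "norm (integral {a..b} ?u) = norm (G b - G a - (G b - G a - integral {a..b} ?u))" by simp
  also have "\<dots> \<le> norm (G b) + norm (G a) + norm (G b - G a - integral {a..b} ?u)"
    using norm_triangle_ineq4[of "G b - G a" "G b - G a - integral {a..b} ?u"] norm_triangle_ineq4[of "G b" "G a"] by linarith
  also have "\<dots> \<le> 1 / (2 * pi * \<mu>) + 1 / (2 * pi * \<mu>) + \<nu> / (2 * pi * \<mu>\<^sup>2) * (b - a)"
    using 4 5[of a] 5[of b] ab by (intro add_mono) auto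
  also have "\<dots> = 1 / (pi * \<mu>) + (b - a) * \<nu> / (2 * pi * \<mu>\<^sup>2)"
    using mu by (simp add: field_simps)
  finally show ?thesis .
qed

text \<open>
  The interval of radius \<open>\<eta>\<close> about the possible stationary point \<open>z\<close> is estimated trivially, and on the
  rest the derivative is at least \<open>\<mu> \<eta>\<close>. The point \<open>z\<close> may lie outside the unit interval.
\<close>

lemma oscillatory_integral_stationary_point:
  fixes f f1 f2 :: "real \<Rightarrow> real"
  assumes mu: "\<mu> > 0" and nu: "\<nu> \<ge> 0" and eta: "\<eta> > 0"
    and d1: "\<And>x. x \<in> {0..1} \<Longrightarrow> (f has_real_derivative f1 x) (at x within {0..1})"
    and d2: "\<And>x. x \<in> {0..1} \<Longrightarrow> (f1 has_real_derivative f2 x) (at x within {0..1})"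
    and low: "\<And>x. x \<in> {0..1} \<Longrightarrow> \<mu> * \<bar>x - z\<bar> \<le> \<bar>f1 x\<bar>"
    and up: "\<And>x. x \<in> {0..1} \<Longrightarrow> \<bar>f2 x\<bar> \<le> \<nu>"
  shows "norm (integral {0..1} (\<lambda>x. unit_exp (f x))) \<le> 2 * \<eta> + 2 / (\<mu> * \<eta>) + \<nu> / (\<mu> * \<eta>)\<^sup>2"
proof -
  let ?u = "\<lambda>x. unit_exp (f x)"
  define y1 where "y1 = max 0 (min 1 (z - \<eta>))"
  define y2 where "y2 = max 0 (min 1 (z + \<eta>))"
  have y: "0 \<le> y1" "y1 \<le> y2" "y2 \<le> 1" "y2 - y1 \<le> 2 * \<eta>"
    using eta by (auto simp: y1_def y2_def)
  have int: "?u integrable_on {a..b}" if "0 \<le> a" "b \<le> 1" for a b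
    using that continuous_on_subset[OF continuous_on_unit_exp[OF d1], of "{a..b}"]
    by (intro integrable_continuous_interval) auto
  define K where "K = 1 / (\<mu> * \<eta>) + \<nu> / (2 * (\<mu> * \<eta>)\<^sup>2)"
  have me: "\<mu> * \<eta> > 0" using mu eta by simp
  have K0: "K \<ge> 0" using me nu by (simp add: K_def)
  have piece: "norm (integral {a..b} ?u) \<le> K"
    if ab: "a \<le> b" "0 \<le> a" "b \<le> 1" and far: "\<And>x. x \<in> {a..b} \<Longrightarrow> \<eta> \<le> \<bar>x - z\<bar>" for a b
  proof -
    have "norm (integral {a..b} ?u) \<le> 1 / (pi * (\<mu> * \<eta>)) + (b - a) * \<nu> / (2 * pi * (\<mu> * \<eta>)\<^sup>2)"
    proof (rule oscillatory_integral_first_derivative[OF ab(1) me nu])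
      fix x assume x: "x \<in> {a..b}"
      then have x': "x \<in> {0..1}" using ab by auto
      show "(f has_real_derivative f1 x) (at x within {a..b})" "(f1 has_real_derivative f2 x) (at x within {a..b})"
        using d1[OF x'] d2[OF x'] ab by (auto intro: DERIV_subset)
      show "\<bar>f2 x\<bar> \<le> \<nu>" by (rule up[OF x'])
      have "\<mu> * \<eta> \<le> \<mu> * \<bar>x - z\<bar>" using far[OF x] mu by simp
      then show "\<mu> * \<eta> \<le> \<bar>f1 x\<bar>" using low[OF x'] by linarith
    qed
    also have "\<dots> \<le> K" unfolding K_def
    proof (rule add_mono)
      have p1: "1 \<le> pi" using pi_ge_two by linarith
      then show "1 / (pi * (\<mu> * \<eta>)) \<le> 1 / (\<mu> * \<eta>)"
        using me mult_right_mono[of 1 pi "\<mu> * \<eta>"] by (intro divide_left_mono) auto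
      have "(b - a) * \<nu> \<le> 1 * \<nu>" using ab nu by (intro mult_right_mono) auto
      moreover have "2 * (\<mu> * \<eta>)\<^sup>2 \<le> 2 * pi * (\<mu> * \<eta>)\<^sup>2" using p1 by (intro mult_right_mono) auto
      ultimately show "(b - a) * \<nu> / (2 * pi * (\<mu> * \<eta>)\<^sup>2) \<le> \<nu> / (2 * (\<mu> * \<eta>)\<^sup>2)"
        using me nu by (intro frac_le) auto
    qed
    finally show ?thesis .
  qed
  have A: "norm (integral {0..y1} ?u) \<le> K"
  proof (cases "y1 = 0")
    case False
    then have "y1 \<le> z - \<eta>" by (auto simp: y1_def)
    then show ?thesis using y by (intro piece) auto
  qed (use K0 in auto)
  have C: "norm (integral {y2..1} ?u) \<le> K"
  proof (cases "y2 = 1")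
    case False
    then have "z + \<eta> \<le> y2" by (auto simp: y2_def)
    then show ?thesis using y by (intro piece) auto
  qed (use K0 in auto)
  have B: "norm (integral {y1..y2} ?u) \<le> 2 * \<eta>"
    using has_integral_bound_real[OF _ finite.emptyI integrable_integral[OF int[of y1 y2]], where B = 1] y by auto
  have split: "integral {0..1} ?u = integral {0..y1} ?u + integral {y1..y2} ?u + integral {y2..1} ?u"
    using Henstock_Kurzweil_Integration.integral_combine[where a = 0 and c = y1 and b = 1 and f = ?u]
      Henstock_Kurzweil_Integration.integral_combine[where a = y1 and c = y2 and b = 1 and f = ?u] int y by (auto simp: algebra_simps)
  have "norm (integral {0..1} ?u) \<le> norm (integral {0..y1} ?u) + norm (integral {y1..y2} ?u) + norm (integral {y2..1} ?u)"
    unfolding split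
    using norm_triangle_ineq[of "integral {0..y1} ?u" "integral {y1..y2} ?u"]
      norm_triangle_ineq[of "integral {0..y1} ?u + integral {y1..y2} ?u" "integral {y2..1} ?u"] by linarith
  also have "\<dots> \<le> K + 2 * \<eta> + K" using A B C by linarith
  also have "\<dots> = 2 * \<eta> + 2 / (\<mu> * \<eta>) + \<nu> / (\<mu> * \<eta>)\<^sup>2" by (simp add: K_def field_simps)
  finally show ?thesis .
qed

lemma norm_one_minus_unit_exp_eq:
  "norm (1 - unit_exp y) = 2 * \<bar>sin (pi * y)\<bar>"
proof (rule power2_eq_imp_eq)
  have "(norm (1 - unit_exp y))\<^sup>2 = (1 - cos (2 * pi * y))\<^sup>2 + (sin (2 * pi * y))\<^sup>2"
    by (simp add: unit_exp_def cmod_power2)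
  also have "\<dots> = 2 - 2 * cos (2 * (pi * y))"
    using sin_cos_squared_add[of "2 * pi * y"] by (simp add: power2_eq_square algebra_simps)
  also have "\<dots> = 4 * (sin (pi * y))\<^sup>2" unfolding cos_double_sin by simp
  finally show "(norm (1 - unit_exp y))\<^sup>2 = (2 * \<bar>sin (pi * y)\<bar>)\<^sup>2" by (simp add: power_mult_distrib)
qed auto

lemma norm_unit_exp_diff_le: "norm (unit_exp s - unit_exp t) \<le> 2 * pi * \<bar>s - t\<bar>"
proof -
  have "unit_exp s - unit_exp t = - (unit_exp t * (1 - unit_exp (s - t)))"
    using unit_exp_add[of t "s - t"] by (simp add: right_diff_distrib)
  then have "norm (unit_exp s - unit_exp t) = 2 * \<bar>sin (pi * (s - t))\<bar>"
    by (simp add: norm_mult norm_one_minus_unit_exp_eq)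
  also have "\<dots> \<le> 2 * \<bar>pi * (s - t)\<bar>" using abs_sin_x_le_abs_x[of "pi * (s - t)"] by linarith
  finally show ?thesis by (simp add: abs_mult)
qed

lemma norm_one_minus_unit_exp:
  "norm (1 - unit_exp x) \<ge> 2 * dist_int x"
proof -
  define y where "y = x - of_int (round x)"
  have y: "\<bar>y\<bar> \<le> 1 / 2" unfolding y_def using of_int_round_abs_le[of x] by (simp add: abs_minus_commute)
  have "dist_int x \<le> \<bar>y\<bar>"
    unfolding dist_int_def y_def using infdist_le[of "of_int (round x)" \<int> x] by (simp add: dist_real_def)
  define t where "t = pi * \<bar>y\<bar>"
  have t: "0 \<le> t" "t \<le> 2" using y pi_less_4 by (auto simp: t_def intro!: order_trans[OF mult_mono[of pi 4 "\<bar>y\<bar>" "1/2"]])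
  have "\<bar>sin t - t\<bar> \<le> inverse (fact 3) * \<bar>t\<bar> ^ 3"
    using Maclaurin_sin_bound[of t 3] by (simp add: eval_nat_numeral sin_coeff_def)
  moreover have "inverse (fact 3) * \<bar>t\<bar> ^ 3 \<le> 2/3 * t"
  proof -
    have "t * t * t \<le> 2 * 2 * t" using t by (intro mult_mono) auto
    then show ?thesis using t by (simp add: eval_nat_numeral)
  qed
  ultimately have "t / 3 \<le> sin t" by linarith
  moreover have "norm (1 - unit_exp x) = 2 * \<bar>sin (pi * y)\<bar>"
  proof -
    have "unit_exp x = unit_exp y"
      using unit_exp_add[of y "of_int (round x)"] by (simp add: y_def)
    then show ?thesis by (simp add: norm_one_minus_unit_exp_eq)
  qed
  moreover have "\<bar>sin (pi * y)\<bar> \<ge> sin t"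
    unfolding t_def by (cases "y \<ge> 0") (auto simp: abs_if)
  moreover have "t \<ge> 3 * \<bar>y\<bar>" unfolding t_def using pi_gt3 by (intro mult_right_mono) auto
  ultimately show ?thesis using \<open>dist_int x \<le> \<bar>y\<bar>\<close> by linarith
qed

text \<open>
  On each grid interval the integrand moves by at most \<open>2 \<pi> L / G\<close>, and there are \<open>G\<close> intervals.
\<close>

lemma grid_sum_le_integral:
  fixes f f1 :: "real \<Rightarrow> real" and G :: nat
  assumes G: "G > 0" and L: "L \<ge> 0"
    and d1: "\<And>x. x \<in> {0..1} \<Longrightarrow> (f has_real_derivative f1 x) (at x within {0..1})"
    and up: "\<And>x. x \<in> {0..1} \<Longrightarrow> \<bar>f1 x\<bar> \<le> L"
  shows "norm (\<Sum>a<G. unit_exp (f (real a / real G))) \<le> real G * norm (integral {0..1} (\<lambda>x. unit_exp (f x))) + 2 * pi * L"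
proof -
  let ?u = "\<lambda>x. unit_exp (f x)"
  let ?y = "\<lambda>a::nat. real a / real G"
  have int: "?u integrable_on {a..b}" if "0 \<le> a" "b \<le> 1" for a b
    using that continuous_on_subset[OF continuous_on_unit_exp[OF d1], of "{a..b}"]
    by (intro integrable_continuous_interval) auto
  have lip: "norm (?u x - ?u y) \<le> 2 * pi * L * \<bar>x - y\<bar>" if "x \<in> {0..1}" "y \<in> {0..1}" for x y
  proof -
    have "norm (f x - f y) \<le> L * norm (x - y)"
    proof (rule field_differentiable_bound[of "{0..1}" f f1])
      show "norm (f1 z) \<le> L" if "z \<in> {0..1}" for z using up[OF that] by simp
    qed (use d1 that in auto)
    then have "2 * pi * \<bar>f x - f y\<bar> \<le> 2 * pi * (L * \<bar>x - y\<bar>)" by (intro mult_left_mono) auto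
    also have "\<dots> = 2 * pi * L * \<bar>x - y\<bar>" by simp
    finally show ?thesis using norm_unit_exp_diff_le[of "f x" "f y"] by linarith
  qed
  have cell: "norm (?u (?y a) - of_nat G * integral {?y a..?y (Suc a)} ?u) \<le> 2 * pi * L / real G" if a: "a < G" for a
  proof -
    have y: "0 \<le> ?y a" "?y a \<le> ?y (Suc a)" "?y (Suc a) \<le> 1" "?y (Suc a) - ?y a = 1 / real G"
      using a G by (auto simp: divide_right_mono simp flip: diff_divide_distrib)
    have "((\<lambda>x. ?u (?y a) - ?u x) has_integral ((?y (Suc a) - ?y a) *\<^sub>R ?u (?y a) - integral {?y a..?y (Suc a)} ?u)) {?y a..?y (Suc a)}"
      using has_integral_const_real[of "?u (?y a)" "?y a" "?y (Suc a)"] y int[of "?y a" "?y (Suc a)"]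
      by (intro has_integral_diff integrable_integral) (auto simp del: of_nat_Suc)
    moreover have "norm (?u (?y a) - ?u x) \<le> 2 * pi * L / real G" if "x \<in> {?y a..?y (Suc a)}" for x
    proof -
      have x: "x \<in> {0..1}" "?y a \<in> {0..1}" "\<bar>?y a - x\<bar> \<le> 1 / real G"
        using y that unfolding atLeastAtMost_iff by linarith+
      have "norm (?u (?y a) - ?u x) \<le> 2 * pi * L * \<bar>?y a - x\<bar>" by (rule lip[OF x(2,1)])
      also have "\<dots> \<le> 2 * pi * L * (1 / real G)" using x(3) L by (intro mult_left_mono) auto
      finally show ?thesis by simp
    qed
    ultimately have "norm ((?y (Suc a) - ?y a) *\<^sub>R ?u (?y a) - integral {?y a..?y (Suc a)} ?u) \<le> 2 * pi * L / real G * (1 / real G)"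
      using has_integral_bound_real[OF _ finite.emptyI, where B = "2 * pi * L / real G"] y L
      by (metis (no_types, lifting) Diff_empty content_real divide_nonneg_nonneg mult_nonneg_nonneg of_nat_0_le_iff pi_ge_zero zero_le_numeral)
    then have "real G * norm ((1 / real G) *\<^sub>R ?u (?y a) - integral {?y a..?y (Suc a)} ?u) \<le> real G * (2 * pi * L / real G * (1 / real G))"
      unfolding y(4) by (intro mult_left_mono) auto
    moreover have "real G * norm ((1 / real G) *\<^sub>R ?u (?y a) - integral {?y a..?y (Suc a)} ?u)
       = norm (?u (?y a) - of_nat G * integral {?y a..?y (Suc a)} ?u)"
    proof -
      have "?u (?y a) - of_nat G * integral {?y a..?y (Suc a)} ?u
        = of_nat G * ((1 / real G) *\<^sub>R ?u (?y a) - integral {?y a..?y (Suc a)} ?u)"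
        using G by (simp add: right_diff_distrib scaleR_conv_of_real)
      then show ?thesis by (simp add: norm_mult)
    qed
    ultimately show ?thesis using G by simp
  qed
  have sum_int: "(\<Sum>a<N. integral {?y a..?y (Suc a)} ?u) = integral {0..?y N} ?u" if "N \<le> G" for N
    using that
  proof (induction N)
    case (Suc N)
    have "integral {0..?y N} ?u + integral {?y N..?y (Suc N)} ?u = integral {0..?y (Suc N)} ?u"
      using Suc.prems G
      by (intro Henstock_Kurzweil_Integration.integral_combine int) (auto simp: divide_right_mono)
    then show ?case using Suc by simp
  qed simp
  have split: "(\<Sum>a<G. ?u (?y a)) = (\<Sum>a<G. ?u (?y a) - of_nat G * integral {?y a..?y (Suc a)} ?u) + of_nat G * integral {0..1} ?u"
    using sum_int[of G] G by (simp add: sum_subtractf flip: sum_distrib_left)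
  have "norm (\<Sum>a<G. ?u (?y a)) \<le> norm (\<Sum>a<G. ?u (?y a) - of_nat G * integral {?y a..?y (Suc a)} ?u) + norm (of_nat G * integral {0..1} ?u)"
    by (subst split) (rule norm_triangle_ineq)
  also have "norm (\<Sum>a<G. ?u (?y a) - of_nat G * integral {?y a..?y (Suc a)} ?u) \<le> (\<Sum>a<G. 2 * pi * L / real G)"
    by (intro sum_norm_le cell) auto
  also have "(\<Sum>a<G. 2 * pi * L / real G) = 2 * pi * L" using G by simp
  also have "norm (of_nat G * integral {0..1} ?u) = real G * norm (integral {0..1} ?u)" by (simp add: norm_mult)
  finally show ?thesis by simp
qed

text \<open>
  A quantitative form of Weyl's criterion. If all \<open>f z\<close> were at distance \<open>r\<close> or more from \<open>\<omega>\<close> modulo \<open>1\<close>,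
  the square of the Dirichlet kernel of length \<open>M\<close> would be at most \<open>1/r\<^sup>2\<close> at each \<open>f z - \<omega>\<close>. Smallness of
  the exponential sums forces its average over \<open>Z\<close> to be at least \<open>M/2\<close>.
\<close>

lemma small_exponential_sums_hit:
  fixes f :: "'a \<Rightarrow> real" and M :: nat
  assumes Z: "finite Z" "Z \<noteq> {}" and r: "r > 0" and M: "real M > 2 / r\<^sup>2"
    and S: "\<And>h. 1 \<le> h \<Longrightarrow> h < M \<Longrightarrow> norm (\<Sum>z\<in>Z. unit_exp (real h * f z)) \<le> real (card Z) / (2 * real M)"
  shows "\<exists>z\<in>Z. dist_int (f z - \<omega>) < r"
proof (rule ccontr)
  assume "\<not> ?thesis"
  then have far: "r \<le> dist_int (f z - \<omega>)" if "z \<in> Z" for z using that by force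
  define g where "g z = f z - \<omega>" for z
  define N where "N = real (card Z)"
  have N: "N > 0" using Z by (simp add: N_def card_gt_0_iff)
  have M0: "real M > 0" using M r by (meson divide_pos_pos less_trans zero_less_numeral zero_less_power)
  define D where "D z = (\<Sum>h<M. unit_exp (real h * g z))" for z
  have "norm (D z) \<le> 1 / r" if "z \<in> Z" for z
  proof -
    let ?e = "unit_exp (g z)"
    have n: "norm (1 - ?e) \<ge> 2 * r" using norm_one_minus_unit_exp[of "g z"] far[OF that] by (simp add: g_def)
    have "(1 - ?e) * D z = 1 - ?e ^ M"
      unfolding D_def using one_diff_power_eq[of ?e M] by (simp add: unit_exp_power)
    then have "norm (1 - ?e) * norm (D z) = norm (1 - ?e ^ M)" by (metis norm_mult)
    also have "\<dots> \<le> 2" using norm_triangle_ineq4[of 1 "?e ^ M"] by (simp add: norm_power)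
    finally have "norm (1 - ?e) * norm (D z) \<le> 2" .
    moreover have "2 * r * norm (D z) \<le> norm (1 - ?e) * norm (D z)" using n by (intro mult_right_mono) auto
    ultimately show ?thesis using r by (simp add: field_simps)
  qed
  then have "(norm (D z))\<^sup>2 \<le> (1 / r)\<^sup>2" if "z \<in> Z" for z using that by (intro power_mono) auto
  then have "(\<Sum>z\<in>Z. (norm (D z))\<^sup>2) \<le> (\<Sum>z\<in>Z. (1 / r)\<^sup>2)" by (intro sum_mono)
  then have upper: "(\<Sum>z\<in>Z. (norm (D z))\<^sup>2) \<le> N * (1 / r)\<^sup>2" by (simp add: N_def)
  define T where "T h h' = (\<Sum>z\<in>Z. unit_exp (real h * g z - real h' * g z))" for h h' :: nat
  have "of_real (\<Sum>z\<in>Z. (norm (D z))\<^sup>2) = (\<Sum>z\<in>Z. D z * cnj (D z))"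
    by (simp only: of_real_sum complex_norm_square)
  also have "\<dots> = (\<Sum>z\<in>Z. \<Sum>h<M. \<Sum>h'<M. unit_exp (real h * g z - real h' * g z))"
    by (simp add: D_def sum_product unit_exp_diff)
  also have "\<dots> = (\<Sum>h<M. \<Sum>h'<M. T h h')"
    unfolding T_def by (subst sum.swap, intro sum.cong refl, subst sum.swap) simp
  finally have eq: "of_real (\<Sum>z\<in>Z. (norm (D z))\<^sup>2) = (\<Sum>h<M. \<Sum>h'<M. T h h')" .
  have T1: "norm (T h h') \<le> N / (2 * real M)" if "h < M" "h' < h" for h h'
  proof -
    have "T h h' = (\<Sum>z\<in>Z. unit_exp (- (real (h - h') * \<omega>)) * unit_exp (real (h - h') * f z))"
      unfolding T_def g_def using that by (intro sum.cong refl) (simp add: of_nat_diff algebra_simps flip: unit_exp_add)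
    then have "norm (T h h') = norm (\<Sum>z\<in>Z. unit_exp (real (h - h') * f z))"
      by (simp add: norm_mult flip: sum_distrib_left)
    then show ?thesis using S[of "h - h'"] that by (simp add: N_def)
  qed
  have T2: "T h' h = cnj (T h h')" for h h'
    unfolding T_def by (simp add: flip: unit_exp_minus)
  have T3: "T h h = of_real N" for h by (simp add: T_def N_def)
  have Tall: "norm (T h h' - (if h = h' then of_real N else 0)) \<le> N / (2 * real M)" if "h < M" "h' < M" for h h'
    using T1[of h h'] T1[of h' h] T2[of h h'] T3[of h] that N M0
    by (cases h h' rule: linorder_cases) auto
  have "(\<Sum>h<M. \<Sum>h'<M. T h h' - (if h = h' then of_real N else 0)) = (\<Sum>h<M. \<Sum>h'<M. T h h') - of_real (real M * N)"
    by (simp add: sum_subtractf)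
  moreover have "norm (\<Sum>h<M. \<Sum>h'<M. T h h' - (if h = h' then of_real N else 0)) \<le> (\<Sum>h<M. \<Sum>h'<M. N / (2 * real M))"
    by (intro sum_norm_le Tall) auto
  moreover have "(\<Sum>h<M. \<Sum>h'<M. N / (2 * real M)) = real M * N / 2" using M0 by simp
  ultimately have "norm (of_real (\<Sum>z\<in>Z. (norm (D z))\<^sup>2) - complex_of_real (real M * N)) \<le> real M * N / 2"
    unfolding eq by simp
  then have "\<bar>(\<Sum>z\<in>Z. (norm (D z))\<^sup>2) - real M * N\<bar> \<le> real M * N / 2"
    by (metis norm_of_real of_real_diff)
  then have "real M * N / 2 \<le> N * (1 / r)\<^sup>2" using upper by linarith
  then have "real M \<le> 2 / r\<^sup>2" using N r by (simp add: field_simps)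
  then show False using M by simp
qed

section \<open>Grid cells avoiding rational numbers\<close>

text \<open>
  Cells are closed, so that limit sets are compact; neighbouring cells share an endpoint.
\<close>

definition gridcell :: "nat \<Rightarrow> nat \<Rightarrow> int \<Rightarrow> real set" where
  "gridcell m k a = {of_int a / real m ^ k .. (of_int a + 1) / real m ^ k}"

definition subcells :: "nat \<Rightarrow> int \<Rightarrow> int set" where
  "subcells m a = {int m * a ..< int m * a + int m}"

text \<open>
  The usual condition on \<open>q\<close> times the distance from \<open>qx\<close> to the integers, restricted to a range of
  denominators. A range containing \<open>q = 0\<close> is harmless because \<open>c / 0 = 0\<close>.
\<close>

definition bad_between :: "real \<Rightarrow> real \<Rightarrow> real \<Rightarrow> real \<Rightarrow> bool" where
  "bad_between c lo hi x \<longleftrightarrow>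
     (\<forall>q::nat. \<forall>p::int. lo \<le> real q \<and> real q < hi \<longrightarrow> \<bar>real q * x - of_int p\<bar> \<ge> c / real q)"

lemma bad_betweenD:
  "bad_between c lo hi x \<Longrightarrow> lo \<le> real q \<Longrightarrow> real q < hi \<Longrightarrow> \<bar>real q * x - of_int p\<bar> \<ge> c / real q"
  by (auto simp: bad_between_def)

lemma bad_between_int:
  assumes "bad_between c lo hi x" "lo \<le> \<bar>real_of_int q\<bar>" "\<bar>real_of_int q\<bar> < hi"
  shows "\<bar>of_int q * x - of_int p\<bar> \<ge> c / \<bar>of_int q\<bar>"
proof (cases "q \<ge> 0")
  case True
  then show ?thesis using bad_betweenD[OF assms(1), of "nat q" p] assms(2,3) by simp
next
  case False
  then have "\<bar>real (nat (-q)) * x - of_int (-p)\<bar> \<ge> c / real (nat (-q))"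
    using assms(2,3) by (intro bad_betweenD[OF assms(1)]) auto
  moreover have "\<bar>real (nat (-q)) * x - of_int (-p)\<bar> = \<bar>of_int q * x - of_int p\<bar>"
    using False by (simp add: abs_if)
  ultimately show ?thesis using False by simp
qed

lemma bad_between_mono:
  assumes "bad_between c lo hi x" "c' \<le> c" "lo \<le> lo'" "hi' \<le> hi"
  shows "bad_between c' lo' hi' x"
  unfolding bad_between_def
proof (intro allI impI)
  fix q :: nat and p :: int
  assume "lo' \<le> real q \<and> real q < hi'"
  then have "c / real q \<le> \<bar>real q * x - of_int p\<bar>"
    using bad_betweenD[OF assms(1), of q p] assms(3,4) by linarith
  moreover have "c' / real q \<le> c / real q"
    using assms(2) by (simp add: divide_right_mono)
  ultimately show "c' / real q \<le> \<bar>real q * x - of_int p\<bar>" by linarith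
qed

lemma bad_between_join:
  assumes "bad_between c lo mid x" "bad_between c mid hi x"
  shows "bad_between c lo hi x"
  using assms unfolding bad_between_def by (meson linorder_not_le)

lemma subcells_finite [simp]: "finite (subcells m a)"
  and card_subcells [simp]: "card (subcells m a) = m"
  by (simp_all add: subcells_def)

lemma subcells_div: "a' \<in> subcells m a \<Longrightarrow> a' div int m = a"
  unfolding subcells_def by (intro int_div_pos_eq[of _ _ _ "a' - int m * a"]) auto

lemma subcells_disjoint: "x \<in> subcells m a \<Longrightarrow> x \<in> subcells m b \<Longrightarrow> a = b"
  using subcells_div by blast

lemma gridcell_subcell:
  assumes "a' \<in> subcells m a" "m > 0"
  shows "gridcell m (Suc k) a' \<subseteq> gridcell m k a"
proof -
  have "real_of_int (int m * a) \<le> of_int a'" "of_int (a' + 1) \<le> real_of_int (int m * a + int m)"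
    using assms(1) unfolding subcells_def by (simp_all only: of_int_le_iff) auto
  then have 1: "real m * of_int a \<le> of_int a'" "of_int a' + 1 \<le> real m * (of_int a + 1)"
    by (simp_all add: algebra_simps)
  have "of_int a / real m ^ k = (real m * of_int a) / real m ^ Suc k"
    "(of_int a + 1) / real m ^ k = (real m * (of_int a + 1)) / real m ^ Suc k"
    using assms(2) by simp_all
  then have "of_int a / real m ^ k \<le> of_int a' / real m ^ Suc k"
    "(of_int a' + 1) / real m ^ Suc k \<le> (of_int a + 1) / real m ^ k"
    using 1 by (simp_all only:) (intro divide_right_mono; simp)+
  then show ?thesis unfolding gridcell_def by auto
qed

lemma gridcell_dist:
  assumes "x \<in> gridcell m k a" "y \<in> gridcell m k a"
  shows "\<bar>x - y\<bar> \<le> 1 / real m ^ k"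
proof -
  have "(of_int a + 1) / real m ^ k = of_int a / real m ^ k + 1 / real m ^ k"
    by (simp add: add_divide_distrib)
  then show ?thesis using assms unfolding gridcell_def by auto
qed

lemma gridcell_cover:
  assumes "x \<in> gridcell m k a" "m > 0"
  obtains a' where "a' \<in> subcells m a" "x \<in> gridcell m (Suc k) a'"
proof -
  define y where "y = x * real m ^ Suc k"
  have x: "x = y / real m ^ Suc k" using assms(2) by (simp add: y_def)
  have 1: "of_int (int m * a) \<le> y" "y \<le> of_int (int m * a + int m)"
  proof -
    have pos: "real m ^ k > 0" using assms by simp
    have "of_int a \<le> x * real m ^ k" "x * real m ^ k \<le> of_int a + 1"
      using assms(1) pos by (auto simp: gridcell_def field_simps)
    then have "real m * of_int a \<le> real m * (x * real m ^ k)"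
      "real m * (x * real m ^ k) \<le> real m * (of_int a + 1)"
      by (auto intro!: mult_left_mono simp del: mult_le_cancel_left_pos)
    then show "of_int (int m * a) \<le> y" "y \<le> of_int (int m * a + int m)"
      by (simp_all add: y_def algebra_simps)
  qed
  show thesis
  proof (cases "y = of_int (int m * a + int m)")
    case True
    let ?a = "int m * a + int m - 1"
    show thesis
    proof (rule that)
      show "?a \<in> subcells m a" using assms(2) by (auto simp: subcells_def)
      show "x \<in> gridcell m (Suc k) ?a"
        unfolding gridcell_def x True by (simp add: divide_right_mono)
    qed
  next
    case False
    show thesis
    proof (rule that)
      show "\<lfloor>y\<rfloor> \<in> subcells m a"
        using 1 False unfolding subcells_def
        by (auto simp: le_floor_iff floor_less_iff)
      show "x \<in> gridcell m (Suc k) \<lfloor>y\<rfloor>"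
        unfolding gridcell_def x
        by (auto simp del: power_Suc intro!: divide_right_mono)
    qed
  qed
qed

lemma card_cells_near_point:
  assumes "m > 0" and near: "\<And>a. a \<in> A \<Longrightarrow> \<exists>x\<in>gridcell m k a. \<bar>x - z\<bar> < 1 / real m ^ k"
  shows "finite A" "card A \<le> 3"
proof -
  let ?f = "\<lfloor>z * real m ^ k\<rfloor>"
  have "A \<subseteq> {?f - 1, ?f, ?f + 1}"
  proof
    fix a assume "a \<in> A"
    then obtain x where x: "x \<in> gridcell m k a" "\<bar>x - z\<bar> < 1 / real m ^ k"
      using near by blast
    have pos: "real m ^ k > 0" using assms by simp
    have one: "1 / Y * Y = 1" if "Y > 0" for Y :: real using that by simp
    have "\<bar>x * real m ^ k - z * real m ^ k\<bar> = \<bar>x - z\<bar> * real m ^ k"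
      using pos by (simp add: abs_mult flip: left_diff_distrib)
    also have "\<dots> < 1"
      using mult_strict_right_mono[OF x(2) pos] one[OF pos] by simp
    finally have "\<bar>x * real m ^ k - z * real m ^ k\<bar> < 1" .
    moreover have "of_int a \<le> x * real m ^ k" "x * real m ^ k \<le> of_int a + 1"
      using x(1) pos by (auto simp: gridcell_def field_simps)
    ultimately have "of_int a < z * real m ^ k + 1" "z * real m ^ k - 2 < of_int a"
      by linarith+
    then have "a \<le> ?f + 1" "?f - 1 \<le> a" by linarith+
    then show "a \<in> {?f - 1, ?f, ?f + 1}" by auto
  qed
  note sub = this
  then show "finite A" by (rule finite_subset) simp
  from sub have "card A \<le> card {?f - 1, ?f, ?f + 1}" by (intro card_mono) auto
  also have "\<dots> \<le> 3" by (simp add: card_insert_if)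
  finally show "card A \<le> 3" .
qed

lemma unkilled_subcells:
  assumes "card {a' \<in> subcells m a. P a'} \<le> 3"
  obtains S where "S \<subseteq> subcells m a" "card S = m - 3" "\<And>a'. a' \<in> S \<Longrightarrow> \<not> P a'"
proof -
  let ?G = "subcells m a - {a' \<in> subcells m a. P a'}"
  have "card ?G = m - card {a' \<in> subcells m a. P a'}"
    by (subst card_Diff_subset) auto
  then have "m - 3 \<le> card ?G" using assms by simp
  then obtain S where "S \<subseteq> ?G" "card S = m - 3" "finite S"
    by (rule obtain_subset_with_card_n)
  then show thesis using that[of S] by blast
qed

lemma fraction_gap:
  fixes p p' :: int and q q' :: nat
  assumes "q > 0" "q' > 0" "real_of_int p / real q \<noteq> of_int p' / real q'"
  shows "\<bar>real_of_int p / real q - of_int p' / real q'\<bar> \<ge> 1 / (real q * real q')"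
proof -
  have eq: "real_of_int p / real q - of_int p' / real q'
     = of_int (p * int q' - p' * int q) / (real q * real q')"
    using assms by (simp add: field_simps)
  have "p * int q' - p' * int q \<noteq> 0"
  proof
    assume "p * int q' - p' * int q = 0"
    then have "real_of_int p / real q - of_int p' / real q' = 0" unfolding eq by simp
    then show False using assms(3) by simp
  qed
  then have "\<bar>p * int q' - p' * int q\<bar> \<ge> 1" by linarith
  then have "\<bar>real_of_int (p * int q' - p' * int q)\<bar> \<ge> 1" by linarith
  then show ?thesis unfolding eq using assms(1,2)
    by (auto simp: abs_mult intro!: divide_right_mono)
qed

text \<open>
  Two distinct fractions with denominators below \<open>hi\<close> are further apart than twice the length of the
  cell. Hence a single fraction can endanger points of the cell, and the neighbourhood of it that has
  to be avoided is at most as long as one subcell, so that it meets at most three of them.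
\<close>

lemma good_subcolumns:
  assumes m: "m > 0" and lo: "lo > 0" and hi: "hi\<^sup>2 \<le> real m ^ k / 4" "hi > 0"
    and c: "c \<le> lo\<^sup>2 / (2 * real m ^ Suc k)"
  obtains S where "S \<subseteq> subcells m a" "card S = m - 3"
    "\<And>a' x. a' \<in> S \<Longrightarrow> x \<in> gridcell m (Suc k) a' \<Longrightarrow> bad_between c lo hi x"
proof -
  define P where "P a' \<longleftrightarrow> (\<exists>x\<in>gridcell m (Suc k) a'. \<not> bad_between c lo hi x)" for a'
  have wit: "\<exists>x\<in>gridcell m (Suc k) a'. \<exists>p q. 0 < q \<and> real q < hi \<and> \<bar>x - of_int p / real q\<bar> < 1 / (2 * real m ^ Suc k)"
    if PA: "P a'" for a'
  proof -
    obtain x where x0: "x \<in> gridcell m (Suc k) a'" "\<not> bad_between c lo hi x"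
      using PA unfolding P_def by blast
    then obtain q p where "lo \<le> real q" "real q < hi" "\<bar>real q * x - of_int p\<bar> < c / real q"
      unfolding bad_between_def not_all not_imp not_le by blast
    note x = x0(1) this
    have q: "real q > 0" using x lo by linarith
    have "\<bar>x - of_int p / real q\<bar> = \<bar>real q * x - of_int p\<bar> / real q"
      using q by (subst abs_div_pos[OF q]) (simp add: field_simps)
    also have "\<dots> < c / real q / real q" by (rule divide_strict_right_mono[OF x(4) q])
    also have "\<dots> = c / (real q)\<^sup>2" by (simp add: power2_eq_square)
    also have "\<dots> \<le> (lo\<^sup>2 / (2 * real m ^ Suc k)) / (real q)\<^sup>2"
      using c by (intro divide_right_mono) auto
    also have "\<dots> = (lo\<^sup>2 / (real q)\<^sup>2) * (1 / (2 * real m ^ Suc k))" by simp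
    also have "\<dots> \<le> 1 * (1 / (2 * real m ^ Suc k))"
      using x(2) lo q by (intro mult_right_mono) (auto simp: power_mono divide_le_eq_1)
    finally show ?thesis using x q by auto
  qed
  have "card {a' \<in> subcells m a. P a'} \<le> 3"
  proof (cases "\<exists>a'\<in>subcells m a. P a'")
    case False
    then have e: "{a' \<in> subcells m a. P a'} = {}" by auto
    show ?thesis unfolding e by simp
  next
    case True
    then obtain a0 where a0: "a0 \<in> subcells m a" "P a0" by auto
    then obtain x0 p0 q0 where 0: "x0 \<in> gridcell m (Suc k) a0" "0 < q0" "real q0 < hi"
      "\<bar>x0 - of_int p0 / real q0\<bar> < 1 / (2 * real m ^ Suc k)" using wit[OF a0(2)] by blast
    show ?thesis
    proof (rule card_cells_near_point(2)[OF m, of _ "Suc k" "of_int p0 / real q0"])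
      fix a' assume "a' \<in> {a' \<in> subcells m a. P a'}"
      then have a': "a' \<in> subcells m a" "P a'" by auto
      then obtain x p q where 1: "x \<in> gridcell m (Suc k) a'" "0 < q" "real q < hi"
        "\<bar>x - of_int p / real q\<bar> < 1 / (2 * real m ^ Suc k)" using wit[OF a'(2)] by blast
      have "x \<in> gridcell m k a" "x0 \<in> gridcell m k a"
        using gridcell_subcell[OF a'(1) m, of k] gridcell_subcell[OF a0(1) m, of k] 0(1) 1(1) by auto
      then have dxx: "\<bar>x - x0\<bar> \<le> 1 / real m ^ k" by (rule gridcell_dist)
      have "of_int p / real q = of_int p0 / real q0"
      proof (rule ccontr)
        assume "of_int p / real q \<noteq> of_int p0 / real q0"
        then have "1 / (real q * real q0) \<le> \<bar>of_int p / real q - of_int p0 / real q0\<bar>"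
          by (rule fraction_gap[OF 1(2) 0(2)])
        also have "\<dots> \<le> \<bar>x - x0\<bar> + \<bar>x - of_int p / real q\<bar> + \<bar>x0 - of_int p0 / real q0\<bar>" by linarith
        also have "\<dots> < 1 / real m ^ k + 1 / (2 * real m ^ Suc k) + 1 / (2 * real m ^ Suc k)"
          using dxx 0(4) 1(4) by linarith
        also have "\<dots> = 1 / real m ^ k + 1 / real m ^ Suc k" by (simp add: field_simps)
        also have "\<dots> \<le> 1 / real m ^ k + 1 / real m ^ k"
          using m by (intro add_mono divide_left_mono) auto
        finally have "1 / (real q * real q0) < 2 / real m ^ k" by simp
        moreover have "real q * real q0 \<le> hi\<^sup>2"
          using 0 1 by (simp add: power2_eq_square mult_mono)
        then have "real q * real q0 \<le> real m ^ k / 4" using hi by linarith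
        then have "1 / (real q * real q0) \<ge> 1 / (real m ^ k / 4)"
          by (intro frac_le) (use 0(2) 1(2) in auto)
        moreover have "1 / (real m ^ k / 4) = 4 / real m ^ k" by simp
        moreover have "4 / real m ^ k \<ge> 2 / real m ^ k" by (simp add: divide_right_mono)
        ultimately show False by (metis leD order.strict_trans1 order.trans)
      qed
      then have "\<bar>x - of_int p0 / real q0\<bar> < 1 / (2 * real m ^ Suc k)" using 1(4) by simp
      also have "\<dots> \<le> 1 / real m ^ Suc k" using m by (intro divide_left_mono) auto
      finally show "\<exists>x\<in>gridcell m (Suc k) a'. \<bar>x - of_int p0 / real q0\<bar> < 1 / real m ^ Suc k"
        using 1(1) by blast
    qed
  qed
  from unkilled_subcells[OF this] obtain S where
    "S \<subseteq> subcells m a" "card S = m - 3" "\<And>a'. a' \<in> S \<Longrightarrow> \<not> P a'" by auto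
  then show thesis using that[of S] unfolding P_def by blast
qed

text \<open>
  Iterating \<open>good_subcolumns\<close> with \<open>lo\<close> and \<open>hi\<close> growing like \<open>R\<^sup>k\<close>. The constant that it allows is then
  the same at every level.
\<close>

lemma good_descendants:
  fixes R m l L :: nat and root :: int
  assumes R: "R > 0" and m: "m = R\<^sup>2"
  shows "\<exists>S. finite S \<and> card S = (m - 3) ^ L \<and>
    (\<forall>a\<in>S. gridcell m (l + L) a \<subseteq> gridcell m l root) \<and>
    (\<forall>a\<in>S. \<forall>x\<in>gridcell m (l + L) a.
       bad_between (1 / (8 * (real m)\<^sup>2)) (real R ^ l / (2 * real R)) (real R ^ (l + L) / (2 * real R)) x)"
proof (induction L)
  case 0
  show ?case by (rule exI[of _ "{root}"]) (auto simp: bad_between_def)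
next
  case (Suc L)
  let ?c = "1 / (8 * (real m)\<^sup>2)"
  from Suc obtain S where S: "finite S" "card S = (m - 3) ^ L"
    "\<And>a. a \<in> S \<Longrightarrow> gridcell m (l + L) a \<subseteq> gridcell m l root"
    "\<And>a x. a \<in> S \<Longrightarrow> x \<in> gridcell m (l + L) a \<Longrightarrow>
       bad_between ?c (real R ^ l / (2 * real R)) (real R ^ (l + L) / (2 * real R)) x" by blast
  have m0: "m > 0" using R m by simp
  have mk: "real m ^ (l + L) = (real R ^ (l + L))\<^sup>2" by (simp add: m power_even_eq power2_eq_square power_mult_distrib)
  have ex: "\<exists>T. T \<subseteq> subcells m a \<and> card T = m - 3 \<and> (\<forall>a'\<in>T. \<forall>x\<in>gridcell m (Suc (l + L)) a'.
     bad_between ?c (real R ^ (l + L) / (2 * real R)) (real R ^ (l + Suc L) / (2 * real R)) x)" for a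
  proof -
    have 1: "0 < real R ^ (l + L) / (2 * real R)" using R by simp
    have 2: "(real R ^ (l + Suc L) / (2 * real R))\<^sup>2 \<le> real m ^ (l + L) / 4"
      using R unfolding mk by (simp add: field_simps)
    have 3: "real R ^ (l + Suc L) / (2 * real R) > 0" using R by simp
    have 4: "?c \<le> (real R ^ (l + L) / (2 * real R))\<^sup>2 / (2 * real m ^ Suc (l + L))"
      using R unfolding power_Suc mk by (simp add: m field_simps)
    show ?thesis by (rule good_subcolumns[OF m0 1 2 3 4, of a]) blast
  qed
  define P where "P a' \<longleftrightarrow> (\<forall>x\<in>gridcell m (Suc (l + L)) a'.
     bad_between ?c (real R ^ (l + L) / (2 * real R)) (real R ^ (l + Suc L) / (2 * real R)) x)" for a'
  have "\<forall>a. \<exists>T. T \<subseteq> subcells m a \<and> card T = m - 3 \<and> (\<forall>a'\<in>T. P a')"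
    using ex unfolding P_def by blast
  from choice[OF this] obtain f where f0: "\<forall>a. f a \<subseteq> subcells m a \<and> card (f a) = m - 3 \<and> (\<forall>a'\<in>f a. P a')"
    by (rule exE)
  have f1: "f a \<subseteq> subcells m a" and f2: "card (f a) = m - 3" and f3: "a' \<in> f a \<Longrightarrow> P a'" for a a'
    using f0[rule_format, of a] by simp_all
  have fin: "finite (f a)" for a by (rule finite_subset[OF f1]) simp
  have "card (\<Union>a\<in>S. f a) = (\<Sum>a\<in>S. card (f a))"
  proof (rule card_UN_disjoint)
    show "\<forall>i\<in>S. \<forall>j\<in>S. i \<noteq> j \<longrightarrow> f i \<inter> f j = {}"
      using f1 subcells_disjoint by blast
  qed (use S fin in auto)
  then have "card (\<Union>a\<in>S. f a) = (m - 3) ^ Suc L" by (simp add: S(2) f2)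
  moreover have "gridcell m (l + Suc L) a' \<subseteq> gridcell m l root" if "a \<in> S" "a' \<in> f a" for a a'
    using gridcell_subcell[of a' m a "l + L"] f1[of a] that S(3)[OF that(1)] m0 by auto
  moreover have "bad_between ?c (real R ^ l / (2 * real R)) (real R ^ (l + Suc L) / (2 * real R)) x"
    if "a \<in> S" "a' \<in> f a" "x \<in> gridcell m (l + Suc L) a'" for a a' x
  proof (rule bad_between_join)
    show "bad_between ?c (real R ^ l / (2 * real R)) (real R ^ (l + L) / (2 * real R)) x"
      using S(4)[OF that(1)] gridcell_subcell[of a' m a "l + L"] f1[of a] that m0 by auto
    show "bad_between ?c (real R ^ (l + L) / (2 * real R)) (real R ^ (l + Suc L) / (2 * real R)) x"
      using f3[OF that(2)] that(3) unfolding P_def by simp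
  qed
  ultimately show ?case using S(1) fin by (intro exI[of _ "\<Union>a\<in>S. f a"]) auto
qed

section \<open>Farey pairs, Moebius images and lattice points\<close>

text \<open>
  Dirichlet's theorem at the centre of the cell gives a fraction \<open>p/q\<close> inside the cell with \<open>q\<close> at most a
  constant times \<open>R\<^sup>l\<close>. Bad approximability prevents \<open>q\<close> from being much smaller. The Farey neighbour
  with \<open>q'\<close> about \<open>4 m\<^sup>2 q\<close> is so close to \<open>p/q\<close> that it lies in the cell as well. For denominators below
  \<open>lo\<close> a weak constant \<open>cb\<close> is enough, since \<open>lo\<close> is small in comparison with \<open>R\<^sup>l\<close>.
\<close>

lemma farey_pair_in_cell:
  fixes R m l :: nat and u :: int
  assumes R: "R \<ge> 2" and m: "m = R\<^sup>2"
    and weak: "\<And>x. x \<in> gridcell m l u \<Longrightarrow> bad_between cb 0 lo x"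
    and strong: "\<And>x. x \<in> gridcell m l u \<Longrightarrow> bad_between (1 / (8 * (real m)\<^sup>2)) lo (real R ^ l / (2 * real R)) x"
    and lo: "lo \<le> cb * (8 * real m * real R ^ l)"
  obtains p q p' q' :: int where
    "p' * q - p * q' = 1" "0 < q" "real R ^ l / real m \<le> q" "q \<le> 8 * real m * real R ^ l"
    "4 * (real m)\<^sup>2 * q \<le> q'" "q' \<le> (4 * (real m)\<^sup>2 + 1) * q"
    "of_int p / of_int q \<in> {of_int u / real m ^ l <..< (of_int u + 1) / real m ^ l}"
    "of_int p' / of_int q' \<in> {of_int u / real m ^ l <..< (of_int u + 1) / real m ^ l}"
    "of_int p / real_of_int q < of_int p' / of_int q'"
proof -
  have m0: "m > 0" and m4: "m \<ge> 4" using R m power_mono[of 2 R 2] by auto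
  \<comment> \<open>The factor \<open>8 m\<close> is what makes \<open>1 / (q Q)\<close> at most an eighth of the length of the cell.\<close>
  define Q where "Q = 8 * m * R ^ l"
  have Q0: "Q > 0" using R m0 by (simp add: Q_def)
  define x where "x = (of_int u + 1/2) / real m ^ l"
  have ml: "real m ^ l = (real R ^ l)\<^sup>2" by (simp add: m power_even_eq power2_eq_square power_mult_distrib)
  have Rl: "real R ^ l > 0" using R by simp
  have xin: "x \<in> gridcell m l u" unfolding gridcell_def x_def by (auto intro!: divide_right_mono)
  obtain p q where pq: "coprime p q" "0 < q" "q \<le> int Q" "\<bar>of_int q * x - of_int p\<bar> < 1 / real Q"
    using Dirichlet_approx_coprime[OF Q0] by metis
  have qR: "real_of_int q \<le> 8 * real m * real R ^ l"
    using pq(3) unfolding Q_def by (metis of_int_le_iff of_int_of_nat_eq of_nat_mult of_nat_numeral of_nat_power)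
  have qlow: "real R ^ l / real m \<le> q"
  proof -
    have aq: "\<bar>real_of_int q\<bar> = q" using pq(2) by simp
    have Qr: "real Q = 8 * real m * real R ^ l" by (simp add: Q_def)
    consider "real_of_int q < lo" | "lo \<le> q" "real_of_int q < real R ^ l / (2 * real R)" | "real R ^ l / (2 * real R) \<le> q"
      by linarith
    then show ?thesis
    proof cases
      case 1
      then have "cb / q \<le> \<bar>of_int q * x - of_int p\<bar>"
        using bad_between_int[OF weak[OF xin], of q p] pq(2) by simp
      then have "cb / q < 1 / real Q" using pq(4) by linarith
      then have "cb * real Q < q" using pq(2) Q0 by (simp add: field_simps)
      then show ?thesis using 1 lo by (simp add: Qr)
    next
      case 2
      then have "1 / (8 * (real m)\<^sup>2) / q \<le> \<bar>of_int q * x - of_int p\<bar>"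
        using bad_between_int[OF strong[OF xin], of q p] pq(2) by simp
      then have "1 / (8 * (real m)\<^sup>2) / q < 1 / real Q" using pq(4) by linarith
      then have "real Q < q * (8 * (real m)\<^sup>2)" using pq(2) Q0 m0 by (simp add: field_simps)
      then have "8 * real m * real R ^ l < 8 * real m * (q * real m)"
        by (simp add: Qr power2_eq_square mult_ac)
      then have "real R ^ l < q * real m" using m0 by simp
      then show ?thesis using m0 by (simp add: field_simps)
    next
      case 3
      have "real R ^ l / real m \<le> real R ^ l / (2 * real R)"
        using R by (intro divide_left_mono) (auto simp: m power2_eq_square)
      then show ?thesis using 3 by linarith
    qed
  qed
  have close: "\<bar>of_int p / of_int q - x\<bar> \<le> 1 / (8 * real m ^ l)"
  proof -
    have "\<bar>of_int p / of_int q - x\<bar> = \<bar>of_int q * x - of_int p\<bar> / q"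
    proof -
      have "of_int q * x - of_int p = of_int q * (x - of_int p / of_int q)"
        using pq(2) by (simp add: right_diff_distrib)
      then show ?thesis using pq(2) by (simp add: abs_mult abs_minus_commute)
    qed
    also have "\<dots> \<le> (1 / real Q) / q" using pq by (intro divide_right_mono) auto
    also have "\<dots> \<le> (1 / real Q) / (real R ^ l / real m)"
      using qlow Rl m0 pq(2) by (intro divide_left_mono) auto
    also have "\<dots> = 1 / (8 * real m ^ l)" using m0 Rl
      by (simp add: Q_def ml power2_eq_square field_simps)
    finally show ?thesis .
  qed
  define T where "T = 4 * (int m)\<^sup>2"
  have T0: "T > 0" using m0 by (simp add: T_def)
  obtain s t where st: "s * q + t * p = 1" using pq(1)
    by (metis bezout_int coprime_iff_gcd_eq_1 gcd.commute)
  define j where "j = T - ((- t) div q)"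
  define q' where "q' = - t + j * q"
  define p' where "p' = s + j * p"
  have det: "p' * q - p * q' = 1" using st by (simp add: p'_def q'_def algebra_simps)
  have q'eq: "q' = (- t) mod q + T * q"
    unfolding q'_def j_def using mult_div_mod_eq[of q "-t"] by (simp add: algebra_simps)
  have q'1: "T * q \<le> q'" "q' \<le> (T + 1) * q"
  proof -
    have "0 \<le> (- t) mod q" "(- t) mod q < q" using pq(2) by simp_all
    then show "T * q \<le> q'" "q' \<le> (T + 1) * q" unfolding q'eq distrib_right by linarith+
  qed
  have q'0: "q' > 0" using q'1 T0 pq(2) by (meson less_le_trans mult_pos_pos)
  have Tr: "real_of_int T = 4 * (real m)\<^sup>2" by (simp add: T_def)
  have q'r: "4 * (real m)\<^sup>2 * q \<le> q'" "q' \<le> (4 * (real m)\<^sup>2 + 1) * q"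
    using q'1 unfolding Tr[symmetric] by (metis of_int_le_iff of_int_mult, metis of_int_le_iff of_int_mult of_int_add of_int_1)
  have diff: "of_int p' / of_int q' - of_int p / real_of_int q = 1 / (of_int q * of_int q')"
  proof -
    have "of_int p' / of_int q' - of_int p / real_of_int q = of_int (p' * q - p * q') / (of_int q * of_int q')"
      using pq(2) q'0 by (simp add: field_simps)
    then show ?thesis by (simp add: det)
  qed
  have diff2: "1 / (real_of_int q * of_int q') \<le> 1 / (4 * real m ^ l)"
  proof -
    have "4 * real m ^ l = 4 * (real m)\<^sup>2 * ((real R ^ l / real m) * (real R ^ l / real m))"
      using m0 by (simp add: ml power2_eq_square field_simps)
    also have "\<dots> \<le> 4 * (real m)\<^sup>2 * (real_of_int q * q)"
      using qlow Rl m0 pq(2) by (intro mult_left_mono mult_mono) auto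
    also have "\<dots> \<le> real_of_int q * q'"
      using mult_left_mono[OF q'r(1), of "real_of_int q"] pq(2) by (simp add: mult_ac)
    finally show ?thesis using m0 by (intro divide_left_mono) (auto simp: pq(2) q'0)
  qed
  have dpos: "1 / (real_of_int q * of_int q') > 0" using pq(2) q'0 by simp
  have "x - 1 / (2 * real m ^ l) = of_int u / real m ^ l" "x + 1 / (2 * real m ^ l) = (of_int u + 1) / real m ^ l"
    using m0 by (simp_all add: x_def field_simps)
  moreover have "1 / (8 * real m ^ l) + 1 / (4 * real m ^ l) < 1 / (2 * real m ^ l)" "1 / (8 * real m ^ l) < 1 / (2 * real m ^ l)"
    using m0 by (simp_all add: field_simps)
  ultimately have "of_int p / of_int q \<in> {of_int u / real m ^ l <..< (of_int u + 1) / real m ^ l}"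
    "of_int p' / of_int q' \<in> {of_int u / real m ^ l <..< (of_int u + 1) / real m ^ l}"
    using close diff diff2 dpos unfolding greaterThanLessThan_iff by linarith+
  then show thesis using that[of p' q p q'] det pq(2) qlow qR q'r diff dpos by auto
qed

text \<open>
  With \<open>s\<close> and \<open>w\<close> the coordinates of the integer vector \<open>(A, B)\<close> in the unimodular basis, \<open>B \<beta> - A\<close> equals
  \<open>(s x - w) / (q + q' x)\<close> for the image point \<open>\<beta>\<close>. If this is at most \<open>1/B\<close>, then \<open>\<bar>s\<bar>\<close> is at most a constant
  times \<open>B/q\<close>. So the badness of \<open>x\<close> passes to \<open>\<beta>\<close> for all denominators that are not much smaller
  than \<open>q\<close>, with a loss that depends on \<open>t\<close> and \<open>b\<close> only.
\<close>

lemma mobius_image_bad: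
  fixes p q p' q' A :: int and B :: nat and x c t b X :: real
  assumes det: "p' * q - p * q' = 1" and q: "q > 0" "q' > 0" "of_int q' \<le> t * of_int q"
    and x: "0 \<le> x" "x \<le> 1" "bad_between c 1 X x"
    and c: "0 < c" "c \<le> 1" and t: "t \<ge> 1" and b: "b \<ge> 1"
    and B: "B > 0" "of_int q \<le> b * real B" "(t * b\<^sup>2 + 1) * real B / of_int q < X"
  shows "\<bar>real B * ((of_int p + of_int p' * x) / (of_int q + of_int q' * x)) - of_int A\<bar>
           \<ge> c / ((t * b\<^sup>2 + 1) * (t + 1)) / real B"
proof (rule ccontr)
  define D where "D = of_int q + of_int q' * x"
  define \<beta> where "\<beta> = (of_int p + of_int p' * x) / D"
  define E where "E = t * b\<^sup>2 + 1"
  define s where "s = int B * p' - A * q'"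
  define w where "w = A * q - int B * p"
  have D: "D \<ge> of_int q" "D \<le> (t + 1) * of_int q" "D > 0"
  proof -
    show 1: "D \<ge> of_int q" using x q by (simp add: D_def)
    have "of_int q' * x \<le> of_int q' * 1" using x q by (intro mult_left_mono) auto
    then show "D \<le> (t + 1) * of_int q" using q(3) by (simp add: D_def algebra_simps)
    show "D > 0" using 1 q by linarith
  qed
  have E: "E > 0" "E \<ge> b"
  proof -
    have "b \<le> b * b" "b * b \<le> t * (b * b)" using t b mult_left_mono[of 1 b b] mult_right_mono[of 1 t "b*b"] by simp_all
    then show "E > 0" "E \<ge> b" using b unfolding E_def power2_eq_square by linarith+
  qed
  have Beta: "real B * \<beta> - of_int A = (of_int s * x - of_int w) / D"
    unfolding \<beta>_def using D(3) by (simp add: s_def w_def D_def field_simps)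
  assume "\<not> ?thesis"
  then have small: "\<bar>real B * \<beta> - of_int A\<bar> < c / (E * (t + 1)) / real B"
    by (simp add: \<beta>_def D_def E_def)
  have "c / (E * (t + 1)) \<le> 1"
  proof -
    have "c \<le> 1 * 1" using c by simp
    also have "\<dots> \<le> E * (t + 1)" using E b t by (intro mult_mono) auto
    finally show ?thesis using E t by (simp add: divide_le_eq_1)
  qed
  then have "c / (E * (t + 1)) / real B \<le> 1 / real B" by (intro divide_right_mono) auto
  then have small1: "\<bar>real B * \<beta> - of_int A\<bar> \<le> 1 / real B" using small by linarith
  show False
  proof (cases "s = 0")
    case True
    have "w \<noteq> 0"
    proof
      assume "w = 0"
      have "int B = int B * (p' * q - p * q')" by (simp add: det)
      also have "\<dots> = q * s + q' * w" by (simp add: s_def w_def algebra_simps)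
      finally show False using True \<open>w = 0\<close> B by simp
    qed
    then have "1 \<le> \<bar>real_of_int w\<bar>" by linarith
    then have "1 / D \<le> \<bar>real B * \<beta> - of_int A\<bar>"
      using D(3) unfolding Beta True by (simp add: divide_right_mono)
    moreover have "D \<le> (t + 1) * (b * real B)"
      using D(2) mult_left_mono[OF B(2), of "t + 1"] t by linarith
    then have "1 / D \<ge> 1 / ((t + 1) * (b * real B))" using D(3) by (intro frac_le) auto
    moreover have "1 / ((t + 1) * (b * real B)) \<ge> c / (E * (t + 1)) / real B"
    proof -
      have "c / (E * (t + 1)) / real B = c / (E * ((t + 1) * real B))" by simp
      also have "\<dots> \<le> 1 / (b * ((t + 1) * real B))"
        using c E b t B by (intro frac_le mult_right_mono) auto
      finally show ?thesis by (simp add: mult_ac)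
    qed
    ultimately show False using small by linarith
  next
    case False
    have seq: "of_int s = of_int q' * (real B * \<beta> - of_int A) + real B / D"
    proof -
      have "D * of_int s = of_int q' * (of_int s * x - of_int w) + real B * of_int (p' * q - p * q')"
        by (simp add: D_def s_def w_def algebra_simps)
      then have "D * of_int s = of_int q' * (of_int s * x - of_int w) + real B" by (simp add: det)
      then show ?thesis unfolding Beta using D(3) by (simp add: field_simps)
    qed
    have "\<bar>of_int s\<bar> \<le> of_int q' * \<bar>real B * \<beta> - of_int A\<bar> + real B / D"
      unfolding seq using q D(3) by (intro order_trans[OF abs_triangle_ineq]) (simp add: abs_mult)
    also have "\<dots> \<le> of_int q' * (1 / real B) + real B / of_int q"
      using small1 q D by (intro add_mono mult_left_mono divide_left_mono) auto
    also have "\<dots> \<le> t * of_int q * (1 / real B) + real B / of_int q"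
      using q B by (intro add_right_mono mult_right_mono) auto
    also have "\<dots> \<le> t * (b\<^sup>2 * real B / of_int q) + real B / of_int q"
    proof -
      have "of_int q * of_int q \<le> (b * real B) * (b * real B)"
        using B(2) q by (intro mult_mono) auto
      then have "of_int q / real B \<le> b\<^sup>2 * real B / of_int q"
        using q B by (simp add: field_simps power2_eq_square)
      then have "t * (of_int q / real B) \<le> t * (b\<^sup>2 * real B / of_int q)" using t by (intro mult_left_mono) auto
      then show ?thesis by simp
    qed
    also have "\<dots> = E * real B / of_int q" by (simp add: E_def add_divide_distrib distrib_right)
    finally have sle: "\<bar>of_int s\<bar> \<le> E * real B / of_int q" .
    have s1: "\<bar>real_of_int s\<bar> \<ge> 1" using False by linarith
    have "c / \<bar>of_int s\<bar> \<le> \<bar>of_int s * x - of_int w\<bar>"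
      using bad_between_int[OF x(3) s1] sle B(3) by (simp add: E_def)
    moreover have "c / (E * real B / of_int q) \<le> c / \<bar>of_int s\<bar>"
      using sle s1 c by (intro divide_left_mono mult_pos_pos) auto
    ultimately have 1: "c / (E * real B / of_int q) \<le> \<bar>of_int s * x - of_int w\<bar>" by linarith
    have "c / (E * (t + 1)) / real B = c / (E * real B / of_int q) / ((t + 1) * of_int q)"
      using q B(1) E(1) t by (simp add: divide_simps)
    also have "\<dots> \<le> \<bar>of_int s * x - of_int w\<bar> / D"
      using 1 D q B c E by (intro frac_le) auto
    also have "\<dots> = \<bar>real B * \<beta> - of_int A\<bar>" unfolding Beta using D(3) by simp
    finally show False using small by linarith
  qed
qed

lemma card_floor_interval:
  fixes a b :: real
  assumes "a \<le> b"
  shows "real (card {\<lfloor>a\<rfloor>..\<lfloor>b\<rfloor>}) \<le> b - a + 2"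
proof -
  have "\<lfloor>a\<rfloor> \<le> \<lfloor>b\<rfloor>" using assms by (rule floor_mono)
  then have "real (card {\<lfloor>a\<rfloor>..\<lfloor>b\<rfloor>}) = of_int (\<lfloor>b\<rfloor> - \<lfloor>a\<rfloor> + 1)" by simp
  also have "\<dots> \<le> b - a + 2" by (simp) linarith
  finally show ?thesis .
qed

text \<open>
  A packing argument. Bad approximability of \<open>\<beta>\<close> says that two lattice vectors \<open>(q, p - \<beta> q)\<close> cannot agree
  in the first coordinate to within \<open>\<epsilon> S\<close> and in the second to within \<open>\<epsilon> / S\<close>.
\<close>

lemma lattice_strip_count:
  fixes p q :: "'a \<Rightarrow> int" and \<beta> cb \<epsilon> S Z q0 hi :: real
  assumes fin: "finite U" and inj: "inj_on (\<lambda>u. (p u, q u)) U"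
    and bad: "bad_between cb 0 hi \<beta>" and S: "S \<ge> 1"
    and eps: "0 < \<epsilon>" "\<epsilon> < 1" "\<epsilon> * S \<le> hi" "\<epsilon>\<^sup>2 \<le> cb"
    and Z: "Z \<ge> 0" "\<And>u. u \<in> U \<Longrightarrow> \<bar>of_int (p u) - \<beta> * of_int (q u)\<bar> \<le> Z / S"
  shows "real (card {u\<in>U. \<bar>of_int (q u) - q0\<bar> < S}) \<le> (2 / \<epsilon> + 2) * (2 * Z / \<epsilon> + 2)"
proof -
  let ?A = "{u\<in>U. \<bar>of_int (q u) - q0\<bar> < S}"
  define P where "P u = of_int (p u) - \<beta> * of_int (q u)" for u
  define f where "f u = (\<lfloor>of_int (q u) / (\<epsilon> * S)\<rfloor>, \<lfloor>P u * S / \<epsilon>\<rfloor>)" for u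
  let ?I = "{\<lfloor>(q0 - S) / (\<epsilon> * S)\<rfloor>..\<lfloor>(q0 + S) / (\<epsilon> * S)\<rfloor>}"
  let ?J = "{\<lfloor>- (Z / \<epsilon>)\<rfloor>..\<lfloor>Z / \<epsilon>\<rfloor>}"
  have eS: "\<epsilon> * S > 0" using eps S by simp
  have eS2: "\<epsilon> / S > 0" using eps S by simp
  have floor_eq: "\<bar>y - z\<bar> < 1" if "\<lfloor>y\<rfloor> = \<lfloor>z\<rfloor>" for y z :: real using that by linarith
  have "inj_on f ?A"
  proof (rule inj_onI)
    fix u v assume u: "u \<in> ?A" and v: "v \<in> ?A" and "f u = f v"
    then have "\<bar>of_int (q u) / (\<epsilon> * S) - of_int (q v) / (\<epsilon> * S)\<bar> < 1"
      and "\<bar>P u * S / \<epsilon> - P v * S / \<epsilon>\<bar> < 1"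
      unfolding f_def by (auto intro: floor_eq)
    moreover have "of_int (q u) / (\<epsilon> * S) - of_int (q v) / (\<epsilon> * S) = of_int (q u - q v) / (\<epsilon> * S)"
      "P u * S / \<epsilon> - P v * S / \<epsilon> = (P u - P v) / (\<epsilon> / S)"
      using S eps by (simp_all add: field_simps)
    ultimately have "\<bar>real_of_int (q u - q v)\<bar> / (\<epsilon> * S) < 1" "\<bar>P u - P v\<bar> / (\<epsilon> / S) < 1"
      using abs_of_pos[OF eS] abs_of_pos[OF eS2] by (simp_all only: abs_divide)
    then have 1: "\<bar>real_of_int (q u - q v)\<bar> < \<epsilon> * S" and 2: "\<bar>P u - P v\<bar> < \<epsilon> / S"
      by (simp_all only: pos_divide_less_eq[OF eS] pos_divide_less_eq[OF eS2] mult_1)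
    have qq: "q u = q v"
    proof (rule ccontr)
      assume "q u \<noteq> q v"
      then have pos: "\<bar>real_of_int (q u - q v)\<bar> > 0" by simp
      have "cb / \<bar>of_int (q u - q v)\<bar> \<le> \<bar>of_int (q u - q v) * \<beta> - of_int (p u - p v)\<bar>"
        using 1 eps by (intro bad_between_int[OF bad]) auto
      also have "\<dots> = \<bar>P u - P v\<bar>" unfolding P_def by (simp add: algebra_simps)
      also have "\<dots> < \<epsilon> / S" by (rule 2)
      finally have "cb / \<bar>of_int (q u - q v)\<bar> < \<epsilon> / S" .
      moreover have "\<epsilon> / S \<le> cb / (\<epsilon> * S)" using eps S by (simp add: field_simps power2_eq_square)
      moreover have "cb / (\<epsilon> * S) \<le> cb / \<bar>real_of_int (q u - q v)\<bar>"
        using 1 pos eS eps S zero_le_power2[of \<epsilon>] by (intro divide_left_mono mult_pos_pos) linarith+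
      ultimately show False by linarith
    qed
    then have "\<bar>real_of_int (p u - p v)\<bar> < \<epsilon> / S" using 2 by (simp add: P_def)
    also have "\<dots> \<le> \<epsilon>" using eps S by (simp add: divide_le_eq)
    finally have "\<bar>real_of_int (p u - p v)\<bar> < 1" using eps by linarith
    then have "p u = p v" by linarith
    then show "u = v" using inj qq u v by (auto simp: inj_on_def)
  qed
  moreover have "f ` ?A \<subseteq> ?I \<times> ?J"
  proof
    fix y assume "y \<in> f ` ?A"
    then obtain u where u: "u \<in> U" "\<bar>of_int (q u) - q0\<bar> < S" "y = f u" by auto
    have "(q0 - S) / (\<epsilon> * S) \<le> of_int (q u) / (\<epsilon> * S)" "of_int (q u) / (\<epsilon> * S) \<le> (q0 + S) / (\<epsilon> * S)"
      using u eS by (auto intro!: divide_right_mono)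
    moreover have "\<bar>P u * S / \<epsilon>\<bar> \<le> Z / \<epsilon>"
    proof -
      have "\<bar>P u\<bar> * S \<le> Z" using Z(2)[OF u(1)] S by (simp add: P_def field_simps)
      then show ?thesis using eps S by (simp add: abs_mult divide_right_mono)
    qed
    then have "- (Z / \<epsilon>) \<le> P u * S / \<epsilon>" "P u * S / \<epsilon> \<le> Z / \<epsilon>"
      unfolding abs_le_iff by linarith+
    ultimately show "y \<in> ?I \<times> ?J" unfolding u(3) f_def by (auto intro: floor_mono)
  qed
  ultimately have "card ?A \<le> card (?I \<times> ?J)"
    by (rule card_inj_on_le) simp
  then have "real (card ?A) \<le> real (card ?I) * real (card ?J)"
    unfolding card_cartesian_product of_nat_mult[symmetric] of_nat_le_iff .
  also have "\<dots> \<le> (2 / \<epsilon> + 2) * (2 * Z / \<epsilon> + 2)"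
  proof (rule mult_mono)
    have "real (card ?I) \<le> (q0 + S) / (\<epsilon> * S) - (q0 - S) / (\<epsilon> * S) + 2"
      using eS S by (intro card_floor_interval divide_right_mono) auto
    also have "(q0 + S) / (\<epsilon> * S) - (q0 - S) / (\<epsilon> * S) = 2 / \<epsilon>"
      using S eps by (simp add: field_simps)
    finally show "real (card ?I) \<le> 2 / \<epsilon> + 2" .
    have "real (card ?J) \<le> Z / \<epsilon> - (- (Z / \<epsilon>)) + 2"
      using Z eps by (intro card_floor_interval) (simp add: divide_nonneg_pos)
    then show "real (card ?J) \<le> 2 * Z / \<epsilon> + 2" by simp
  qed (use eps in auto)
  finally show ?thesis .
qed

section \<open>Badly approximable numbers in narrow strips\<close>

text \<open>
  A Moebius map of determinant \<open>1\<close> has derivative \<open>1 / (q + q' x)\<^sup>2\<close>. The difference of two such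
  derivatives is governed by the difference of the linear forms \<open>q + q' x\<close> and \<open>Q + Q' x\<close>, which is at
  least \<open>S/2\<close> times the distance from some point \<open>z\<close> because the forms differ by at least \<open>S\<close> at \<open>x = 0\<close>.
\<close>

lemma mobius_pair_grid_sum:
  fixes p q p' q' P Q P' Q' S T n h d e t \<rho> :: real and G :: nat
  assumes det: "p' * q - p * q' = 1" "P' * Q - P * Q' = 1"
    and ST: "S > 0" "T \<ge> 1" and d: "d > 0" and e: "e > 0" and t: "t \<ge> 0" and rho: "\<rho> \<ge> 0"
    and qq: "d * (S * T) \<le> q" "0 \<le> q'" "q' \<le> t * q" "q + q' \<le> e * (S * T)"
    and QQ: "d * (S * T) \<le> Q" "0 \<le> Q'" "Q' \<le> t * Q" "Q + Q' \<le> e * (S * T)"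
    and apart: "\<bar>q - Q\<bar> \<ge> S"
    and n: "T ^ 8 * S\<^sup>2 \<le> n" "n \<le> \<rho> * (T ^ 8 * S\<^sup>2)"
    and h: "1 \<le> h" "h \<le> T" and G: "real G = T ^ 10"
  shows "norm (\<Sum>a<G. unit_exp (h * n * ((p + p' * (real a / real G)) / (q + q' * (real a / real G))
             - (P + P' * (real a / real G)) / (Q + Q' * (real a / real G)))))
        \<le> real G * ((2 + 2 * e ^ 4 / d + 4 * t * \<rho> * e ^ 8 / d ^ 4 + 8 * \<rho> / d\<^sup>2) / T)"
proof -
  define f where "f x = h * n * ((p + p' * x) / (q + q' * x) - (P + P' * x) / (Q + Q' * x))" for x
  define f1 where "f1 x = h * n * (1 / (q + q' * x)\<^sup>2 - 1 / (Q + Q' * x)\<^sup>2)" for x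
  define f2 where "f2 x = h * n * (- 2 * q' / (q + q' * x) ^ 3 + 2 * Q' / (Q + Q' * x) ^ 3)" for x
  have dST: "d * (S * T) > 0" using d ST by simp
  have D: "d * (S * T) \<le> q + q' * x" "q + q' * x \<le> e * (S * T)" "q \<le> q + q' * x"
    "d * (S * T) \<le> Q + Q' * x" "Q + Q' * x \<le> e * (S * T)" "Q \<le> Q + Q' * x" if "x \<in> {0..1}" for x
  proof -
    have "0 \<le> q' * x" "0 \<le> Q' * x" "q' * x \<le> q' * 1" "Q' * x \<le> Q' * 1"
      using that qq QQ mult_left_mono[of x 1 q'] mult_left_mono[of x 1 Q'] by auto
    then show "d * (S * T) \<le> q + q' * x" "q + q' * x \<le> e * (S * T)" "q \<le> q + q' * x"
      "d * (S * T) \<le> Q + Q' * x" "Q + Q' * x \<le> e * (S * T)" "Q \<le> Q + Q' * x"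
      using qq QQ by linarith+
  qed
  have Dp: "q + q' * x > 0" "Q + Q' * x > 0" if "x \<in> {0..1}" for x using D[OF that] dST by linarith+
  have h0: "h > 0" using h by simp
  have T0: "T > 0" using ST by simp
  have n0: "n > 0"
  proof -
    have "T ^ 8 * S\<^sup>2 > 0" using ST by simp
    then show ?thesis using n by linarith
  qed
  have d1: "(f has_real_derivative f1 x) (at x within {0..1})" if "x \<in> {0..1}" for x
  proof -
    have a: "((\<lambda>x. (p + p' * x) / (q + q' * x)) has_real_derivative 1 / (q + q' * x)\<^sup>2) (at x within {0..1})"
    proof -
      have "((\<lambda>x. (p + p' * x) / (q + q' * x)) has_real_derivative
         (p' * (q + q' * x) - (p + p' * x) * q') / ((q + q' * x) * (q + q' * x))) (at x within {0..1})"
        using Dp[OF that] by (auto intro!: derivative_eq_intros)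
      moreover have "p' * (q + q' * x) - (p + p' * x) * q' = 1" using det(1) by (simp add: algebra_simps)
      ultimately show ?thesis by (simp add: power2_eq_square)
    qed
    have b: "((\<lambda>x. (P + P' * x) / (Q + Q' * x)) has_real_derivative 1 / (Q + Q' * x)\<^sup>2) (at x within {0..1})"
    proof -
      have "((\<lambda>x. (P + P' * x) / (Q + Q' * x)) has_real_derivative
         (P' * (Q + Q' * x) - (P + P' * x) * Q') / ((Q + Q' * x) * (Q + Q' * x))) (at x within {0..1})"
        using Dp[OF that] by (auto intro!: derivative_eq_intros)
      moreover have "P' * (Q + Q' * x) - (P + P' * x) * Q' = 1" using det(2) by (simp add: algebra_simps)
      ultimately show ?thesis by (simp add: power2_eq_square)
    qed
    show ?thesis unfolding f_def[abs_def] f1_def by (intro DERIV_cmult DERIV_diff a b)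
  qed
  have d2: "(f1 has_real_derivative f2 x) (at x within {0..1})" if "x \<in> {0..1}" for x
  proof -
    have a: "((\<lambda>x. 1 / (q + q' * x)\<^sup>2) has_real_derivative - 2 * q' / (q + q' * x) ^ 3) (at x within {0..1})"
      using Dp[OF that] by (auto intro!: derivative_eq_intros simp: divide_simps) (simp add: eval_nat_numeral)?
    have b: "((\<lambda>x. 1 / (Q + Q' * x)\<^sup>2) has_real_derivative - 2 * Q' / (Q + Q' * x) ^ 3) (at x within {0..1})"
      using Dp[OF that] by (auto intro!: derivative_eq_intros simp: divide_simps) (simp add: eval_nat_numeral)?
    have "(f1 has_real_derivative h * n * (- 2 * q' / (q + q' * x) ^ 3 - (- 2 * Q' / (Q + Q' * x) ^ 3))) (at x within {0..1})"
      unfolding f1_def[abs_def] by (intro DERIV_cmult DERIV_diff a b)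
    then show ?thesis by (simp add: f2_def)
  qed
  define \<mu> where "\<mu> = h * T ^ 5 * (d / e ^ 4)"
  have mu: "\<mu> > 0" using h0 T0 d e by (simp add: \<mu>_def)
  define L where "L = h * \<rho> * T ^ 6 / d\<^sup>2"
  have L0: "L \<ge> 0" using h0 rho T0 by (simp add: L_def)
  have hn: "h * n * (1 / (d * (S * T))\<^sup>2) \<le> L"
  proof -
    have "h * n * (1 / (d * (S * T))\<^sup>2) \<le> h * (\<rho> * (T ^ 8 * S\<^sup>2)) * (1 / (d * (S * T))\<^sup>2)"
      using h0 n by (intro mult_right_mono mult_left_mono) auto
    also have "\<dots> = L" using ST d by (simp add: L_def power_mult_distrib field_simps flip: power_add)
    finally show ?thesis .
  qed
  have inv: "1 / (q + q' * x)\<^sup>2 \<le> 1 / (d * (S * T))\<^sup>2" "1 / (Q + Q' * x)\<^sup>2 \<le> 1 / (d * (S * T))\<^sup>2"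
    if "x \<in> {0..1}" for x
    using D[OF that] dST by (intro divide_left_mono power_mono mult_pos_pos; force)+
  have up1: "\<bar>f1 x\<bar> \<le> L" if x: "x \<in> {0..1}" for x
  proof -
    have "0 \<le> 1 / (q + q' * x)\<^sup>2" "0 \<le> 1 / (Q + Q' * x)\<^sup>2" by simp_all
    then have "\<bar>1 / (q + q' * x)\<^sup>2 - 1 / (Q + Q' * x)\<^sup>2\<bar> \<le> 1 / (d * (S * T))\<^sup>2" using inv[OF x] by linarith
    then have "h * n * \<bar>1 / (q + q' * x)\<^sup>2 - 1 / (Q + Q' * x)\<^sup>2\<bar> \<le> h * n * (1 / (d * (S * T))\<^sup>2)"
      using h0 n0 by (intro mult_left_mono) auto
    then show ?thesis using hn h0 n0 by (simp add: f1_def abs_mult)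
  qed
  have up2: "\<bar>f2 x\<bar> \<le> 4 * t * L" if x: "x \<in> {0..1}" for x
  proof -
    have 1: "q' / (q + q' * x) ^ 3 \<le> t * (1 / (d * (S * T))\<^sup>2)"
    proof -
      have "q' / (q + q' * x) ^ 3 = (q' / (q + q' * x)) * (1 / (q + q' * x)\<^sup>2)" by (simp add: eval_nat_numeral)
      also have "\<dots> \<le> t * (1 / (d * (S * T))\<^sup>2)"
      proof (rule mult_mono)
        have "t * q \<le> t * (q + q' * x)" using D[OF x] t by (intro mult_left_mono) auto
        then show "q' / (q + q' * x) \<le> t" using qq Dp[OF x] by (simp add: divide_le_eq)
      qed (use inv[OF x] t in auto)
      finally show ?thesis .
    qed
    have 2: "Q' / (Q + Q' * x) ^ 3 \<le> t * (1 / (d * (S * T))\<^sup>2)"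
    proof -
      have "Q' / (Q + Q' * x) ^ 3 = (Q' / (Q + Q' * x)) * (1 / (Q + Q' * x)\<^sup>2)" by (simp add: eval_nat_numeral)
      also have "\<dots> \<le> t * (1 / (d * (S * T))\<^sup>2)"
      proof (rule mult_mono)
        have "t * Q \<le> t * (Q + Q' * x)" using D[OF x] t by (intro mult_left_mono) auto
        then show "Q' / (Q + Q' * x) \<le> t" using QQ Dp[OF x] by (simp add: divide_le_eq)
      qed (use inv[OF x] t in auto)
      finally show ?thesis .
    qed
    have "0 \<le> q' / (q + q' * x) ^ 3" "0 \<le> Q' / (Q + Q' * x) ^ 3" using qq QQ Dp[OF x] by auto
    then have "\<bar>- 2 * q' / (q + q' * x) ^ 3 + 2 * Q' / (Q + Q' * x) ^ 3\<bar> \<le> 4 * t * (1 / (d * (S * T))\<^sup>2)"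
      using 1 2 by simp
    then have "h * n * \<bar>- 2 * q' / (q + q' * x) ^ 3 + 2 * Q' / (Q + Q' * x) ^ 3\<bar> \<le> h * n * (4 * t * (1 / (d * (S * T))\<^sup>2))"
      using h0 n0 by (intro mult_left_mono) auto
    also have "\<dots> = 4 * t * (h * n * (1 / (d * (S * T))\<^sup>2))" by simp
    also have "\<dots> \<le> 4 * t * L" using hn t by (intro mult_left_mono) auto
    finally show ?thesis using h0 n0 by (simp add: f2_def abs_mult)
  qed
  obtain z where z: "\<And>x. x \<in> {0..1} \<Longrightarrow> S / 2 * \<bar>x - z\<bar> \<le> \<bar>(q + q' * x) - (Q + Q' * x)\<bar>"
  proof (cases "\<bar>q' - Q'\<bar> \<ge> S / 2")
    case True
    then have nz: "q' - Q' \<noteq> 0" using ST by auto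
    show thesis
    proof (rule that[of "- (q - Q) / (q' - Q')"])
      fix x
      have "(q + q' * x) - (Q + Q' * x) = (q' - Q') * (x - (- (q - Q) / (q' - Q')))"
        using nz by (simp add: field_simps)
      then show "S / 2 * \<bar>x - - (q - Q) / (q' - Q')\<bar> \<le> \<bar>(q + q' * x) - (Q + Q' * x)\<bar>"
        using mult_right_mono[OF True, of "\<bar>x - - (q - Q) / (q' - Q')\<bar>"] by (simp only: abs_mult)
    qed
  next
    case False
    show thesis
    proof (rule that[of 0])
      fix x :: real assume x: "x \<in> {0..1}"
      have "\<bar>(q' - Q') * x\<bar> \<le> S / 2 * 1" unfolding abs_mult using False x ST by (intro mult_mono) auto
      moreover have "(q + q' * x) - (Q + Q' * x) = (q - Q) + (q' - Q') * x" by (simp add: algebra_simps)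
      moreover have "S / 2 * \<bar>x - 0\<bar> \<le> S / 2 * 1" using x ST by (intro mult_left_mono) auto
      ultimately show "S / 2 * \<bar>x - 0\<bar> \<le> \<bar>(q + q' * x) - (Q + Q' * x)\<bar>" using apart by linarith
    qed
  qed
  have low: "\<mu> * \<bar>x - z\<bar> \<le> \<bar>f1 x\<bar>" if x: "x \<in> {0..1}" for x
  proof -
    define X Y where "X = q + q' * x" and "Y = Q + Q' * x"
    have XY: "X > 0" "Y > 0" "d * (S * T) \<le> X" "X \<le> e * (S * T)" "d * (S * T) \<le> Y" "Y \<le> e * (S * T)"
      using D[OF x] Dp[OF x] by (auto simp: X_def Y_def)
    have "1 / X\<^sup>2 - 1 / Y\<^sup>2 = (Y - X) * (X + Y) / (X\<^sup>2 * Y\<^sup>2)"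
      using XY by (simp add: divide_simps power2_eq_square algebra_simps)
    then have "\<bar>f1 x\<bar> = h * n * (\<bar>X - Y\<bar> * (X + Y) / (X\<^sup>2 * Y\<^sup>2))"
      using h0 n0 XY by (simp add: f1_def abs_mult abs_minus_commute flip: X_def Y_def)
    moreover have "h * n * (\<bar>X - Y\<bar> * (X + Y) / (X\<^sup>2 * Y\<^sup>2))
       \<ge> h * (T ^ 8 * S\<^sup>2) * ((S / 2 * \<bar>x - z\<bar>) * (2 * (d * (S * T))) / ((e * (S * T))\<^sup>2 * (e * (S * T))\<^sup>2))"
      using XY h0 n0 n z[OF x] dST ST
      by (intro mult_mono frac_le power_mono) (auto simp: X_def Y_def)
    moreover have "h * (T ^ 8 * S\<^sup>2) * ((S / 2 * \<bar>x - z\<bar>) * (2 * (d * (S * T))) / ((e * (S * T))\<^sup>2 * (e * (S * T))\<^sup>2))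
       = \<mu> * \<bar>x - z\<bar>"
      using ST T0 e by (simp add: \<mu>_def field_simps eval_nat_numeral)
    ultimately show ?thesis by simp
  qed
  have int: "norm (integral {0..1} (\<lambda>x. unit_exp (f x)))
     \<le> 2 * (1 / T) + 2 / (\<mu> * (1 / T)) + (4 * t * L) / (\<mu> * (1 / T))\<^sup>2"
    using T0 t L0 by (intro oscillatory_integral_stationary_point[OF mu _ _ d1 d2 low up2]) auto
  have G0: "G > 0" using G T0 by (metis of_nat_0_less_iff zero_less_power)
  have "norm (\<Sum>a<G. unit_exp (f (real a / real G))) \<le> real G * norm (integral {0..1} (\<lambda>x. unit_exp (f x))) + 2 * pi * L"
    by (rule grid_sum_le_integral[OF G0 L0 d1 up1])
  also have "\<dots> \<le> real G * (2 * (1 / T) + 2 / (\<mu> * (1 / T)) + (4 * t * L) / (\<mu> * (1 / T))\<^sup>2) + 2 * pi * L"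
    using int by (intro add_right_mono mult_left_mono) auto
  also have "\<dots> = real G * (2 / T + 2 / (\<mu> * (1 / T)) + (4 * t * L) / (\<mu> * (1 / T))\<^sup>2 + 2 * pi * L / real G)"
    using G0 by (simp add: field_simps)
  also have "\<dots> \<le> real G * (2 / T + (2 * e ^ 4 / d) / T + (4 * t * \<rho> * e ^ 8 / d ^ 4) / T + (8 * \<rho> / d\<^sup>2) / T)"
  proof (intro mult_left_mono add_mono)
    show "2 / (\<mu> * (1 / T)) \<le> (2 * e ^ 4 / d) / T"
    proof -
      have "2 / (\<mu> * (1 / T)) = (2 * e ^ 4 / d) * (1 / (h * T ^ 4))"
        using T0 h0 d e by (simp add: \<mu>_def field_simps eval_nat_numeral)
      also have "\<dots> \<le> (2 * e ^ 4 / d) * (1 / T)"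
      proof (intro mult_left_mono divide_left_mono)
        have "1 * T ^ 1 \<le> h * T ^ 4" using h ST by (intro mult_mono power_increasing) auto
        then show "T \<le> h * T ^ 4" by simp
      qed (use e d T0 h0 in auto)
      finally show ?thesis by simp
    qed
    show "(4 * t * L) / (\<mu> * (1 / T))\<^sup>2 \<le> (4 * t * \<rho> * e ^ 8 / d ^ 4) / T"
    proof -
      have "(4 * t * L) / (\<mu> * (1 / T))\<^sup>2 = (4 * t * \<rho> * e ^ 8 / d ^ 4) * (1 / (h * T\<^sup>2))"
        using T0 h0 d e by (simp add: \<mu>_def L_def field_simps eval_nat_numeral)
      also have "\<dots> \<le> (4 * t * \<rho> * e ^ 8 / d ^ 4) * (1 / T)"
      proof (intro mult_left_mono divide_left_mono)
        have "1 * T ^ 1 \<le> h * T ^ 2" using h ST by (intro mult_mono power_increasing) auto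
        then show "T \<le> h * T\<^sup>2" by simp
      qed (use e d T0 h0 t rho in auto)
      finally show ?thesis by simp
    qed
    show "2 * pi * L / real G \<le> (8 * \<rho> / d\<^sup>2) / T"
    proof -
      have "2 * pi * L / real G = (2 * pi * \<rho> / d\<^sup>2) * (h / T ^ 4)"
        unfolding G L_def using T0 d by (simp add: field_simps eval_nat_numeral)
      also have "\<dots> \<le> (8 * \<rho> / d\<^sup>2) * (1 / T)"
      proof (rule mult_mono)
        show "2 * pi * \<rho> / d\<^sup>2 \<le> 8 * \<rho> / d\<^sup>2" using pi_less_4 rho by (intro divide_right_mono mult_right_mono) auto
        have "h * T \<le> T * T" using h T0 by (intro mult_right_mono) auto
        also have "\<dots> = T ^ 2" by (simp add: power2_eq_square)
        also have "\<dots> \<le> T ^ 4" using ST by (intro power_increasing) auto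
        finally show "h / T ^ 4 \<le> 1 / T" using T0 by (simp add: field_simps)
      qed (use rho h0 T0 in auto)
      finally show ?thesis by simp
    qed
  qed (use G0 in auto)
  also have "\<dots> = real G * ((2 + 2 * e ^ 4 / d + 4 * t * \<rho> * e ^ 8 / d ^ 4 + 8 * \<rho> / d\<^sup>2) / T)"
    by (simp add: add_divide_distrib)
  finally show ?thesis by (simp add: f_def)
qed

text \<open>
  Cauchy-Schwarz in \<open>x\<close>, followed by completion of the sum over \<open>X\<close> to the full grid. The completion
  wastes the factor \<open>G / card X\<close>. Pairs \<open>u\<close>, \<open>v\<close> that are close are estimated trivially.
\<close>

lemma bilinear_sum_bound:
  fixes \<theta> :: "'u \<Rightarrow> nat \<Rightarrow> real" and G :: nat
  assumes U: "finite U" and X: "X \<subseteq> {..<G}" and \<delta>: "\<delta> \<ge> 0"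
    and pair: "\<And>u v. u \<in> U \<Longrightarrow> v \<in> U \<Longrightarrow> \<not> close u v \<Longrightarrow>
       norm (\<Sum>a<G. unit_exp (\<theta> u a - \<theta> v a)) \<le> real G * \<delta>"
    and close: "\<And>u. u \<in> U \<Longrightarrow> real (card {v\<in>U. close u v}) \<le> A"
  shows "(norm (\<Sum>x\<in>X. \<Sum>u\<in>U. unit_exp (\<theta> u x)))\<^sup>2
    \<le> real (card X) * (real (card U) * (real G * (A + real (card U) * \<delta>)))"
proof -
  define F where "F a = (\<Sum>u\<in>U. unit_exp (\<theta> u a))" for a
  have finX: "finite X" using X finite_subset by blast
  have "(norm (\<Sum>x\<in>X. F x))\<^sup>2 \<le> (\<Sum>x\<in>X. norm (F x))\<^sup>2"
    by (intro power_mono norm_sum) auto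
  also have "\<dots> \<le> (\<Sum>x\<in>X. (norm (F x))\<^sup>2) * real (card X)"
    by (rule sum_squared_le_sum_of_squares)
  also have "(\<Sum>x\<in>X. (norm (F x))\<^sup>2) \<le> (\<Sum>a<G. (norm (F a))\<^sup>2)"
    using X by (intro sum_mono2) auto
  also have "(\<Sum>a<G. (norm (F a))\<^sup>2) \<le> real (card U) * (real G * (A + real (card U) * \<delta>))"
  proof -
    have "complex_of_real (\<Sum>a<G. (norm (F a))\<^sup>2) = (\<Sum>a<G. F a * cnj (F a))"
      by (simp only: of_real_sum complex_norm_square)
    also have "\<dots> = (\<Sum>a<G. \<Sum>u\<in>U. \<Sum>v\<in>U. unit_exp (\<theta> u a - \<theta> v a))"
      by (simp add: F_def sum_product unit_exp_diff)
    also have "\<dots> = (\<Sum>u\<in>U. \<Sum>v\<in>U. \<Sum>a<G. unit_exp (\<theta> u a - \<theta> v a))"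
      by (subst sum.swap, intro sum.cong refl, subst sum.swap) simp
    finally have eq: "complex_of_real (\<Sum>a<G. (norm (F a))\<^sup>2) = (\<Sum>u\<in>U. \<Sum>v\<in>U. \<Sum>a<G. unit_exp (\<theta> u a - \<theta> v a))" .
    have one: "norm (\<Sum>a<G. unit_exp (\<theta> u a - \<theta> v a)) \<le> real G * ((if close u v then 1 else 0) + \<delta>)"
      if "u \<in> U" "v \<in> U" for u v
    proof (cases "close u v")
      case True
      have "norm (\<Sum>a<G. unit_exp (\<theta> u a - \<theta> v a)) \<le> (\<Sum>a<G. 1)"
        by (intro sum_norm_le) auto
      also have "\<dots> \<le> real G * (1 + \<delta>)" using \<delta> by (simp add: distrib_left)
      finally show ?thesis using True by simp
    qed (use pair[OF that] in auto)
    have "norm (\<Sum>u\<in>U. \<Sum>v\<in>U. \<Sum>a<G. unit_exp (\<theta> u a - \<theta> v a))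
       \<le> (\<Sum>u\<in>U. \<Sum>v\<in>U. real G * ((if close u v then 1 else 0) + \<delta>))"
      by (intro sum_norm_le one)
    also have "\<dots> = (\<Sum>u\<in>U. real G * (real (card {v\<in>U. close u v}) + real (card U) * \<delta>))"
      using U by (intro sum.cong refl) (simp add: sum.distrib sum.If_cases Int_def flip: sum_distrib_left)
    also have "\<dots> \<le> (\<Sum>u\<in>U. real G * (A + real (card U) * \<delta>))"
      using close by (intro sum_mono mult_left_mono add_right_mono) auto
    also have "\<dots> = real (card U) * (real G * (A + real (card U) * \<delta>))" by simp
    finally have "norm (complex_of_real (\<Sum>a<G. (norm (F a))\<^sup>2)) \<le> real (card U) * (real G * (A + real (card U) * \<delta>))"
      unfolding eq .
    then show ?thesis by (simp only: norm_of_real)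
  qed
  finally show ?thesis unfolding F_def by (simp add: mult_ac mult_right_mono)
qed

lemma mobius_between:
  fixes p q p' q' x lo hi :: real
  assumes "q > 0" "q' > 0" "0 \<le> x" "lo \<le> p / q" "p / q \<le> hi" "lo \<le> p' / q'" "p' / q' \<le> hi"
  shows "lo \<le> (p + p' * x) / (q + q' * x)" "(p + p' * x) / (q + q' * x) \<le> hi"
proof -
  have pos: "q + q' * x > 0" using assms by (simp add: add_pos_nonneg)
  have a: "lo * q \<le> p" "lo * q' \<le> p'" "p \<le> hi * q" "p' \<le> hi * q'"
    using assms by (simp_all add: field_simps)
  have b: "lo * q' * x \<le> p' * x" "p' * x \<le> hi * q' * x"
    using a assms(3) by (auto intro: mult_right_mono)
  show "lo \<le> (p + p' * x) / (q + q' * x)" "(p + p' * x) / (q + q' * x) \<le> hi"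
    using a b pos by (simp_all add: pos_le_divide_eq pos_divide_le_eq distrib_left mult.assoc[symmetric])
qed

lemma gridcell_open_unique:
  assumes "m > 0" "y \<in> {of_int u / real m ^ l <..< (of_int u + 1) / real m ^ l}"
  shows "u = \<lfloor>y * real m ^ l\<rfloor>"
proof -
  have pos: "real m ^ l > 0" using assms by simp
  have "of_int u < y * real m ^ l" "y * real m ^ l < of_int u + 1"
    using assms(2) pos by (simp_all only: greaterThanLessThan_iff pos_divide_less_eq pos_less_divide_eq)
  then show ?thesis by linarith
qed

text \<open>
  Here \<open>U\<close> is the number of Moebius maps and \<open>V\<close> the number of points \<open>x\<close>. With \<open>\<phi> = (m / (m - 3))\<^sup>K\<close>, the
  number of grid points is \<open>\<phi>\<^sup>5 V\<close> and the square of \<open>R\<^sup>K\<close> is \<open>\<phi> U\<close>, so everything reduces to the fact that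
  \<open>R\<^sup>K\<close> exceeds \<open>\<phi>\<^sup>6 M\<^sup>2\<close> by an arbitrarily large factor.
\<close>

lemma counting_beats_loss:
  fixes R K M :: nat and C3 C2 :: real
  assumes R: "R \<ge> 10" and C: "C2 \<ge> 0" "C3 \<ge> 0" "C2 + C3 > 0" and M: "real M ^ 4 \<le> real R ^ K" "M > 0"
    and K: "16 * (C3 + C2)\<^sup>2 \<le> 2 ^ K"
  defines "m \<equiv> R\<^sup>2" and "U \<equiv> real (R\<^sup>2 - 3) ^ K" and "V \<equiv> real (R\<^sup>2 - 3) ^ (5 * K)"
  shows "V * (U * (real m ^ (5 * K) * (C3 * real R ^ K + U * (C2 / real R ^ K)))) \<le> (V * U / (2 * real M))\<^sup>2"
proof -
  define T where "T = real R ^ K"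
  define w where "w = real m ^ K"
  define \<phi> where "\<phi> = (real m / real (m - 3)) ^ K"
  have m: "m \<ge> 100" using R power_mono[of 10 R 2] by (simp add: m_def)
  have T: "T > 0" using R by (simp add: T_def)
  have U: "U > 0" using m by (simp add: U_def flip: m_def)
  have V: "V = U ^ 5" by (simp add: U_def V_def power_mult mult.commute)
  have G: "real m ^ (5 * K) = w ^ 5" by (simp add: w_def power_mult mult.commute)
  have wT: "w = T\<^sup>2" by (simp add: w_def T_def m_def power_mult mult.commute flip: power_mult)
  have w: "w = \<phi> * U" using m by (simp add: w_def \<phi>_def U_def power_divide flip: m_def)
  have Uw: "U \<le> w" unfolding U_def w_def m_def by (intro power_mono) auto
  have phi0: "\<phi> > 0" using m by (simp add: \<phi>_def)
  have phi: "\<phi> ^ 12 \<le> (real R / 2) ^ K"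
  proof -
    have "real m / real (m - 3) \<le> 100 / 97" using m by (simp add: field_simps of_nat_diff)
    then have "(real m / real (m - 3)) ^ 12 \<le> (100 / 97) ^ 12" by (intro power_mono) auto
    also have "\<dots> \<le> (5 :: real)" by (simp add: power_divide)
    also have "\<dots> \<le> real R / 2" using R by simp
    finally have "((real m / real (m - 3)) ^ 12) ^ K \<le> (real R / 2) ^ K" by (intro power_mono) auto
    then show ?thesis by (simp add: \<phi>_def mult.commute flip: power_mult)
  qed
  define C4 where "C4 = C3 + C2"
  have C4: "C4 > 0" using C by (simp add: C4_def)
  have key: "4 * C4 * (real M)\<^sup>2 * \<phi> ^ 6 \<le> T"
  proof (rule power2_le_imp_le)
    have "(4 * C4 * (real M)\<^sup>2 * \<phi> ^ 6)\<^sup>2 = (16 * C4\<^sup>2) * real M ^ 4 * \<phi> ^ 12"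
      by (simp add: power_mult_distrib flip: power_mult)
    also have "\<dots> \<le> 2 ^ K * T * (real R / 2) ^ K"
      using K M phi phi0 T unfolding T_def C4_def by (intro mult_mono) auto
    also have "\<dots> = T\<^sup>2" by (simp add: T_def power_divide power2_eq_square)
    finally show "(4 * C4 * (real M)\<^sup>2 * \<phi> ^ 6)\<^sup>2 \<le> T\<^sup>2" .
  qed (use T in auto)
  have "w ^ 5 * (C3 * T + U * (C2 / T)) \<le> w ^ 5 * (C4 * T)"
  proof (intro mult_left_mono)
    have "U * (C2 / T) \<le> w * (C2 / T)" using Uw C T by (intro mult_right_mono) auto
    also have "\<dots> = C2 * T" using T by (simp add: wT power2_eq_square)
    finally show "C3 * T + U * (C2 / T) \<le> C4 * T" by (simp add: C4_def distrib_right)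
  qed (use wT in auto)
  also have "\<dots> = C4 * w ^ 6 / T" using T by (simp add: wT eval_nat_numeral)
  also have "\<dots> = (4 * C4 * (real M)\<^sup>2 * \<phi> ^ 6) * U ^ 6 / (T * (4 * (real M)\<^sup>2))"
    using T M by (simp add: w power_mult_distrib field_simps)
  also have "\<dots> \<le> T * U ^ 6 / (T * (4 * (real M)\<^sup>2))"
    using key U T by (intro divide_right_mono mult_right_mono) auto
  also have "\<dots> = U ^ 6 / (4 * (real M)\<^sup>2)" using T by simp
  finally have "w ^ 5 * (C3 * T + U * (C2 / T)) \<le> U ^ 6 / (4 * (real M)\<^sup>2)" .
  then have "V * (U * (w ^ 5 * (C3 * T + U * (C2 / T)))) \<le> V * (U * (U ^ 6 / (4 * (real M)\<^sup>2)))"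
    using U V by (intro mult_left_mono) auto
  also have "\<dots> = (V * U / (2 * real M))\<^sup>2" by (simp add: V power_divide power_mult_distrib flip: power_Suc power_mult power_add)
  finally show ?thesis by (simp add: G T_def)
qed

text \<open>
  The cell has length \<open>R\<close> to the power \<open>8K\<close> in units of \<open>1/n\<close>, up to \<open>R\<^sup>2\<close>. The constant \<open>cb\<close> is what the
  earlier construction guarantees for the cell, \<open>cs\<close> is what the new number \<open>\<tau>\<close> satisfies at the
  denominators from the current level on. The number \<open>M\<close> expresses that the width \<open>r\<close> of the strip is
  not smaller than a negative power of \<open>R\<^sup>K\<close>.
\<close>

definition strips_reachable :: "nat \<Rightarrow> real \<Rightarrow> real \<Rightarrow> nat \<Rightarrow> bool" where
  "strips_reachable R cs cb K \<longleftrightarrow> (\<forall>k a M. \<forall>n r \<omega> :: real.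
     (\<forall>x\<in>gridcell (R\<^sup>2) k a. bad_between cb 0 (real R ^ k / (2 * real R)) x) \<longrightarrow>
     real R ^ (8 * K + 2 * k) \<le> n \<longrightarrow> n \<le> real R ^ (8 * K + 2 * k + 2) \<longrightarrow>
     0 < r \<longrightarrow> 2 / r\<^sup>2 < real M \<longrightarrow> real M ^ 4 \<le> real R ^ K \<longrightarrow>
     (\<exists>\<tau>\<in>gridcell (R\<^sup>2) k a. dist_int (n * \<tau> - \<omega>) < r \<and>
        bad_between cs (real R ^ k / (2 * real R)) (real R ^ (k + 5 * K)) \<tau>))"

lemma strips_reachableE:
  fixes \<omega> :: real
  assumes "strips_reachable R cs cb K"
    and "\<And>x. x \<in> gridcell (R\<^sup>2) k a \<Longrightarrow> bad_between cb 0 (real R ^ k / (2 * real R)) x"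
    and "real R ^ (8 * K + 2 * k) \<le> n" "n \<le> real R ^ (8 * K + 2 * k + 2)"
    and "0 < r" "2 / r\<^sup>2 < real M" "real M ^ 4 \<le> real R ^ K"
  obtains \<tau> where "\<tau> \<in> gridcell (R\<^sup>2) k a" "dist_int (n * \<tau> - \<omega>) < r"
    "bad_between cs (real R ^ k / (2 * real R)) (real R ^ (k + 5 * K)) \<tau>"
  using assms unfolding strips_reachable_def by meson

text \<open>
  The order of the quantifiers matters: \<open>cs\<close> depends on \<open>R\<close> only, so that \<open>cb\<close> may afterwards be chosen
  smaller than \<open>cs\<close> and serve for all special levels simultaneously. A small \<open>cb\<close> merely delays the
  \<open>K\<close> from which the statement holds. It enters twice: the descendants must be much smaller than the
  cell for \<open>farey_pair_in_cell\<close>, and it controls the number of pairs of maps with close denominators.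
\<close>

lemma bad_number_in_strip:
  fixes R :: nat
  assumes R: "R \<ge> 10"
  obtains cs :: real where "0 < cs" "cs \<le> 1" "\<And>cb. 0 < cb \<Longrightarrow> \<exists>K0. \<forall>K\<ge>K0. strips_reachable R cs cb K"
proof -
  define m where "m = R\<^sup>2"
  define c where "c = 1 / (8 * (real m)\<^sup>2)"
  define t where "t = 4 * (real m)\<^sup>2 + 1"
  define b where "b = 16 * real m * real R"
  define E where "E = t * b\<^sup>2 + 1"
  define cs where "cs = c / (E * (t + 1))"
  have m: "m \<ge> 100" using R power_mono[of 10 R 2] by (simp add: m_def)
  have m0: "m > 0" using m by simp
  have R0: "real R > 0" using R by simp
  have "1 \<le> (real m)\<^sup>2" using m by (intro one_le_power) simp
  then have "1 \<le> 8 * (real m)\<^sup>2" by linarith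
  then have c: "0 < c" "c \<le> 1"
    using m by (simp_all add: c_def divide_le_eq)
  have t: "t \<ge> 1" by (simp add: t_def)
  have b: "b \<ge> 1"
  proof -
    have "1 * 1 \<le> (16 * real m) * real R" using m R by (intro mult_mono) auto
    then show ?thesis by (simp add: b_def)
  qed
  have E: "E \<ge> 1" using t by (simp add: E_def)
  have Et: "1 * 1 \<le> E * (t + 1)" using E t by (intro mult_mono) auto
  have cs: "0 < cs" "cs \<le> c"
    using c E t Et by (auto simp: cs_def divide_le_eq mult_le_cancel_left1)
  have main: "\<exists>K0. \<forall>K\<ge>K0. strips_reachable R cs cb K"
    if cb: "0 < cb" for cb
  proof -
    define \<epsilon> where "\<epsilon> = min (1 / (2 * real R)) cb"
    have eps: "0 < \<epsilon>" "\<epsilon> \<le> 1 / (2 * real R)" "\<epsilon> < 1" "\<epsilon>\<^sup>2 \<le> cb"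
    proof -
      show 1: "0 < \<epsilon>" "\<epsilon> \<le> 1 / (2 * real R)" using cb R0 by (auto simp: \<epsilon>_def)
      have "1 / (2 * real R) < 1" using R by simp
      then show 2: "\<epsilon> < 1" using 1 by linarith
      have "\<epsilon> * \<epsilon> \<le> 1 * \<epsilon>" using 1 2 by (intro mult_right_mono) auto
      then show "\<epsilon>\<^sup>2 \<le> cb" by (simp add: power2_eq_square \<epsilon>_def)
    qed
    define C3 where "C3 = (2 / \<epsilon> + 2) * (16 * real m / \<epsilon> + 2)"
    define d where "d = 1 / real m"
    define e where "e = (1 + t) * (8 * real m)"
    define C2 where "C2 = 2 + 2 * e ^ 4 / d + 4 * t * (real R)\<^sup>2 * e ^ 8 / d ^ 4 + 8 * (real R)\<^sup>2 / d\<^sup>2"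
    have de: "d > 0" "e > 0" using m0 t by (auto simp: d_def e_def)
    have C2: "C2 \<ge> 0" "C2 > 0" using de t by (auto simp: C2_def intro!: add_pos_nonneg)
    have C3: "C3 \<ge> 0" using eps m0 by (simp add: C3_def)
    define W where "W = 1 / (16 * real R * real m * cb) + 2 * real R * real m * E + 16 * (C3 + C2)\<^sup>2"
    obtain K0 where K0: "W < 2 ^ K0" using real_arch_pow[of 2 W] by auto
    show ?thesis unfolding strips_reachable_def m_def[symmetric]
    proof (intro exI[of _ K0] allI impI)
      fix K k :: nat and a :: int and M :: nat and n r \<omega> :: real
      assume K: "K0 \<le> K" and good: "\<forall>x\<in>gridcell m k a. bad_between cb 0 (real R ^ k / (2 * real R)) x"
        and n: "real R ^ (8 * K + 2 * k) \<le> n" "n \<le> real R ^ (8 * K + 2 * k + 2)"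
        and r: "0 < r" and M: "2 / r\<^sup>2 < real M" "real M ^ 4 \<le> real R ^ K"
      define T where "T = real R ^ K"
      define S where "S = real R ^ k"
      have S1: "S \<ge> 1" using R by (simp add: S_def)
      have T1: "T \<ge> 1" using R by (simp add: T_def)
      have W: "W \<le> 2 ^ K" using K0 power_increasing[OF K, of "2::real"] by linarith
      have "2 ^ K \<le> T" unfolding T_def using R by (intro power_mono) auto
      then have WT: "W \<le> T" using W by linarith
      have Wparts: "1 / (16 * real R * real m * cb) \<le> W" "2 * real R * real m * E \<le> W" "16 * (C3 + C2)\<^sup>2 \<le> W"
        using R0 m0 cb E by (simp_all add: W_def)
      have M0: "M > 0"
      proof -
        have "2 / r\<^sup>2 > 0" using r by simp
        then show ?thesis using M by (metis gr0I less_asym of_nat_0)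
      qed
      have MT: "real M \<le> T"
      proof -
        have "real M ^ 1 \<le> real M ^ 4" using M0 by (intro power_increasing) auto
        then show ?thesis using M(2) unfolding T_def power_one_right by linarith
      qed
      have ST: "real R ^ (k + K) = S * T" by (simp add: S_def T_def power_add)
      have mk: "real m ^ k = S\<^sup>2" by (simp add: m_def S_def mult.commute flip: power_mult)
      \<comment> \<open>Many subcells whose points are badly approximable with the uniform constant \<open>c\<close>; each
        of them contains a Farey pair.\<close>
      obtain U where U: "finite U" "card U = (m - 3) ^ K"
        "\<And>u. u \<in> U \<Longrightarrow> gridcell m (k + K) u \<subseteq> gridcell m k a"
        "\<And>u x. u \<in> U \<Longrightarrow> x \<in> gridcell m (k + K) u \<Longrightarrow>
           bad_between c (real R ^ k / (2 * real R)) (real R ^ (k + K) / (2 * real R)) x"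
        using good_descendants[where R = R and m = m and l = k and L = K and root = a] R m_def
        unfolding c_def by (auto simp del: One_nat_def)
      define farey :: "int \<Rightarrow> (int \<times> int) \<times> int \<times> int \<Rightarrow> bool" where
        "farey u w \<longleftrightarrow> (case w of ((p, q), (p', q')) \<Rightarrow>
          p' * q - p * q' = 1 \<and> 0 < q \<and> S * T / real m \<le> q \<and> q \<le> 8 * real m * (S * T) \<and>
          4 * (real m)\<^sup>2 * q \<le> q' \<and> q' \<le> t * q \<and>
          of_int p / real_of_int q \<in> {of_int u / real m ^ (k + K) <..< (of_int u + 1) / real m ^ (k + K)} \<and>
          of_int p' / real_of_int q' \<in> {of_int u / real m ^ (k + K) <..< (of_int u + 1) / real m ^ (k + K)})" for u w
      have "\<exists>w. farey u w" if u: "u \<in> U" for u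
      proof -
        have weak: "bad_between cb 0 (real R ^ k / (2 * real R)) x" if "x \<in> gridcell m (k + K) u" for x
          using good U(3)[OF u] that by blast
        have strong: "bad_between (1 / (8 * (real m)\<^sup>2)) (real R ^ k / (2 * real R)) (real R ^ (k + K) / (2 * real R)) x"
          if "x \<in> gridcell m (k + K) u" for x
          using U(4)[OF u that] by (simp add: c_def)
        have lo: "real R ^ k / (2 * real R) \<le> cb * (8 * real m * real R ^ (k + K))"
        proof -
          have "1 / (16 * real R * real m * cb) \<le> T" using Wparts WT by linarith
          then have "1 \<le> T * (16 * real R * real m * cb)" using R0 m0 cb by (simp add: divide_le_eq)
          then have "S * 1 \<le> S * (T * (16 * real R * real m * cb))" using S1 by (intro mult_left_mono) auto
          then show ?thesis using R0 unfolding ST S_def[symmetric] by (simp add: field_simps)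
        qed
        show ?thesis unfolding farey_def
          by (rule farey_pair_in_cell[of R m "k + K" u cb "real R ^ k / (2 * real R)", OF _ _ weak strong lo])
            (use R in \<open>auto simp: m_def t_def ST intro!: exI\<close>)
      qed
      then have "\<forall>u\<in>U. \<exists>w. farey u w" by (rule ballI)
      from bchoice[OF this] obtain w where w: "\<forall>u\<in>U. farey u (w u)" by (rule exE)
      define p q p' q' where "p u = fst (fst (w u))" and "q u = snd (fst (w u))"
        and "p' u = fst (snd (w u))" and "q' u = snd (snd (w u))" for u
      have F: "p' u * q u - p u * q' u = 1" "0 < q u" "S * T / real m \<le> q u" "q u \<le> 8 * real m * (S * T)"
        "4 * (real m)\<^sup>2 * q u \<le> q' u" "q' u \<le> t * q u"
        "of_int (p u) / real_of_int (q u) \<in> {of_int u / real m ^ (k + K) <..< (of_int u + 1) / real m ^ (k + K)}"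
        "of_int (p' u) / real_of_int (q' u) \<in> {of_int u / real m ^ (k + K) <..< (of_int u + 1) / real m ^ (k + K)}"
        if "u \<in> U" for u
        using bspec[OF w that] unfolding p_def q_def p'_def q'_def farey_def by (auto simp: case_prod_beta)
      have q'0: "0 < q' u" if "u \<in> U" for u
      proof -
        have "0 < 4 * (real m)\<^sup>2 * q u" using F(2)[OF that] m0 by simp
        then show ?thesis using F(5)[OF that] by linarith
      qed
      \<comment> \<open>Badly approximable points of a grid that is fine enough to resolve the phases.\<close>
      define G where "G = m ^ (5 * K)"
      have G: "real G = T ^ 10" by (simp add: G_def m_def T_def flip: power_mult) (simp add: mult.commute mult.left_commute)
      have G0: "G > 0" using m0 by (simp add: G_def)
      obtain X0 where X0: "finite X0" "card X0 = (m - 3) ^ (5 * K)"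
        "\<And>a. a \<in> X0 \<Longrightarrow> gridcell m (5 * K) a \<subseteq> gridcell m 0 0"
        "\<And>a x. a \<in> X0 \<Longrightarrow> x \<in> gridcell m (5 * K) a \<Longrightarrow>
           bad_between c (1 / (2 * real R)) (real R ^ (5 * K) / (2 * real R)) x"
        using good_descendants[where R = R and m = m and l = 0 and L = "5 * K" and root = 0] R m_def
        unfolding c_def by (auto simp del: One_nat_def)
      have X0in: "0 \<le> a" "a < int G" "of_int a / real G \<in> gridcell m (5 * K) a" if "a \<in> X0" for a
      proof -
        have "of_int a / real G \<in> gridcell m (5 * K) a" "(of_int a + 1) / real G \<in> gridcell m (5 * K) a"
          by (auto simp: gridcell_def G_def intro!: divide_right_mono)
        then have "of_int a / real G \<ge> 0" "(of_int a + 1) / real G \<le> 1" "of_int a / real G \<in> gridcell m (5 * K) a"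
          using X0(3)[OF that] by (auto simp: gridcell_def)
        then show "0 \<le> a" "a < int G" "of_int a / real G \<in> gridcell m (5 * K) a"
          using G0 by (auto simp: zero_le_divide_iff divide_le_eq)
      qed
      define X where "X = nat ` X0"
      have "inj_on nat X0" using X0in(1) by (intro inj_onI) (simp add: eq_nat_nat_iff)
      then have cardX: "card X = (m - 3) ^ (5 * K)" unfolding X_def using X0(2) by (simp add: card_image)
      have finX: "finite X" unfolding X_def using X0(1) by simp
      have XG: "X \<subseteq> {..<G}" unfolding X_def using X0in(1,2) G0 by (auto simp: nat_less_iff)
      have Xbad: "bad_between c 1 (T ^ 5 / (2 * real R)) (real x / real G)" "0 \<le> real x / real G" "real x / real G \<le> 1"
        if x: "x \<in> X" for x
      proof -
        obtain y where y: "y \<in> X0" "x = nat y" using x by (auto simp: X_def)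
        then have "real x = of_int y" using X0in(1)[OF y(1)] by simp
        then have "bad_between c (1 / (2 * real R)) (real R ^ (5 * K) / (2 * real R)) (real x / real G)"
          using X0(4)[OF y(1) X0in(3)[OF y(1)]] by simp
        moreover have "real R ^ (5 * K) = T ^ 5" by (simp add: T_def mult.commute flip: power_mult)
        ultimately show "bad_between c 1 (T ^ 5 / (2 * real R)) (real x / real G)"
          using R by (auto elim!: bad_between_mono)
        have "x < G" using XG x by auto
        then show "0 \<le> real x / real G" "real x / real G \<le> 1" by (auto simp: divide_le_eq)
      qed
      define MU where "MU u x = (of_int (p u) + of_int (p' u) * (real x / real G)) / (of_int (q u) + of_int (q' u) * (real x / real G))"
        for u and x :: nat
      have MUin: "MU u x \<in> gridcell m (k + K) u" if "u \<in> U" "x \<in> X" for u x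
        unfolding MU_def gridcell_def atLeastAtMost_iff
        using F(2,7,8)[OF that(1)] q'0[OF that(1)] Xbad(2)[OF that(2)]
          mobius_between[where q = "of_int (q u)" and q' = "of_int (q' u)" and x = "real x / real G"
            and lo = "of_int u / real m ^ (k + K)" and hi = "(of_int u + 1) / real m ^ (k + K)"
            and p = "of_int (p u)" and p' = "of_int (p' u)"]
        by auto
      \<comment> \<open>Pairs of maps whose denominators differ by less than \<open>S\<close> are rare.\<close>
      have inj: "inj_on (\<lambda>u. (p u, q u)) U"
      proof (rule inj_onI)
        fix u v assume "u \<in> U" "v \<in> U" "(p u, q u) = (p v, q v)"
        then show "u = v"
          using gridcell_open_unique[OF m0 F(7)[of u]] gridcell_open_unique[OF m0 F(7)[of v]] by simp
      qed
      define close where "close u v \<longleftrightarrow> \<bar>real_of_int (q v) - of_int (q u)\<bar> < S" for u v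
      have closecount: "real (card {v\<in>U. close u v}) \<le> C3 * T" for u
      proof -
        define \<beta> where "\<beta> = of_int a / real m ^ k"
        have bet: "\<beta> \<in> gridcell m k a" by (auto simp: \<beta>_def gridcell_def intro!: divide_right_mono)
        have "real (card {v\<in>U. \<bar>of_int (q v) - of_int (q u)\<bar> < S}) \<le> (2 / \<epsilon> + 2) * (2 * (8 * real m * T) / \<epsilon> + 2)"
        proof (rule lattice_strip_count[OF U(1) inj good[rule_format, OF bet] S1 eps(1,3)])
          show "\<epsilon> * S \<le> real R ^ k / (2 * real R)"
            using mult_right_mono[OF eps(2), of S] S1 by (simp add: S_def)
          show "\<bar>of_int (p v) - \<beta> * of_int (q v)\<bar> \<le> 8 * real m * T / S" if v: "v \<in> U" for v
          proof -
            have "of_int (p v) / of_int (q v) \<in> gridcell m k a"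
              using F(7)[OF v] U(3)[OF v] by (auto simp: gridcell_def)
            then have "\<bar>of_int (p v) / of_int (q v) - \<beta>\<bar> \<le> 1 / S\<^sup>2"
              using gridcell_dist[OF _ bet] by (simp add: mk)
            then have "\<bar>of_int (p v) / of_int (q v) - \<beta>\<bar> * of_int (q v) \<le> 1 / S\<^sup>2 * (8 * real m * (S * T))"
              using F(2,4)[OF v] by (intro mult_mono) auto
            also have "\<dots> = 8 * real m * T / S" using S1 by (simp add: power2_eq_square)
            also have "\<bar>of_int (p v) / of_int (q v) - \<beta>\<bar> * of_int (q v) = \<bar>(of_int (p v) / of_int (q v) - \<beta>) * of_int (q v)\<bar>"
              using F(2)[OF v] by (simp add: abs_mult)
            also have "(of_int (p v) / of_int (q v) - \<beta>) * of_int (q v) = of_int (p v) - \<beta> * of_int (q v)"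
              using F(2)[OF v] by (simp add: field_simps)
            finally show ?thesis .
          qed
        qed (use eps T1 in auto)
        also have "\<dots> = (2 / \<epsilon> + 2) * (16 * real m / \<epsilon> * T + 2)" by simp
        also have "\<dots> \<le> (2 / \<epsilon> + 2) * (16 * real m / \<epsilon> * T + 2 * T)"
          using T1 eps by (intro mult_left_mono add_left_mono) auto
        also have "\<dots> = C3 * T" by (simp add: C3_def algebra_simps)
        finally show ?thesis by (simp add: close_def)
      qed
      have Rp: "T ^ 8 * S\<^sup>2 = real R ^ (8 * K + 2 * k)"
        by (simp add: T_def S_def power_add mult.commute flip: power_mult)
      have nn: "T ^ 8 * S\<^sup>2 \<le> n" "n \<le> (real R)\<^sup>2 * (T ^ 8 * S\<^sup>2)"
        using n unfolding Rp by (simp_all add: power_add power2_eq_square mult_ac)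
      have sums: "norm (\<Sum>z\<in>X \<times> U. unit_exp (real h * (n * MU (snd z) (fst z)))) \<le> real (card (X \<times> U)) / (2 * real M)"
        if h: "1 \<le> h" "h < M" for h
      proof -
        define \<theta> where "\<theta> u x = real h * n * MU u x" for u x
        have pair: "norm (\<Sum>x<G. unit_exp (\<theta> u x - \<theta> v x)) \<le> real G * (C2 / T)"
          if uv: "u \<in> U" "v \<in> U" "\<not> close u v" for u v
        proof -
          have det: "real_of_int (p' u) * of_int (q u) - of_int (p u) * of_int (q' u) = 1" if "u \<in> U" for u
          proof -
            have "real_of_int (p' u * q u - p u * q' u) = 1" using F(1)[OF that] by simp
            then show ?thesis by simp
          qed
          have dq: "d * (S * T) \<le> q u" if "u \<in> U" for u using F(3)[OF that] by (simp add: d_def)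
          have eq: "q u + q' u \<le> e * (S * T)" if "u \<in> U" for u
          proof -
            have "real_of_int (q u) + q' u \<le> (1 + t) * q u" using F(6)[OF that] by (simp add: distrib_right)
            also have "\<dots> \<le> (1 + t) * (8 * real m * (S * T))" using F(4)[OF that] t by (intro mult_left_mono) auto
            finally show ?thesis by (simp add: e_def mult_ac)
          qed
          have "norm (\<Sum>x<G. unit_exp (real h * n * (MU u x - MU v x))) \<le> real G * (C2 / T)"
            unfolding MU_def C2_def
          proof (rule mobius_pair_grid_sum[where S = S and d = d and e = e and t = t and \<rho> = "(real R)\<^sup>2"])
            show "S \<le> \<bar>real_of_int (q u) - of_int (q v)\<bar>" using uv(3) by (simp add: close_def abs_minus_commute)
            show "real h \<le> T" using h MT by linarith
          qed (use det[OF uv(1)] det[OF uv(2)] dq[OF uv(1)] dq[OF uv(2)] eq[OF uv(1)] eq[OF uv(2)] S1 T1 de t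
                  F(6)[OF uv(1)] F(6)[OF uv(2)] q'0[OF uv(1)] q'0[OF uv(2)] nn h G in auto)
          then show ?thesis by (simp add: \<theta>_def right_diff_distrib)
        qed
        have "(norm (\<Sum>x\<in>X. \<Sum>u\<in>U. unit_exp (\<theta> u x)))\<^sup>2
           \<le> real (card X) * (real (card U) * (real G * (C3 * T + real (card U) * (C2 / T))))"
          using bilinear_sum_bound[where close = close and \<delta> = "C2 / T" and A = "C3 * T", OF U(1) XG _ pair closecount] C2 T1 by simp
        also have "\<dots> \<le> (real (card X) * real (card U) / (2 * real M))\<^sup>2"
          using counting_beats_loss[OF R C2(1) C3 _ M(2) M0, of] Wparts(3) W C2(2) C3
          unfolding cardX U(2) G_def T_def m_def by simp
        finally have "norm (\<Sum>x\<in>X. \<Sum>u\<in>U. unit_exp (\<theta> u x)) \<le> real (card X) * real (card U) / (2 * real M)"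
          by (rule power2_le_imp_le) simp
        moreover have "(\<Sum>z\<in>X \<times> U. unit_exp (real h * (n * MU (snd z) (fst z)))) = (\<Sum>x\<in>X. \<Sum>u\<in>U. unit_exp (\<theta> u x))"
          by (simp add: sum.cartesian_product \<theta>_def case_prod_beta mult.assoc)
        ultimately show ?thesis by (simp add: card_cartesian_product)
      qed
      have m3: "m - 3 > 0" using m by simp
      have ne: "X \<times> U \<noteq> {}" "finite (X \<times> U)"
      proof -
        have "card X > 0" "card U > 0" using cardX U(2) m3 by simp_all
        then show "X \<times> U \<noteq> {}" by (metis Sigma_empty1 Sigma_empty2 card.empty less_irrefl Times_empty)
        show "finite (X \<times> U)" using finX U(1) by simp
      qed
      obtain z where z: "z \<in> X \<times> U" "dist_int (n * MU (snd z) (fst z) - \<omega>) < r"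
        using small_exponential_sums_hit[OF ne(2,1) r M(1) sums] by blast
      obtain x u where xu: "x \<in> X" "u \<in> U" "z = (x, u)" using z(1) by auto
      define \<tau> where "\<tau> = MU u x"
      have tau: "\<tau> \<in> gridcell m (k + K) u" using MUin xu by (simp add: \<tau>_def)
      show "\<exists>\<tau>\<in>gridcell m k a. dist_int (n * \<tau> - \<omega>) < r \<and>
          bad_between cs (real R ^ k / (2 * real R)) (real R ^ (k + 5 * K)) \<tau>"
      proof (intro bexI conjI)
        show "dist_int (n * \<tau> - \<omega>) < r" using z(2) xu(3) by (simp add: \<tau>_def)
        show "\<tau> \<in> gridcell m k a" using tau U(3)[OF xu(2)] by blast
        \<comment> \<open>Small denominators are covered by the subcell, the others by badness of \<open>x\<close>.\<close>
        have 1: "bad_between cs (real R ^ k / (2 * real R)) (real R ^ (k + K) / (2 * real R)) \<tau>"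
          using U(4)[OF xu(2) tau] cs(2) by (rule bad_between_mono) auto
        have 2: "bad_between cs (real R ^ (k + K) / (2 * real R)) (real R ^ (k + 5 * K)) \<tau>"
          unfolding bad_between_def
        proof (intro allI impI)
          fix B :: nat and A :: int
          assume B: "real R ^ (k + K) / (2 * real R) \<le> real B \<and> real B < real R ^ (k + 5 * K)"
          have B1: "S * T / (2 * real R) \<le> real B" using B by (simp add: ST)
          have B2: "real B < S * T ^ 5" using B by (simp add: S_def T_def power_add mult.commute flip: power_mult)
          have STp: "S * T > 0" using S1 T1 by simp
          have B0: "B > 0"
          proof -
            have "S * T / (2 * real R) > 0" using STp R0 by simp
            then show ?thesis using B1 by (metis gr0I not_less of_nat_0)
          qed
          have qb: "of_int (q u) \<le> b * real B"
          proof -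
            have "b * (S * T / (2 * real R)) = 8 * real m * (S * T)" using R0 by (simp add: b_def)
            then have "of_int (q u) \<le> b * (S * T / (2 * real R))" using F(4)[OF xu(2)] by simp
            also have "\<dots> \<le> b * real B" using B1 b by (intro mult_left_mono) auto
            finally show ?thesis .
          qed
          have EB: "(t * b\<^sup>2 + 1) * real B / of_int (q u) < T ^ 5 / (2 * real R)"
          proof -
            have q0: "real_of_int (q u) > 0" using F(2)[OF xu(2)] by simp
            have "(t * b\<^sup>2 + 1) * real B = E * real B" by (simp add: E_def)
            also have "\<dots> < E * (S * T ^ 5)" using B2 E by simp
            also have "\<dots> = (T ^ 5 / (2 * real R)) * ((2 * real R * real m * E) * (S * T / real m) / T)"
              using R0 m0 T1 by (simp add: field_simps)
            also have "\<dots> \<le> (T ^ 5 / (2 * real R)) * (T * of_int (q u) / T)"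
              using Wparts(2) WT F(3)[OF xu(2)] S1 T1 R0 m0 by (intro mult_left_mono divide_right_mono mult_mono) auto
            also have "\<dots> = (T ^ 5 / (2 * real R)) * of_int (q u)" using T1 by simp
            finally show ?thesis using q0 by (simp add: pos_divide_less_eq)
          qed
          show "cs / real B \<le> \<bar>real B * \<tau> - of_int A\<bar>"
            using mobius_image_bad[OF F(1)[OF xu(2)] F(2)[OF xu(2)] q'0[OF xu(2)] F(6)[OF xu(2)]
                Xbad(2,3,1)[OF xu(1)] c t b B0 qb EB]
            by (simp add: \<tau>_def MU_def cs_def E_def)
        qed
        show "bad_between cs (real R ^ k / (2 * real R)) (real R ^ (k + 5 * K)) \<tau>"
          by (rule bad_between_join[OF 1 2])
      qed
    qed
  qed
  have "cs \<le> 1" using cs c by linarith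
  then show thesis using that[OF cs(1) _ main] by blast
qed

section \<open>Hausdorff measure in the plane\<close>

lemma hausdorff_weight_pos_exponent:
  assumes "s > 0"
  shows "hausdorff_weight s U = ennreal (diameter U powr s)"
  using assms by (simp add: hausdorff_weight_def)

lemma hausdorff_measure_0_nonempty:
  assumes "E \<noteq> {}"
  shows "hausdorff_measure 0 E \<noteq> 0"
proof -
  have "1 \<le> hausdorff_premeasure 0 1 E"
    unfolding hausdorff_premeasure_def
  proof (rule INF_greatest)
    fix U assume "U \<in> {U :: nat \<Rightarrow> 'a set. E \<subseteq> (\<Union>i. U i) \<and> (\<forall>i. bounded (U i) \<and> diameter (U i) \<le> 1)}"
    then have "E \<subseteq> (\<Union>i. U i)" by simp
    then obtain i where "U i \<noteq> {}" using assms by blast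
    then have "1 = (\<Sum>j\<in>{i}. hausdorff_weight 0 (U j))" by (simp add: hausdorff_weight_def)
    also have "\<dots> \<le> (\<Sum>j. hausdorff_weight 0 (U j))" by (rule sum_le_suminf) auto
    finally show "1 \<le> (\<Sum>j. hausdorff_weight 0 (U j))" .
  qed
  also have "\<dots> \<le> hausdorff_measure 0 E"
    unfolding hausdorff_measure_def by (rule SUP_upper) auto
  finally show ?thesis by auto
qed

text \<open>
  Replaces a set of diameter \<open>d\<close>, possibly \<open>0\<close>, by an open ball at negligible cost.
\<close>

lemma powr_slightly_larger_radius:
  fixes d s \<tau> :: real
  assumes "0 \<le> d" "d < 1" "s > 0" "\<tau> > 0"
  obtains \<rho> where "d < \<rho>" "\<rho> \<le> 1" "\<rho> powr s \<le> d powr s + \<tau>"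
proof -
  define w where "w = (d powr s + \<tau>) powr (1 / s)"
  have pos: "d powr s + \<tau> > 0" using assms by (simp add: add_nonneg_pos)
  have "d = (d powr s) powr (1 / s)" using assms by (simp add: powr_powr)
  also have "\<dots> < w" unfolding w_def using assms by (intro powr_less_mono2) auto
  finally have "d < w" .
  moreover have "w powr s = d powr s + \<tau>" using assms pos by (simp add: w_def powr_powr)
  ultimately show thesis
    using assms that[of "min 1 w"] powr_mono2[of s "min 1 w" w] by auto
qed

text \<open>
  Counting nodes replaces a measure: by compactness finitely many of the balls cover a whole level of the
  tree, and at a deep enough level each ball meets at most the proportion \<open>C \<rho>\<^sup>s\<close> of the nodes.
\<close>

lemma mass_distribution_principle:
  fixes N :: "nat \<Rightarrow> 'b set" and F :: "nat \<Rightarrow> 'b \<Rightarrow> 'a :: {heine_borel, real_normed_vector} set"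
  assumes s: "s > 0"
    and N: "\<And>k. finite (N k)" "\<And>k. N k \<noteq> {}"
    and F: "\<And>k v. v \<in> N k \<Longrightarrow> compact (F k v)" "\<And>k v. v \<in> N k \<Longrightarrow> F k v \<noteq> {}"
    and nested: "\<And>k. (\<Union>v\<in>N (Suc k). F (Suc k) v) \<subseteq> (\<Union>v\<in>N k. F k v)"
    and count: "\<And>\<rho>. 0 < \<rho> \<Longrightarrow> \<rho> \<le> 1 \<Longrightarrow>
       \<exists>k0. \<forall>K\<ge>k0. \<forall>z. real (card {v\<in>N K. F K v \<inter> ball z \<rho> \<noteq> {}}) \<le> C * \<rho> powr s * real (card (N K))"
    and E: "(\<Inter>k. \<Union>v\<in>N k. F k v) \<subseteq> E" and C: "C > 0"
  shows "hausdorff_measure s E \<noteq> 0"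
proof
  assume "hausdorff_measure s E = 0"
  moreover have "hausdorff_premeasure s (1/2) E \<le> hausdorff_measure s E"
    unfolding hausdorff_measure_def by (rule SUP_upper) auto
  ultimately have zero: "hausdorff_premeasure s (1/2) E = 0" by simp
  define \<eta> where "\<eta> = 1 / (4 * C)"
  have eta: "\<eta> > 0" using C by (simp add: \<eta>_def)
  have "hausdorff_premeasure s (1/2) E < ennreal \<eta>" using eta zero by simp
  then obtain U :: "nat \<Rightarrow> 'a set" where U: "E \<subseteq> (\<Union>i. U i)" "\<And>i. bounded (U i)" "\<And>i. diameter (U i) \<le> 1/2"
    "(\<Sum>i. hausdorff_weight s (U i)) < ennreal \<eta>"
    unfolding hausdorff_premeasure_def INF_less_iff by auto
  define d where "d i = diameter (U i)" for i
  have d: "0 \<le> d i" "d i < 1" for i using U(2)[of i] U(3)[of i] by (auto simp: d_def diameter_ge_0)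
  have "\<exists>\<rho>. d i < \<rho> \<and> \<rho> \<le> 1 \<and> \<rho> powr s \<le> d i powr s + \<eta> * (1/2) ^ Suc i" for i
    by (rule powr_slightly_larger_radius[OF d s, of "\<eta> * (1/2) ^ Suc i" i]) (use eta in auto)
  then obtain \<rho> where rho: "\<And>i. d i < \<rho> i" "\<And>i. \<rho> i \<le> 1" "\<And>i. \<rho> i powr s \<le> d i powr s + \<eta> * (1/2) ^ Suc i"
    by metis
  have rho0: "\<rho> i > 0" for i using d(1)[of i] rho(1)[of i] by linarith
  \<comment> \<open>For empty \<open>U i\<close> the centre is arbitrary and the radius still contributes to the sum as required.\<close>
  define x where "x i = (SOME y. y \<in> U i)" for i
  have Ux: "U i \<subseteq> ball (x i) (\<rho> i)" for i
  proof
    fix y assume y: "y \<in> U i"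
    then have "x i \<in> U i" unfolding x_def by (rule someI)
    then have "dist (x i) y \<le> d i" using y U(2) unfolding d_def by (intro diameter_bounded_bound) auto
    then show "y \<in> ball (x i) (\<rho> i)" using rho(1)[of i] by simp
  qed
  define V where "V = (\<Union>i. ball (x i) (\<rho> i))"
  define FF where "FF k = (\<Union>v\<in>N k. F k v)" for k
  have FFc: "compact (FF k)" for k unfolding FF_def by (intro compact_UN N F)
  have FFmono: "FF n \<subseteq> FF m" if "m \<le> n" for m n
    using lift_Suc_antimono_le[of FF, OF _ that] nested unfolding FF_def by blast
  have "\<exists>K. FF K \<subseteq> V"
  proof (rule ccontr)
    assume no: "\<not> ?thesis"
    have "\<Inter>(range (\<lambda>k. FF k - V)) \<noteq> {}"
    proof (rule compact_nest)
      show "compact (FF k - V)" for k by (intro compact_diff FFc) (auto simp: V_def)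
      show "FF k - V \<noteq> {}" for k using no by auto
      show "FF n - V \<subseteq> FF m - V" if "m \<le> n" for m n using FFmono[OF that] by auto
    qed
    then obtain y where y: "\<And>k. y \<in> FF k" "y \<notin> V" by auto
    then have "y \<in> E" using E by (auto simp: FF_def)
    then show False using U(1) Ux y(2) unfolding V_def by blast
  qed
  then obtain K where K: "FF K \<subseteq> V" by blast
  obtain I where I: "finite I" "FF K \<subseteq> (\<Union>i\<in>I. ball (x i) (\<rho> i))"
    using compactE_image[OF FFc[of K], of UNIV "\<lambda>i. ball (x i) (\<rho> i)"] K unfolding V_def by auto
  have "\<forall>i. \<exists>k0. \<forall>K\<ge>k0. \<forall>z. real (card {v\<in>N K. F K v \<inter> ball z (\<rho> i) \<noteq> {}}) \<le> C * \<rho> i powr s * real (card (N K))"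
    using count[OF rho0 rho(2)] by blast
  from choice[OF this] obtain k0 where k0': "\<forall>i. \<forall>K\<ge>k0 i. \<forall>z. real (card {v\<in>N K. F K v \<inter> ball z (\<rho> i) \<noteq> {}}) \<le> C * \<rho> i powr s * real (card (N K))"
    by (rule exE)
  have k0: "\<And>i K z. K \<ge> k0 i \<Longrightarrow> real (card {v\<in>N K. F K v \<inter> ball z (\<rho> i) \<noteq> {}}) \<le> C * \<rho> i powr s * real (card (N K))"
    using k0' by simp
  define K' where "K' = Max (insert K (k0 ` I))"
  have K': "K \<le> K'" "\<And>i. i \<in> I \<Longrightarrow> k0 i \<le> K'" using I(1) by (auto simp: K'_def)
  have "N K' \<subseteq> (\<Union>i\<in>I. {v\<in>N K'. F K' v \<inter> ball (x i) (\<rho> i) \<noteq> {}})"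
  proof
    fix v assume v: "v \<in> N K'"
    then obtain y where y: "y \<in> F K' v" using F(2) by blast
    then have "y \<in> FF K" using FFmono[OF K'(1)] v unfolding FF_def by auto
    then show "v \<in> (\<Union>i\<in>I. {v\<in>N K'. F K' v \<inter> ball (x i) (\<rho> i) \<noteq> {}})" using I(2) v y by blast
  qed
  then have "card (N K') \<le> card (\<Union>i\<in>I. {v\<in>N K'. F K' v \<inter> ball (x i) (\<rho> i) \<noteq> {}})"
    using I(1) N(1) by (intro card_mono) auto
  also have "\<dots> \<le> (\<Sum>i\<in>I. card {v\<in>N K'. F K' v \<inter> ball (x i) (\<rho> i) \<noteq> {}})" by (rule card_UN_le[OF I(1)])
  finally have "real (card (N K')) \<le> (\<Sum>i\<in>I. real (card {v\<in>N K'. F K' v \<inter> ball (x i) (\<rho> i) \<noteq> {}}))"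
    by (simp flip: of_nat_sum)
  also have "\<dots> \<le> (\<Sum>i\<in>I. C * \<rho> i powr s * real (card (N K')))" by (intro sum_mono k0 K')
  also have "\<dots> = (C * (\<Sum>i\<in>I. \<rho> i powr s)) * real (card (N K'))"
    by (simp add: sum_distrib_left sum_distrib_right mult_ac)
  finally have "real (card (N K')) \<le> (C * (\<Sum>i\<in>I. \<rho> i powr s)) * real (card (N K'))" .
  moreover have "card (N K') > 0" using N by (simp add: card_gt_0_iff)
  ultimately have "1 \<le> C * (\<Sum>i\<in>I. \<rho> i powr s)" by simp
  moreover have "(\<Sum>i\<in>I. \<rho> i powr s) \<le> 2 * \<eta>"
  proof -
    have "(\<Sum>i\<in>I. \<rho> i powr s) \<le> (\<Sum>i\<in>I. d i powr s) + (\<Sum>i\<in>I. \<eta> * (1/2) ^ Suc i)"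
      unfolding sum.distrib[symmetric] by (intro sum_mono rho(3))
    moreover have "(\<Sum>i\<in>I. \<eta> * (1/2) ^ Suc i) \<le> \<eta>"
    proof -
      have "(\<Sum>i\<in>I. \<eta> * (1/2) ^ Suc i) \<le> (\<Sum>i. \<eta> * (1/2) ^ Suc i)"
        using eta I(1) sums_mult[OF power_half_series, of \<eta>] by (intro sum_le_suminf) (auto simp: sums_iff)
      also have "\<dots> = \<eta>" using sums_mult[OF power_half_series, of \<eta>] by (simp add: sums_iff)
      finally show ?thesis .
    qed
    moreover have "(\<Sum>i\<in>I. d i powr s) \<le> \<eta>"
    proof -
      have "ennreal (\<Sum>i\<in>I. d i powr s) = (\<Sum>i\<in>I. hausdorff_weight s (U i))"
        by (simp add: hausdorff_weight_pos_exponent[OF s] d_def)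
      also have "\<dots> \<le> (\<Sum>i. hausdorff_weight s (U i))" by (rule sum_le_suminf) (use I(1) in auto)
      also have "\<dots> < ennreal \<eta>" by (rule U(4))
      finally show ?thesis using eta by (simp add: ennreal_less_iff sum_nonneg)
    qed
    ultimately show ?thesis by linarith
  qed
  then have "C * (\<Sum>i\<in>I. \<rho> i powr s) \<le> C * (2 * \<eta>)" using C by (intro mult_left_mono) auto
  ultimately show False using C by (simp add: \<eta>_def)
qed

text \<open>
  The \<open>i\<close>-th unit square is cut into so many small squares that it contributes at most \<open>\<eta>\<close> divided by the
  \<open>(i + 1)\<close>-st power of \<open>2\<close>.
\<close>

lemma hausdorff_measure_plane_above_2:
  fixes E :: "(real \<times> real) set"
  assumes s: "s > 2"
  shows "hausdorff_measure s E = 0"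
proof -
  have small: "hausdorff_premeasure s \<epsilon> E \<le> ennreal \<eta>" if eps: "\<epsilon> > 0" and eta: "\<eta> > 0" for \<epsilon> \<eta>
  proof -
    have "\<exists>M::nat. M > 0 \<and> 2 / real M \<le> \<epsilon> \<and> (real M)\<^sup>2 * (2 / real M) powr s \<le> \<eta> * (1/2) ^ Suc i" for i :: nat
    proof -
      have "((\<lambda>M. 2 / real M) \<longlongrightarrow> 0) sequentially" by (rule lim_const_over_n)
      then have 1: "\<forall>\<^sub>F M in sequentially. 2 / real M < \<epsilon>" using eps by (rule order_tendstoD)
      have "((\<lambda>M. 2 powr s * real M powr (2 - s)) \<longlongrightarrow> 2 powr s * 0) sequentially"
        using s by (intro tendsto_mult tendsto_const tendsto_neg_powr filterlim_real_sequentially) auto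
      moreover have "\<forall>\<^sub>F M in sequentially. 2 powr s * real M powr (2 - s) = (real M)\<^sup>2 * (2 / real M) powr s"
        using eventually_gt_at_top[of 0]
      proof eventually_elim
        case (elim M)
        then show ?case by (simp add: powr_diff powr_divide powr_numeral)
      qed
      ultimately have "((\<lambda>M. (real M)\<^sup>2 * (2 / real M) powr s) \<longlongrightarrow> 0) sequentially"
        by (simp add: tendsto_cong)
      then have 2: "\<forall>\<^sub>F M in sequentially. (real M)\<^sup>2 * (2 / real M) powr s < \<eta> * (1/2) ^ Suc i"
        using eta by (intro order_tendstoD) auto
      have "\<forall>\<^sub>F M in sequentially. M > (0::nat)" by (rule eventually_gt_at_top)
      then have "\<forall>\<^sub>F M in sequentially. M > 0 \<and> 2 / real M \<le> \<epsilon> \<and> (real M)\<^sup>2 * (2 / real M) powr s \<le> \<eta> * (1/2) ^ Suc i"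
        using 1 2 by eventually_elim auto
      then show ?thesis using eventually_happens' sequentially_bot by blast
    qed
    then obtain M where M: "\<And>i. M i > 0" "\<And>i::nat. 2 / real (M i) \<le> \<epsilon>"
      "\<And>i. (real (M i))\<^sup>2 * (2 / real (M i)) powr s \<le> \<eta> * (1/2) ^ Suc i" by metis
    define corner :: "nat \<Rightarrow> int \<times> int" where "corner = from_nat_into UNIV"
    have "surj corner" unfolding corner_def by (rule range_from_nat_into) auto
    define Q where "Q i r = (if r < (M i)\<^sup>2 then
        gridcell (M i) 1 (int (M i) * fst (corner i) + int (r mod M i)) \<times>
        gridcell (M i) 1 (int (M i) * snd (corner i) + int (r div M i)) else {})" for i r
    have dist_cell: "dist y z \<le> 2 / real (M i)" if yz: "y \<in> Q i r" "z \<in> Q i r" for y z i r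
    proof -
      obtain a b where "y \<in> gridcell (M i) 1 a \<times> gridcell (M i) 1 b" "z \<in> gridcell (M i) 1 a \<times> gridcell (M i) 1 b"
        using yz unfolding Q_def by (meson empty_iff)
      then have "\<bar>fst y - fst z\<bar> \<le> 1 / real (M i)" "\<bar>snd y - snd z\<bar> \<le> 1 / real (M i)"
        using gridcell_dist[of _ "M i" 1] by (auto simp: mem_Times_iff)
      moreover have "dist y z \<le> \<bar>fst y - fst z\<bar> + \<bar>snd y - snd z\<bar>"
        using sqrt_sum_squares_le_sum_abs[of "fst y - fst z" "snd y - snd z"]
        by (simp add: dist_prod_def dist_real_def)
      ultimately show ?thesis by simp
    qed
    have Qb: "bounded (Q i r)" for i r
      unfolding Q_def gridcell_def by (auto intro: bounded_Times)
    have Qd: "diameter (Q i r) \<le> 2 / real (M i)" for i r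
      using dist_cell M(1) by (intro diameter_le) (auto simp: dist_norm)
    have weight: "hausdorff_weight s (Q i r) \<le> ennreal ((2 / real (M i)) powr s)" for i r
      unfolding hausdorff_weight_pos_exponent[OF order.strict_trans[OF zero_less_numeral s]]
      using Qd diameter_ge_0[OF Qb] s by (intro ennreal_leI powr_mono2) auto
    have inner: "(\<Sum>r. hausdorff_weight s (Q i r)) \<le> ennreal (\<eta> * (1/2) ^ Suc i)" for i
    proof -
      have "(\<Sum>r. hausdorff_weight s (Q i r)) = (\<Sum>r<(M i)\<^sup>2. hausdorff_weight s (Q i r))"
        by (rule suminf_finite) (auto simp: Q_def hausdorff_weight_def)
      also have "\<dots> \<le> (\<Sum>r<(M i)\<^sup>2. ennreal ((2 / real (M i)) powr s))" by (intro sum_mono weight)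
      also have "\<dots> = ennreal ((real (M i))\<^sup>2 * (2 / real (M i)) powr s)"
        by (simp add: ennreal_mult' ennreal_of_nat_eq_real_of_nat)
      also have "\<dots> \<le> ennreal (\<eta> * (1/2) ^ Suc i)" by (intro ennreal_leI M(3))
      finally show ?thesis .
    qed
    define U where "U n = (case prod_decode n of (i, r) \<Rightarrow> Q i r)" for n
    have "E \<subseteq> (\<Union>n. U n)"
    proof
      fix z assume "z \<in> E"
      obtain i where i: "corner i = (\<lfloor>fst z\<rfloor>, \<lfloor>snd z\<rfloor>)" using \<open>surj corner\<close> by (metis surjD)
      have fr: "\<exists>a<M i. y \<in> gridcell (M i) 1 (int (M i) * \<lfloor>y\<rfloor> + int a)" for y :: real
      proof -
        have "y \<in> gridcell (M i) 0 \<lfloor>y\<rfloor>" by (auto simp: gridcell_def)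
        from gridcell_cover[OF this M(1)] obtain a' where a': "a' \<in> subcells (M i) \<lfloor>y\<rfloor>" "y \<in> gridcell (M i) (Suc 0) a'"
          by metis
        then show ?thesis by (intro exI[of _ "nat (a' - int (M i) * \<lfloor>y\<rfloor>)"]) (auto simp: subcells_def nat_less_iff)
      qed
      obtain a b where ab: "a < M i" "b < M i" "fst z \<in> gridcell (M i) 1 (int (M i) * \<lfloor>fst z\<rfloor> + int a)"
        "snd z \<in> gridcell (M i) 1 (int (M i) * \<lfloor>snd z\<rfloor> + int b)" using fr by meson
      define r where "r = b * M i + a"
      have "b * M i + a < b * M i + M i" using ab by simp
      also have "\<dots> = Suc b * M i" by simp
      also have "\<dots> \<le> M i * M i" using ab by (intro mult_right_mono) auto
      finally have "r < (M i)\<^sup>2" by (simp add: r_def power2_eq_square)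
      moreover have "r mod M i = a" "r div M i = b" using ab by (auto simp: r_def)
      ultimately have "z \<in> Q i r" using ab by (auto simp: Q_def i mem_Times_iff)
      then have "z \<in> U (prod_encode (i, r))" by (simp add: U_def)
      then show "z \<in> (\<Union>n. U n)" by blast
    qed
    moreover have "bounded (U n)" "diameter (U n) \<le> \<epsilon>" for n
      unfolding U_def using Qb Qd M(2) order_trans by (auto split: prod.split) blast
    ultimately have "hausdorff_premeasure s \<epsilon> E \<le> (\<Sum>n. hausdorff_weight s (U n))"
      unfolding hausdorff_premeasure_def by (intro INF_lower) auto
    also have "\<dots> = (\<Sum>n. (\<lambda>(i, r). hausdorff_weight s (Q i r)) (prod_decode n))"
      by (intro suminf_cong) (simp add: U_def split: prod.split)
    also have "\<dots> = (\<Sum>i. \<Sum>r. hausdorff_weight s (Q i r))"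
      by (rule suminf_ennreal_2dimen) simp
    also have "\<dots> \<le> (\<Sum>i. ennreal (\<eta> * (1/2) ^ Suc i))" by (intro suminf_le inner) auto
    also have "\<dots> = ennreal \<eta>"
      using sums_mult[OF power_half_series, of \<eta>] eta by (intro suminf_ennreal_eq) auto
    finally show ?thesis .
  qed
  have "hausdorff_premeasure s \<epsilon> E \<le> 0" if "\<epsilon> > 0" for \<epsilon>
  proof (rule ennreal_le_epsilon)
    fix \<eta> :: real assume "\<eta> > 0"
    then show "hausdorff_premeasure s \<epsilon> E \<le> 0 + ennreal \<eta>" using small[OF that] by simp
  qed
  then have "hausdorff_measure s E \<le> 0"
    unfolding hausdorff_measure_def by (intro SUP_least) auto
  then show ?thesis by simp
qed

lemma hausdorff_dim_eq_2I:
  fixes E :: "(real \<times> real) set"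
  assumes "E \<noteq> {}" "\<And>s. 0 < s \<Longrightarrow> s < 2 \<Longrightarrow> hausdorff_measure s E \<noteq> 0"
  shows "hausdorff_dim E = 2"
proof (rule antisym)
  have "hausdorff_dim E \<le> ennreal s" if "s > 2" for s
    unfolding hausdorff_dim_def using that hausdorff_measure_plane_above_2[OF that, of E] by (intro INF_lower) auto
  note upper = this
  show "hausdorff_dim E \<le> 2"
  proof (rule ennreal_le_epsilon)
    fix e :: real assume "e > 0"
    then have "hausdorff_dim E \<le> ennreal (2 + e)" by (intro upper) simp
    also have "\<dots> = 2 + ennreal e" using \<open>e > 0\<close> by (subst ennreal_plus) simp_all
    finally show "hausdorff_dim E \<le> 2 + ennreal e" .
  qed
  show "2 \<le> hausdorff_dim E"
    unfolding hausdorff_dim_def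
  proof (rule INF_greatest)
    fix s assume s: "s \<in> {s. 0 \<le> s \<and> hausdorff_measure s E = 0}"
    then have "s \<noteq> 0" using hausdorff_measure_0_nonempty[OF assms(1)] by auto
    then have "2 \<le> s" using s assms(2)[of s] by force
    then show "2 \<le> ennreal s" using ennreal_leI[of 2 s] by simp
  qed
qed

section \<open>Trees of anisotropic rectangles\<close>

lemma in_subcells_div:
  assumes "m > 0"
  shows "a \<in> subcells m (a div int m)"
proof -
  have "0 \<le> a mod int m" "a mod int m < int m" "int m * (a div int m) + a mod int m = a" using assms by simp_all
  then show ?thesis unfolding subcells_def atLeastLessThan_iff by linarith
qed

lemma gridcell_div:
  assumes "m > 0"
  shows "gridcell m (k + i) a \<subseteq> gridcell m k (a div int m ^ i)"
proof (induction i arbitrary: a)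
  case (Suc i)
  have "gridcell m (k + Suc i) a \<subseteq> gridcell m (k + i) (a div int m)"
    using gridcell_subcell[OF in_subcells_div[OF assms, of a] assms, of "k + i"] by simp
  also have "\<dots> \<subseteq> gridcell m k (a div int m div int m ^ i)" by (rule Suc.IH)
  finally show ?case by (simp add: zdiv_zmult2_eq)
qed simp

text \<open>
  A square of side comparable to that of the rows of level \<open>k\<close> meets at most three such rows, and at
  most three columns of level \<open>k div 2\<close>, since these are at least as wide as the square. Once a row is
  prescribed, only the columns at the levels from \<open>k div 2\<close> to \<open>k\<close> remain to be chosen. Therefore the
  growth condition involves \<open>cols\<close> at the levels below \<open>k div 2\<close>, but \<open>\<rho>\<close> at all levels below \<open>k\<close>.
\<close>

lemma anisotropic_tree_measure:
  fixes Inv :: "nat \<Rightarrow> int \<Rightarrow> int \<Rightarrow> bool" and cols :: "nat \<Rightarrow> nat" and R \<rho> :: nat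
  assumes R: "R \<ge> 2" and m: "m = R\<^sup>2" and s: "s > 0" and c: "c > 0" and pos: "\<rho> > 0" "\<And>k. cols k > 0"
    and root: "Inv 0 0 0"
    and step: "\<And>k a j. Inv k a j \<Longrightarrow> \<exists>A\<subseteq>subcells m a. card A = cols k \<and>
        (\<forall>a'\<in>A. \<exists>B\<subseteq>subcells R j. card B = \<rho> \<and> (\<forall>j'\<in>B. Inv (Suc k) a' j'))"
    and growth: "\<And>k. c * real R powr (s * real k) \<le> (\<Prod>l<k div 2. real (cols l)) * real \<rho> ^ k"
    and E: "\<And>\<beta> \<delta>. (\<And>k. \<exists>a j. Inv k a j \<and> \<beta> \<in> gridcell m k a \<and> \<delta> \<in> gridcell R k j) \<Longrightarrow> (\<beta>, \<delta>) \<in> E"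
  shows "hausdorff_measure s (E :: (real \<times> real) set) \<noteq> 0"
proof -
  have m0: "m > 0" and R0: "R > 0" using R m by auto
  define Bok where "Bok k a' j B \<longleftrightarrow> B \<subseteq> subcells R j \<and> card B = \<rho> \<and> (\<forall>j'\<in>B. Inv (Suc k) a' j')" for k a' j B
  define Aok where "Aok k a j A \<longleftrightarrow> A \<subseteq> subcells m a \<and> card A = cols k \<and> (\<forall>a'\<in>A. \<exists>B. Bok k a' j B)" for k a j A
  define A where "A k a j = (SOME A. Aok k a j A)" for k a j
  define B where "B k a' j = (SOME B. Bok k a' j B)" for k a' j
  have A: "Aok k a j (A k a j)" if "Inv k a j" for k a j
    unfolding A_def using step[OF that] by (intro someI_ex[of "Aok k a j"]) (auto simp: Aok_def Bok_def)
  have B: "Bok k a' j (B k a' j)" if "Inv k a j" "a' \<in> A k a j" for k a a' j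
    unfolding B_def using A[OF that(1)] that(2) by (intro someI_ex[of "Bok k a' j"]) (auto simp: Aok_def)
  define ch where "ch k v = (case v of (a, j) \<Rightarrow> SIGMA a':A k a j. B k a' j)" for k and v :: "int \<times> int"
  define N where "N = rec_nat {(0, 0)} (\<lambda>k S. \<Union>v\<in>S. ch k v)"
  have N0: "N 0 = {(0, 0)}" and NS: "N (Suc k) = (\<Union>v\<in>N k. ch k v)" for k by (simp_all add: N_def)
  have NInv: "Inv k (fst v) (snd v)" if "v \<in> N k" for k v
    using that
  proof (induction k arbitrary: v)
    case 0
    then show ?case using root by (simp add: N0)
  next
    case (Suc k)
    then obtain a j where "(a, j) \<in> N k" "v \<in> ch k (a, j)" by (auto simp: NS)
    then have "Inv k a j" "fst v \<in> A k a j" "snd v \<in> B k (fst v) j" using Suc.IH by (auto simp: ch_def)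
    then show ?case using B[of k a j "fst v"] by (auto simp: Bok_def)
  qed
  have chA: "A k a j \<subseteq> subcells m a" "card (A k a j) = cols k" "finite (A k a j)" if "(a, j) \<in> N k" for k a j
    using A[of k a j] NInv[OF that] pos(2)[of k] by (auto simp: Aok_def intro: card_ge_0_finite)
  have chB: "B k a' j \<subseteq> subcells R j" "card (B k a' j) = \<rho>" "finite (B k a' j)" if "(a, j) \<in> N k" "a' \<in> A k a j" for k a a' j
    using B[of k a j a'] NInv[OF that(1)] that(2) pos(1) by (auto simp: Bok_def intro: card_ge_0_finite)
  have chfin: "finite (ch k v)" "card (ch k v) = cols k * \<rho>" if "v \<in> N k" for k v
  proof -
    obtain a j where v: "v = (a, j)" by (cases v)
    have "card (ch k v) = (\<Sum>a'\<in>A k a j. card (B k a' j))"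
      unfolding ch_def v using chA chB that v by (auto intro!: card_SigmaI)
    also have "\<dots> = cols k * \<rho>" using chA chB that v by simp
    finally show "card (ch k v) = cols k * \<rho>" .
    show "finite (ch k v)" unfolding ch_def v using chA chB that v by auto
  qed
  have par: "(a' div int m, j' div int R) \<in> N k" "a' \<in> A k (a' div int m) (j' div int R)"
    "(a', j') \<in> ch k (a' div int m, j' div int R)"
    if mem: "(a', j') \<in> N (Suc k)" for k a' j'
  proof -
    obtain a j where aj: "(a, j) \<in> N k" "a' \<in> A k a j" "j' \<in> B k a' j" using mem by (auto simp: NS ch_def)
    then have "a' div int m = a" "j' div int R = j"
      using chA(1)[OF aj(1)] chB(1)[OF aj(1,2)] subcells_div by blast+
    then show "(a' div int m, j' div int R) \<in> N k" "a' \<in> A k (a' div int m) (j' div int R)"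
      "(a', j') \<in> ch k (a' div int m, j' div int R)" using aj by (auto simp: ch_def)
  qed
  have Nfin: "finite (N k)" for k by (induction k) (auto simp: N0 NS chfin)
  have Ncard: "card (N k) = (\<Prod>l<k. cols l * \<rho>)" for k
  proof (induction k)
    case (Suc k)
    have "card (N (Suc k)) = (\<Sum>v\<in>N k. card (ch k v))" unfolding NS
    proof (rule card_UN_disjoint)
      show "\<forall>i\<in>N k. \<forall>j\<in>N k. i \<noteq> j \<longrightarrow> ch k i \<inter> ch k j = {}"
      proof (intro ballI impI)
        fix v w assume vw: "v \<in> N k" "w \<in> N k" "v \<noteq> w"
        have "v = (fst z div int m, snd z div int R)" if "z \<in> ch k v" "v \<in> N k" for z v
        proof -
          obtain a j where v: "v = (a, j)" by (cases v)
          then have "fst z \<in> A k a j" "snd z \<in> B k (fst z) j" using that by (auto simp: ch_def)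
          then have "fst z \<in> subcells m a" "snd z \<in> subcells R j"
            using chA(1)[of a j k] chB(1)[of a j k "fst z"] that v by auto
          then show ?thesis by (simp add: v subcells_div)
        qed
        then show "ch k v \<inter> ch k w = {}" using vw by blast
      qed
    qed (use Nfin chfin in auto)
    then show ?case using Suc chfin(2) by simp
  qed (simp add: N0)
  have Nne: "N k \<noteq> {}" for k
  proof -
    have "card (N k) > 0" unfolding Ncard using pos by (intro prod_pos) auto
    then show ?thesis by auto
  qed
  define F where "F k v = gridcell m k (fst v) \<times> gridcell R k (snd v)" for k and v :: "int \<times> int"
  define anc where "anc i v = (fst v div int m ^ i, snd v div int R ^ i)" for i and v :: "int \<times> int"
  have anc_Suc: "anc (Suc i) v = anc i (fst v div int m, snd v div int R)" for i v
    by (simp add: anc_def zdiv_zmult2_eq)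
  have Fanc: "F (k + i) v \<subseteq> F k (anc i v)" for k i v
    unfolding F_def anc_def using gridcell_div[OF m0, of k i] gridcell_div[OF R0, of k i] by auto
  have ancN: "anc i v \<in> N k" if "v \<in> N (k + i)" for k i v
    using that
  proof (induction i arbitrary: v)
    case (Suc i)
    then show ?case using par(1)[of "fst v" "snd v" "k + i"] by (simp add: anc_Suc)
  qed (simp add: anc_def)
  have desc: "card {v\<in>N (k + i). anc i v \<in> S} \<le> card S * (\<Prod>l\<in>{k..<k + i}. cols l * \<rho>)" if S: "finite S" for k i S
  proof (induction i)
    case 0
    have "card {v\<in>N (k + 0). anc 0 v \<in> S} \<le> card S" using S by (intro card_mono) (auto simp: anc_def)
    then show ?case by simp
  next
    case (Suc i)
    have "{v\<in>N (k + Suc i). anc (Suc i) v \<in> S} \<subseteq> (\<Union>w\<in>{v\<in>N (k + i). anc i v \<in> S}. ch (k + i) w)"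
    proof
      fix v assume "v \<in> {v\<in>N (k + Suc i). anc (Suc i) v \<in> S}"
      then show "v \<in> (\<Union>w\<in>{v\<in>N (k + i). anc i v \<in> S}. ch (k + i) w)"
        using par[of "fst v" "snd v" "k + i"] by (auto simp: anc_Suc intro!: bexI[of _ "(fst v div int m, snd v div int R)"])
    qed
    then have "card {v\<in>N (k + Suc i). anc (Suc i) v \<in> S} \<le> card (\<Union>w\<in>{v\<in>N (k + i). anc i v \<in> S}. ch (k + i) w)"
      using Nfin chfin by (intro card_mono) auto
    also have "\<dots> \<le> (\<Sum>w\<in>{v\<in>N (k + i). anc i v \<in> S}. card (ch (k + i) w))"
      using Nfin by (intro card_UN_le) auto
    also have "\<dots> = card {v\<in>N (k + i). anc i v \<in> S} * (cols (k + i) * \<rho>)" using chfin by simp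
    also have "\<dots> \<le> card S * (\<Prod>l\<in>{k..<k + i}. cols l * \<rho>) * (cols (k + i) * \<rho>)"
      using Suc by (intro mult_right_mono) auto
    finally show ?case by (simp add: mult.assoc)
  qed
  have colcount: "finite {a. (a, j) \<in> N (h + i) \<and> a div int m ^ i = b} \<and>
      card {a. (a, j) \<in> N (h + i) \<and> a div int m ^ i = b} \<le> (\<Prod>l\<in>{h..<h + i}. cols l)" for h i j b
  proof (induction i arbitrary: j)
    case 0
    have "{a. (a, j) \<in> N (h + 0) \<and> a div int m ^ 0 = b} \<subseteq> {b}" by auto
    then show ?case using card_mono[of "{b}"] finite_subset by fastforce
  next
    case (Suc i)
    let ?W = "{a. (a, j div int R) \<in> N (h + i) \<and> a div int m ^ i = b}"
    have sub: "{a. (a, j) \<in> N (h + Suc i) \<and> a div int m ^ Suc i = b} \<subseteq> (\<Union>a\<in>?W. A (h + i) a (j div int R))"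
    proof
      fix a assume "a \<in> {a. (a, j) \<in> N (h + Suc i) \<and> a div int m ^ Suc i = b}"
      then show "a \<in> (\<Union>a\<in>?W. A (h + i) a (j div int R))"
        using par(1,2)[of a j "h + i"] by (auto simp: zdiv_zmult2_eq intro!: bexI[of _ "a div int m"])
    qed
    have fin: "finite (\<Union>a\<in>?W. A (h + i) a (j div int R))" using Suc chA by auto
    have "card (\<Union>a\<in>?W. A (h + i) a (j div int R)) \<le> (\<Sum>a\<in>?W. card (A (h + i) a (j div int R)))"
      using Suc by (intro card_UN_le) auto
    also have "\<dots> = card ?W * cols (h + i)" using chA by simp
    also have "\<dots> \<le> (\<Prod>l\<in>{h..<h + i}. cols l) * cols (h + i)" using Suc by (intro mult_right_mono) auto
    finally show ?case using card_mono[OF fin sub] finite_subset[OF sub fin] by (auto simp: mult.commute)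
  qed
  define C where "C = 9 * real R powr s / c"
  have mk: "real m ^ h = real R ^ (2 * h)" for h by (simp add: m power_mult)
  show ?thesis
  proof (rule mass_distribution_principle[where N = N and F = F and C = C and s = s, OF s Nfin Nne])
    show "compact (F k v)" for k v unfolding F_def gridcell_def by (intro compact_Times compact_Icc)
    show "F k v \<noteq> {}" for k v
    proof -
      have "of_int a / real m ^ k \<in> gridcell m k a" for m a by (auto simp: gridcell_def intro!: divide_right_mono)
      then show ?thesis unfolding F_def by blast
    qed
    show "(\<Union>v\<in>N (Suc k). F (Suc k) v) \<subseteq> (\<Union>v\<in>N k. F k v)" for k
      using Fanc[of k 1] ancN[of _ k 1] by fastforce
    show "C > 0" using c R by (simp add: C_def)
    show "(\<Inter>k. \<Union>v\<in>N k. F k v) \<subseteq> E"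
    proof
      fix z assume z: "z \<in> (\<Inter>k. \<Union>v\<in>N k. F k v)"
      have "(fst z, snd z) \<in> E"
      proof (rule E)
        fix k
        obtain v where "v \<in> N k" "z \<in> F k v" using z by blast
        then show "\<exists>a j. Inv k a j \<and> fst z \<in> gridcell m k a \<and> snd z \<in> gridcell R k j"
          using NInv unfolding F_def by (intro exI[of _ "fst v"] exI[of _ "snd v"]) (auto simp: mem_Times_iff)
      qed
      then show "z \<in> E" by simp
    qed
    fix r :: real assume r: "0 < r" "r \<le> 1"
    obtain n where "1 / real R ^ n < r" 
      using real_arch_pow_inv[OF r(1), of "1 / real R"] R by (auto simp: power_one_over)
    then have ex: "\<exists>n. 1 / real R ^ n < r" by blast
    define n where "n = (LEAST n. 1 / real R ^ n < r)"
    have n: "1 / real R ^ n < r" unfolding n_def using ex by (rule LeastI_ex)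
    have "n \<noteq> 0" using n r by (cases n) auto
    define k where "k = n - 1"
    have nk: "n = Suc k" using \<open>n \<noteq> 0\<close> by (simp add: k_def)
    have k: "r \<le> 1 / real R ^ k" using not_less_Least[of k "\<lambda>n. 1 / real R ^ n < r"] nk by (simp add: n_def[symmetric])
    define h where "h = k div 2"
    have hk: "h + (k - h) = k" by (simp add: h_def)
    show "\<exists>k0. \<forall>K\<ge>k0. \<forall>z. real (card {v\<in>N K. F K v \<inter> ball z r \<noteq> {}}) \<le> C * r powr s * real (card (N K))"
    proof (intro exI[of _ k] allI impI)
      fix K :: nat and z :: "real \<times> real" assume K: "k \<le> K"
      obtain x y where z: "z = (x, y)" by (cases z)
      define S where "S = {v\<in>N k. F k v \<inter> ball z r \<noteq> {}}"
      define J where "J = {j. \<exists>y'\<in>gridcell R k j. \<bar>y' - y\<bar> < 1 / real R ^ k}"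
      define Ah where "Ah = {a. \<exists>x'\<in>gridcell m h a. \<bar>x' - x\<bar> < 1 / real m ^ h}"
      have J: "finite J" "card J \<le> 3" using card_cells_near_point[OF R0, of J k y] by (auto simp: J_def)
      have Ah: "finite Ah" "card Ah \<le> 3" using card_cells_near_point[OF m0, of Ah h x] by (auto simp: Ah_def)
      define W where "W b j = {a. (a, j) \<in> N (h + (k - h)) \<and> a div int m ^ (k - h) = b}" for b j
      have W: "finite (W b j)" "card (W b j) \<le> (\<Prod>l\<in>{h..<k}. cols l)" for b j
        using colcount[of j h "k - h" b] unfolding W_def hk by auto
      have "S \<subseteq> (\<Union>j\<in>J. \<Union>b\<in>Ah. W b j \<times> {j})"
      proof
        fix v assume v: "v \<in> S"
        then obtain x' y' where xy: "v \<in> N k" "x' \<in> gridcell m k (fst v)" "y' \<in> gridcell R k (snd v)" "dist (x, y) (x', y') < r"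
          by (auto simp: S_def F_def z)
        have "dist x x' < r" "dist y y' < r"
          using xy(4) dist_fst_le[of "(x, y)" "(x', y')"] dist_snd_le[of "(x, y)" "(x', y')"] by auto
        then have d: "\<bar>x' - x\<bar> < 1 / real R ^ k" "\<bar>y' - y\<bar> < 1 / real R ^ k" using k by (auto simp: dist_real_def)
        have le: "1 / real R ^ k \<le> 1 / real m ^ h"
          unfolding mk using R by (intro divide_left_mono power_increasing) (auto simp: h_def)
        have "x' \<in> gridcell m h (fst v div int m ^ (k - h))"
          using gridcell_div[OF m0, of h "k - h" "fst v"] xy(2) unfolding hk by blast
        moreover have "\<bar>x' - x\<bar> < 1 / real m ^ h" using d(1) le by linarith
        ultimately have "fst v div int m ^ (k - h) \<in> Ah" unfolding Ah_def by blast
        moreover have "snd v \<in> J" unfolding J_def using d(2) xy(3) by blast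
        moreover have "fst v \<in> W (fst v div int m ^ (k - h)) (snd v)" using xy(1) by (simp add: W_def hk)
        ultimately show "v \<in> (\<Union>j\<in>J. \<Union>b\<in>Ah. W b j \<times> {j})"
          by (intro UN_I[of "snd v"] UN_I[of "fst v div int m ^ (k - h)"]) (auto simp: mem_Times_iff)
      qed
      then have "card S \<le> card (\<Union>j\<in>J. \<Union>b\<in>Ah. W b j \<times> {j})"
        using J Ah W by (intro card_mono) auto
      also have "\<dots> \<le> (\<Sum>j\<in>J. card (\<Union>b\<in>Ah. W b j \<times> {j}))" by (intro card_UN_le J)
      also have "\<dots> \<le> (\<Sum>j\<in>J. \<Sum>b\<in>Ah. card (W b j \<times> {j}))" by (intro sum_mono card_UN_le Ah)
      also have "\<dots> \<le> (\<Sum>j\<in>J. \<Sum>b\<in>Ah. \<Prod>l\<in>{h..<k}. cols l)"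
        using W by (intro sum_mono) (simp add: card_cartesian_product)
      also have "\<dots> = card J * card Ah * (\<Prod>l\<in>{h..<k}. cols l)" by simp
      also have "\<dots> \<le> 3 * 3 * (\<Prod>l\<in>{h..<k}. cols l)" using J Ah by (intro mult_mono) auto
      finally have cS: "card S \<le> 9 * (\<Prod>l\<in>{h..<k}. cols l)" by simp
      have "{v\<in>N K. F K v \<inter> ball z r \<noteq> {}} \<subseteq> {v\<in>N (k + (K - k)). anc (K - k) v \<in> S}"
      proof
        fix v assume v: "v \<in> {v\<in>N K. F K v \<inter> ball z r \<noteq> {}}"
        then have "F k (anc (K - k) v) \<inter> ball z r \<noteq> {}" using Fanc[of k "K - k" v] K by auto
        then show "v \<in> {v\<in>N (k + (K - k)). anc (K - k) v \<in> S}"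
          using v K ancN[of v k "K - k"] by (simp add: S_def)
      qed
      then have "card {v\<in>N K. F K v \<inter> ball z r \<noteq> {}} \<le> card {v\<in>N (k + (K - k)). anc (K - k) v \<in> S}"
        using Nfin by (intro card_mono) auto
      also have "\<dots> \<le> card S * (\<Prod>l\<in>{k..<k + (K - k)}. cols l * \<rho>)"
        by (rule desc) (simp add: S_def Nfin)
      also have "\<dots> \<le> 9 * (\<Prod>l\<in>{h..<k}. cols l) * (\<Prod>l\<in>{k..<K}. cols l * \<rho>)"
        using cS K by (intro mult_mono) auto
      finally have "real (card {v\<in>N K. F K v \<inter> ball z r \<noteq> {}})
         \<le> real (9 * (\<Prod>l\<in>{h..<k}. cols l) * (\<Prod>l\<in>{k..<K}. cols l * \<rho>))"
        by (simp only: of_nat_le_iff)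
      also have "\<dots> = 9 * (real (\<Prod>l\<in>{h..<k}. cols l) * real (\<Prod>l\<in>{k..<K}. cols l * \<rho>))"
        by simp
      also have "\<dots> \<le> (C * r powr s * (c * real R powr (s * real k))) * (real (\<Prod>l\<in>{h..<k}. cols l) * real (\<Prod>l\<in>{k..<K}. cols l * \<rho>))"
      proof (rule mult_right_mono)
        have "(1 / real R ^ n) powr s \<le> r powr s" using n s R by (intro powr_mono2) auto
        moreover have "(1 / real R ^ n) powr s = 1 / real R powr (s * real n)"
          using R by (simp add: powr_divide powr_powr mult.commute flip: powr_realpow)
        ultimately have "1 / real R powr (s * real n) \<le> r powr s" by simp
        then have "1 \<le> r powr s * real R powr (s * real n)" using R by (simp add: divide_le_eq)
        also have "real R powr (s * real n) = real R powr s * real R powr (s * real k)"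
          using R by (simp add: nk powr_add[symmetric] distrib_left)
        finally have "9 * 1 \<le> 9 * (r powr s * (real R powr s * real R powr (s * real k)))" by (intro mult_left_mono) auto
        then show "9 \<le> C * r powr s * (c * real R powr (s * real k))" using c by (simp add: C_def mult_ac)
      qed (auto intro!: mult_nonneg_nonneg prod_nonneg)
      also have "\<dots> \<le> (C * r powr s * ((\<Prod>l<h. real (cols l)) * real \<rho> ^ k)) * (real (\<Prod>l\<in>{h..<k}. cols l) * real (\<Prod>l\<in>{k..<K}. cols l * \<rho>))"
        using growth[of k] c unfolding h_def by (intro mult_right_mono mult_left_mono) (auto simp: C_def intro!: mult_nonneg_nonneg prod_nonneg)
      also have "\<dots> = C * r powr s * real (card (N K))"
      proof -
        have "(\<Prod>l<K. cols l * \<rho>) = (\<Prod>l<k. cols l * \<rho>) * (\<Prod>l\<in>{k..<K}. cols l * \<rho>)"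
          using prod.atLeastLessThan_concat[of 0 k K "\<lambda>l. cols l * \<rho>"] K by (simp add: lessThan_atLeast0)
        moreover have "(\<Prod>l<k. cols l * \<rho>) = (\<Prod>l<k. cols l) * \<rho> ^ k" by (simp add: prod.distrib)
        moreover have "(\<Prod>l<k. cols l) = (\<Prod>l<h. cols l) * (\<Prod>l\<in>{h..<k}. cols l)"
          using prod.atLeastLessThan_concat[of 0 h k cols] hk by (simp add: lessThan_atLeast0 h_def)
        ultimately show ?thesis unfolding Ncard by (simp add: mult_ac)
      qed
      finally show "real (card {v\<in>N K. F K v \<inter> ball z r \<noteq> {}}) \<le> C * r powr s * real (card (N K))" .
    qed
  qed
qed

section \<open>Continued fractions and inhomogeneous approximation\<close>

fun cf_numer :: "real \<Rightarrow> nat \<Rightarrow> int" where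
  "cf_numer \<alpha> 0 = partial_quotient \<alpha> 0"
| "cf_numer \<alpha> (Suc 0) = partial_quotient \<alpha> 1 * partial_quotient \<alpha> 0 + 1"
| "cf_numer \<alpha> (Suc (Suc k)) =
     partial_quotient \<alpha> (Suc (Suc k)) * cf_numer \<alpha> (Suc k) + cf_numer \<alpha> k"

lemma complete_quotient_irrational:
  assumes "\<alpha> \<notin> \<rat>"
  shows "complete_quotient \<alpha> k \<notin> \<rat>"
proof (induction k)
  case (Suc k)
  show ?case
  proof
    assume "complete_quotient \<alpha> (Suc k) \<in> \<rat>"
    then have "1 / complete_quotient \<alpha> (Suc k) \<in> \<rat>" by (intro Rats_divide) auto
    then have "frac (complete_quotient \<alpha> k) \<in> \<rat>" by simp
    then have "frac (complete_quotient \<alpha> k) + of_int \<lfloor>complete_quotient \<alpha> k\<rfloor> \<in> \<rat>"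
      by (intro Rats_add) auto
    then show False using Suc by (simp add: frac_def)
  qed
qed (use assms in simp)

lemma complete_quotient_frac:
  assumes "\<alpha> \<notin> \<rat>"
  shows "0 < frac (complete_quotient \<alpha> k)" "frac (complete_quotient \<alpha> k) < 1"
    "complete_quotient \<alpha> (Suc k) > 1" "partial_quotient \<alpha> (Suc k) \<ge> 1"
proof -
  show 1: "0 < frac (complete_quotient \<alpha> k)"
    using complete_quotient_irrational[OF assms, of k] by (simp add: frac_gt_0_iff) (metis Ints_subset_Rats subsetD)
  show 2: "frac (complete_quotient \<alpha> k) < 1" by (rule frac_lt_1)
  show 3: "complete_quotient \<alpha> (Suc k) > 1" using 1 2 by simp
  then show "partial_quotient \<alpha> (Suc k) \<ge> 1" unfolding partial_quotient_def by linarith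
qed

lemma complete_quotient_step:
  assumes "\<alpha> \<notin> \<rat>"
  shows "complete_quotient \<alpha> k = of_int (partial_quotient \<alpha> k) + 1 / complete_quotient \<alpha> (Suc k)"
  by (simp add: partial_quotient_def frac_def)

lemma cf_denom_pos:
  assumes "\<alpha> \<notin> \<rat>"
  shows "cf_denom \<alpha> k \<ge> 1"
proof (induction k rule: less_induct)
  case (less k)
  consider "k = 0" | "k = 1" | j where "k = Suc (Suc j)" by (metis One_nat_def not0_implies_Suc)
  then show ?case
  proof cases
    case 2
    then show ?thesis using complete_quotient_frac(4)[OF assms, of 0] by simp
  next
    case 3
    have "1 * 1 \<le> partial_quotient \<alpha> (Suc (Suc j)) * cf_denom \<alpha> (Suc j)"
      using less[of "Suc j"] complete_quotient_frac(4)[OF assms, of "Suc j"] 3 by (intro mult_mono) auto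
    then show ?thesis using less[of j] 3 by simp
  qed simp
qed

lemma cf_denom_growth:
  assumes "\<alpha> \<notin> \<rat>"
  shows "cf_denom \<alpha> k \<le> cf_denom \<alpha> (Suc k)" "2 * cf_denom \<alpha> k \<le> cf_denom \<alpha> (Suc (Suc k))"
proof -
  have step: "cf_denom \<alpha> (Suc j) + cf_denom \<alpha> j \<le> cf_denom \<alpha> (Suc (Suc j))" for j
    using mult_right_mono[OF complete_quotient_frac(4)[OF assms, of "Suc j"], of "cf_denom \<alpha> (Suc j)"]
      cf_denom_pos[OF assms, of "Suc j"] by simp
  show 1: "cf_denom \<alpha> k \<le> cf_denom \<alpha> (Suc k)" for k
  proof (cases k)
    case 0
    then show ?thesis using cf_denom_pos[OF assms, of 1] by simp
  next
    case (Suc j)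
    then show ?thesis using step[of j] cf_denom_pos[OF assms, of j] by simp
  qed
  show "2 * cf_denom \<alpha> k \<le> cf_denom \<alpha> (Suc (Suc k))" using step[of k] 1[of k] by linarith
qed

lemma cf_denom_exponential:
  assumes "\<alpha> \<notin> \<rat>"
  shows "2 ^ (k div 2) \<le> cf_denom \<alpha> k"
proof (induction k rule: less_induct)
  case (less k)
  consider "k = 0" | "k = 1" | j where "k = Suc (Suc j)" by (metis One_nat_def not0_implies_Suc)
  then show ?case
  proof cases
    case 2
    then show ?thesis using cf_denom_pos[OF assms, of 1] by simp
  next
    case 3
    then show ?thesis using less[of j] cf_denom_growth(2)[OF assms, of j] by simp
  qed simp
qed

lemma cf_determinant:
  "cf_numer \<alpha> (Suc k) * cf_denom \<alpha> k - cf_numer \<alpha> k * cf_denom \<alpha> (Suc k) = (-1) ^ k"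
proof (induction k)
  case 0
  then show ?case by (simp add: mult.commute)
next
  case (Suc k)
  have "cf_numer \<alpha> (Suc (Suc k)) * cf_denom \<alpha> (Suc k) - cf_numer \<alpha> (Suc k) * cf_denom \<alpha> (Suc (Suc k))
     = - (cf_numer \<alpha> (Suc k) * cf_denom \<alpha> k - cf_numer \<alpha> k * cf_denom \<alpha> (Suc k))"
    by (simp add: algebra_simps)
  then show ?case using Suc by simp
qed

lemma cf_expansion:
  assumes "\<alpha> \<notin> \<rat>"
  shows "\<alpha> * (complete_quotient \<alpha> (Suc (Suc k)) * of_int (cf_denom \<alpha> (Suc k)) + of_int (cf_denom \<alpha> k))
       = complete_quotient \<alpha> (Suc (Suc k)) * of_int (cf_numer \<alpha> (Suc k)) + of_int (cf_numer \<alpha> k)"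
proof (induction k)
  case 0
  define y z where "y = complete_quotient \<alpha> (Suc 0)" and "z = complete_quotient \<alpha> (Suc (Suc 0))"
  have y: "\<alpha> = of_int (partial_quotient \<alpha> 0) + 1 / y"
    using complete_quotient_step[OF assms, of 0] by (simp add: y_def)
  have z: "y = of_int (partial_quotient \<alpha> 1) + 1 / z"
    using complete_quotient_step[OF assms, of 1] by (simp add: y_def z_def del: complete_quotient.simps)
  have pos: "y > 1" "z > 1" using complete_quotient_frac(3)[OF assms] by (auto simp: y_def z_def simp del: complete_quotient.simps)
  have zy: "z * y = z * of_int (partial_quotient \<alpha> 1) + 1" using pos(2) by (subst z) (simp add: distrib_left)
  have ay: "\<alpha> * y = of_int (partial_quotient \<alpha> 0) * y + 1" using pos(1) by (subst y) (simp add: distrib_right)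
  have "\<alpha> * (z * of_int (cf_denom \<alpha> (Suc 0)) + of_int (cf_denom \<alpha> 0)) = \<alpha> * (z * y)" using zy by simp
  also have "\<dots> = z * (\<alpha> * y)" by simp
  also have "\<dots> = of_int (partial_quotient \<alpha> 0) * (z * y) + z" unfolding ay by (simp add: algebra_simps)
  also have "\<dots> = z * of_int (cf_numer \<alpha> (Suc 0)) + of_int (cf_numer \<alpha> 0)" unfolding zy by (simp add: algebra_simps)
  finally show ?case by (simp add: z_def)
next
  case (Suc k)
  define y z where "y = complete_quotient \<alpha> (Suc (Suc k))" and "z = complete_quotient \<alpha> (Suc (Suc (Suc k)))"
  have z: "y = of_int (partial_quotient \<alpha> (Suc (Suc k))) + 1 / z"
    using complete_quotient_step[OF assms, of "Suc (Suc k)"] by (simp add: y_def z_def del: complete_quotient.simps)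
  have pos: "z > 1" using complete_quotient_frac(3)[OF assms] by (auto simp: z_def simp del: complete_quotient.simps)
  have zy: "z * y = z * of_int (partial_quotient \<alpha> (Suc (Suc k))) + 1" using pos by (subst z) (simp add: distrib_left)
  have IH: "\<alpha> * (y * of_int (cf_denom \<alpha> (Suc k)) + of_int (cf_denom \<alpha> k)) = y * of_int (cf_numer \<alpha> (Suc k)) + of_int (cf_numer \<alpha> k)"
    using Suc by (simp add: y_def)
  have q: "z * of_int (cf_denom \<alpha> (Suc (Suc k))) + of_int (cf_denom \<alpha> (Suc k)) = z * (y * of_int (cf_denom \<alpha> (Suc k)) + of_int (cf_denom \<alpha> k))"
  proof -
    have "z * (y * of_int (cf_denom \<alpha> (Suc k)) + of_int (cf_denom \<alpha> k)) = (z * y) * of_int (cf_denom \<alpha> (Suc k)) + z * of_int (cf_denom \<alpha> k)"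
      by (simp add: algebra_simps)
    then show ?thesis unfolding zy by (simp add: algebra_simps)
  qed
  have p: "z * of_int (cf_numer \<alpha> (Suc (Suc k))) + of_int (cf_numer \<alpha> (Suc k)) = z * (y * of_int (cf_numer \<alpha> (Suc k)) + of_int (cf_numer \<alpha> k))"
  proof -
    have "z * (y * of_int (cf_numer \<alpha> (Suc k)) + of_int (cf_numer \<alpha> k)) = (z * y) * of_int (cf_numer \<alpha> (Suc k)) + z * of_int (cf_numer \<alpha> k)"
      by (simp add: algebra_simps)
    then show ?thesis unfolding zy by (simp add: algebra_simps)
  qed
  have "\<alpha> * (z * of_int (cf_denom \<alpha> (Suc (Suc k))) + of_int (cf_denom \<alpha> (Suc k)))
     = z * (\<alpha> * (y * of_int (cf_denom \<alpha> (Suc k)) + of_int (cf_denom \<alpha> k)))" unfolding q by simp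
  then show ?case unfolding IH p[symmetric] by (simp add: z_def)
qed

lemma cf_approximation:
  assumes "\<alpha> \<notin> \<rat>"
  shows "coprime (cf_numer \<alpha> (Suc k)) (cf_denom \<alpha> (Suc k))"
    "\<bar>of_int (cf_denom \<alpha> (Suc k)) * \<alpha> - of_int (cf_numer \<alpha> (Suc k))\<bar> \<le> 1 / of_int (cf_denom \<alpha> (Suc k))"
proof -
  show "coprime (cf_numer \<alpha> (Suc k)) (cf_denom \<alpha> (Suc k))"
  proof (rule coprimeI)
    fix c assume "c dvd cf_numer \<alpha> (Suc k)" "c dvd cf_denom \<alpha> (Suc k)"
    then have "c dvd (-1) ^ k" unfolding cf_determinant[of \<alpha> k, symmetric] by (intro dvd_diff) auto
    then show "is_unit c" by (metis dvd_trans is_unit_power_iff minus_one_mult_self dvdI dvd_minus_iff one_dvd)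
  qed
  define y where "y = complete_quotient \<alpha> (Suc (Suc k))"
  define D where "D = y * of_int (cf_denom \<alpha> (Suc k)) + of_int (cf_denom \<alpha> k)"
  have y: "y > 1" using complete_quotient_frac(3)[OF assms] by (auto simp: y_def simp del: complete_quotient.simps)
  have q: "real_of_int (cf_denom \<alpha> (Suc k)) \<ge> 1" "real_of_int (cf_denom \<alpha> k) \<ge> 1"
    using cf_denom_pos[OF assms] by simp_all
  have D: "D \<ge> of_int (cf_denom \<alpha> (Suc k))"
  proof -
    have "1 * real_of_int (cf_denom \<alpha> (Suc k)) \<le> y * of_int (cf_denom \<alpha> (Suc k))"
      using y q by (intro mult_right_mono) auto
    then show ?thesis using q(2) unfolding D_def by linarith
  qed
  have "(of_int (cf_denom \<alpha> (Suc k)) * \<alpha> - of_int (cf_numer \<alpha> (Suc k))) * D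
     = of_int (cf_denom \<alpha> (Suc k)) * (\<alpha> * D) - of_int (cf_numer \<alpha> (Suc k)) * D" by (simp add: algebra_simps)
  also have "\<alpha> * D = y * of_int (cf_numer \<alpha> (Suc k)) + of_int (cf_numer \<alpha> k)"
    using cf_expansion[OF assms, of k] by (simp add: D_def y_def)
  also have "of_int (cf_denom \<alpha> (Suc k)) * (y * of_int (cf_numer \<alpha> (Suc k)) + of_int (cf_numer \<alpha> k)) - of_int (cf_numer \<alpha> (Suc k)) * D
    = - of_int (cf_numer \<alpha> (Suc k) * cf_denom \<alpha> k - cf_numer \<alpha> k * cf_denom \<alpha> (Suc k))"
    by (simp add: D_def algebra_simps)
  finally have "\<bar>(of_int (cf_denom \<alpha> (Suc k)) * \<alpha> - of_int (cf_numer \<alpha> (Suc k))) * D\<bar> = 1"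
    unfolding cf_determinant by (simp add: power_abs)
  then have "\<bar>of_int (cf_denom \<alpha> (Suc k)) * \<alpha> - of_int (cf_numer \<alpha> (Suc k))\<bar> = 1 / D"
    unfolding abs_mult using D q by (simp add: eq_divide_eq)
  also have "\<dots> \<le> 1 / of_int (cf_denom \<alpha> (Suc k))" using D q by (intro divide_left_mono) auto
  finally show "\<bar>of_int (cf_denom \<alpha> (Suc k)) * \<alpha> - of_int (cf_numer \<alpha> (Suc k))\<bar> \<le> 1 / of_int (cf_denom \<alpha> (Suc k))" .
qed

lemma dist_int_le: "dist_int x \<le> \<bar>x - of_int p\<bar>"
  unfolding dist_int_def using infdist_le[of "of_int p" \<int> x] by (simp add: dist_real_def)

text \<open>
  As \<open>n\<close> runs through \<open>q\<close> consecutive integers, \<open>np\<close> runs through all residues modulo \<open>q\<close>, so \<open>np/q\<close> comes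
  within \<open>1/q\<close> of \<open>\<gamma>\<close> modulo \<open>1\<close>. Replacing \<open>p/q\<close> by \<open>\<alpha>\<close> costs at most \<open>n / q\<^sup>2\<close>.
\<close>

lemma inhomogeneous_approximation:
  fixes p q :: int
  assumes q: "q > 0" and cop: "coprime p q" and ap: "\<bar>of_int q * \<alpha> - of_int p\<bar> \<le> 1 / of_int q"
  obtains n :: nat where "of_int q \<le> real n" "real n < 2 * of_int q" "dist_int (real n * \<alpha> - \<gamma>) \<le> 6 / real n"
proof -
  define t where "t = \<lfloor>of_int q * \<gamma>\<rfloor>"
  obtain s u where su: "s * p + u * q = 1" using cop
    by (metis bezout_int coprime_iff_gcd_eq_1)
  define n0 where "n0 = (t * s) mod q"
  define n where "n = nat (q + n0)"
  have n0: "0 \<le> n0" "n0 < q" using q by (simp_all add: n0_def)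
  then have n: "int n = q + n0" using q by (simp add: n_def)
  define c where "c = p - p * ((t * s) div q) - t * u"
  have c: "int n * p = t + q * c"
  proof -
    define d where "d = (t * s) div q"
    have n0d: "n0 = t * s - q * d" unfolding n0_def d_def by (simp add: minus_mult_div_eq_mod)
    have "int n * p = q * p - q * d * p + t * (s * p)" unfolding n n0d by (simp add: algebra_simps)
    also have "s * p = 1 - u * q" using su by simp
    finally show ?thesis unfolding c_def d_def[symmetric] by (simp add: algebra_simps)
  qed
  have qr: "real_of_int q > 0" using q by simp
  have nr: "real n = of_int q + of_int n0" using n by (metis of_int_add of_int_of_nat_eq)
  have nq: "of_int q \<le> real n" "real n < 2 * of_int q" using n0 unfolding nr by simp_all
  have "real n * \<alpha> - \<gamma> - of_int c = real n * (of_int q * \<alpha> - of_int p) / of_int q + (of_int t - of_int q * \<gamma>) / of_int q"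
  proof -
    have "real n * of_int p = of_int t + of_int q * of_int c" using c by (metis of_int_add of_int_mult of_int_of_nat_eq)
    then show ?thesis using qr by (simp add: field_simps)
  qed
  note split = this
  have "\<bar>real n * \<alpha> - \<gamma> - of_int c\<bar> \<le> real n * \<bar>of_int q * \<alpha> - of_int p\<bar> / of_int q + \<bar>of_int t - of_int q * \<gamma>\<bar> / of_int q"
    unfolding split by (rule order_trans[OF abs_triangle_ineq]) (use qr in \<open>simp add: abs_mult abs_divide\<close>)
  also have "\<dots> \<le> 2 * of_int q * (1 / of_int q) / of_int q + 1 / of_int q"
    using nq ap qr unfolding t_def by (intro add_mono divide_right_mono mult_mono) linarith+
  also have "\<dots> = 3 / of_int q" using qr by (simp add: field_simps)
  also have "\<dots> = 6 / (2 * of_int q)" by simp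
  also have "\<dots> \<le> 6 / real n" using nq qr by (intro divide_left_mono) auto
  finally have "\<bar>real n * \<alpha> - \<gamma> - of_int c\<bar> \<le> 6 / real n" .
  then have "dist_int (real n * \<alpha> - \<gamma>) \<le> 6 / real n" using dist_int_le order_trans by blast
  then show thesis using that nq by blast
qed

text \<open>
  Take the first convergent denominator that is at least \<open>exp X\<close>. Its predecessor is smaller than \<open>exp X\<close>,
  so its index is at most a multiple of \<open>X\<close>, because denominators grow at least exponentially. The
  definition of \<open>K_set\<close> turns this into an upper bound for its logarithm.
\<close>

lemma good_approximations_at_every_scale:
  assumes "\<alpha> \<in> K_set"
  obtains C where "C \<ge> 1" "\<And>X. X \<ge> 1 \<Longrightarrow> \<exists>n::nat. X \<le> ln (real n) \<and> ln (real n) \<le> C * X \<and> dist_int (real n * \<alpha> - \<gamma>) \<le> 6 / real n"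
proof -
  have irr: "\<alpha> \<notin> \<rat>" using assms by (simp add: K_set_def)
  obtain C0 where C0: "\<And>k. k \<ge> 1 \<Longrightarrow> ln (real_of_int (cf_denom \<alpha> k)) / real k \<le> C0"
    using assms unfolding K_set_def bdd_above_def by auto
  define C1 where "C1 = max 1 C0"
  have growth: "ln (real_of_int (cf_denom \<alpha> k)) \<le> C1 * real k" if "k \<ge> 1" for k
    using C0[OF that] that by (simp add: C1_def divide_le_eq) (meson max.cobounded2 mult_right_mono of_nat_0_le_iff order_trans)
  have C1: "C1 \<ge> 1" by (simp add: C1_def)
  show thesis
  proof (rule that[of "7 * C1"])
    show "7 * C1 \<ge> 1" using C1 by linarith
    fix X :: real assume X: "X \<ge> 1"
    obtain J where J: "exp X < 2 ^ J" using real_arch_pow[of 2 "exp X"] by auto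
    have "exp X \<le> of_int (cf_denom \<alpha> (2 * J))"
    proof -
      have "(2::int) ^ J \<le> cf_denom \<alpha> (2 * J)" using cf_denom_exponential[OF irr, of "2 * J"] by simp
      then have "(2::real) ^ J \<le> of_int (cf_denom \<alpha> (2 * J))" by (metis of_int_le_iff of_int_numeral of_int_power)
      then show ?thesis using J by linarith
    qed
    then have ex: "\<exists>j. exp X \<le> of_int (cf_denom \<alpha> j)" by blast
    define j where "j = (LEAST j. exp X \<le> of_int (cf_denom \<alpha> j))"
    have j: "exp X \<le> of_int (cf_denom \<alpha> j)" unfolding j_def using ex by (rule LeastI_ex)
    have "j \<noteq> 0"
    proof
      assume "j = 0"
      then have "exp X \<le> 1" using j by simp
      then show False using X by (simp add: exp_le_one_iff)
    qed
    then obtain i where i: "j = Suc i" using not0_implies_Suc by blast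
    have "of_int (cf_denom \<alpha> i) < exp X" using not_less_Least[of i "\<lambda>j. exp X \<le> of_int (cf_denom \<alpha> j)"] i
      by (simp add: j_def[symmetric])
    moreover have "(2::real) ^ (i div 2) \<le> of_int (cf_denom \<alpha> i)"
      using cf_denom_exponential[OF irr, of i] by (metis of_int_le_iff of_int_numeral of_int_power)
    ultimately have "2 ^ (i div 2) < exp X" by linarith
    then have "ln (2 ^ (i div 2)) < X" by (metis ln_exp ln_less_cancel_iff exp_gt_zero zero_less_numeral zero_less_power)
    then have "real (i div 2) * ln 2 < X" by (simp add: ln_realpow)
    moreover have "real (i div 2) * (1 / 2) \<le> real (i div 2) * ln 2" using ln2_ge_two_thirds by (intro mult_left_mono) auto
    ultimately have "real (i div 2) < 2 * X" by linarith
    moreover have "real i \<le> 2 * real (i div 2) + 1" by linarith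
    ultimately have jX: "real j \<le> 6 * X" using X i by simp
    obtain n where n: "of_int (cf_denom \<alpha> j) \<le> real n" "real n < 2 * of_int (cf_denom \<alpha> j)" "dist_int (real n * \<alpha> - \<gamma>) \<le> 6 / real n"
      using inhomogeneous_approximation[of "cf_denom \<alpha> j" "cf_numer \<alpha> j" \<alpha> \<gamma>] cf_approximation[OF irr, of i] cf_denom_pos[OF irr, of j]
      unfolding i by (metis int_one_le_iff_zero_less)
    have q0: "real_of_int (cf_denom \<alpha> j) > 0" using cf_denom_pos[OF irr, of j] by simp
    have "exp X \<le> real n" using j n by linarith
    then have "X \<le> ln (real n)" by (metis exp_gt_zero ln_exp ln_le_cancel_iff less_le_trans)
    moreover have "ln (real n) \<le> 7 * C1 * X"
    proof -
      have "ln (real n) \<le> ln (2 * of_int (cf_denom \<alpha> j))" using n q0 by (intro ln_mono) linarith+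
      also have "\<dots> = ln 2 + ln (of_int (cf_denom \<alpha> j))" using q0 by (simp add: ln_mult)
      also have "\<dots> \<le> 1 + C1 * (6 * X)"
      proof (rule add_mono)
        show "ln 2 \<le> (1::real)" using ln_2_less_1 by linarith
        have "ln (of_int (cf_denom \<alpha> j)) \<le> C1 * real j" by (rule growth) (simp add: i)
        also have "\<dots> \<le> C1 * (6 * X)" using jX C1 by (intro mult_left_mono) auto
        finally show "ln (of_int (cf_denom \<alpha> j)) \<le> C1 * (6 * X)" .
      qed
      also have "1 \<le> C1 * X" using mult_mono[of 1 C1 1 X] C1 X by simp
      finally show ?thesis by (simp add: algebra_simps)
    qed
    ultimately show "\<exists>n::nat. X \<le> ln (real n) \<and> ln (real n) \<le> 7 * C1 * X \<and> dist_int (real n * \<alpha> - \<gamma>) \<le> 6 / real n"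
      using n(3) by blast
  qed
qed

section \<open>The schedule of special levels\<close>

lemma linear_le_exponential:
  fixes W :: real
  obtains i0 :: nat where "i0 \<ge> 1" "\<And>i. i \<ge> i0 \<Longrightarrow> W * (real i + 1) \<le> 2 ^ i"
proof -
  define V where "V = max 1 W"
  have V: "V \<ge> 1" "W \<le> V" by (auto simp: V_def)
  have "((\<lambda>i. real i / 2 ^ i) \<longlongrightarrow> 0) sequentially" by (rule lim_n_over_pown) auto
  then have "\<forall>\<^sub>F i in sequentially. real i / 2 ^ i < 1 / (2 * V)" by (rule order_tendstoD) (use V in auto)
  then obtain j where j: "\<And>i. i \<ge> j \<Longrightarrow> real i / 2 ^ i < 1 / (2 * V)" unfolding eventually_sequentially by auto
  show thesis
  proof (rule that[of "max 1 j"])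
    fix i assume i: "max 1 j \<le> i"
    then have "2 * V * real i < 2 ^ i" using j[of i] V by (simp add: field_simps)
    moreover have "W * (real i + 1) \<le> V * (2 * real i)" using V i by (intro mult_mono) auto
    ultimately show "W * (real i + 1) \<le> 2 ^ i" by simp
  qed simp
qed

text \<open>
  The logarithm of \<open>n t\<close> is of order \<open>B\<close> to the power \<open>t\<close>. The window of special levels that belongs to \<open>n t\<close>
  starts at level \<open>k t\<close> and consists of \<open>5 (K t)\<close> levels. As \<open>k\<close> grows exponentially while \<open>K\<close> grows linearly,
  each window is shorter than \<open>\<epsilon>\<close> times its distance from the start of the previous one. Nevertheless
  the powers of \<open>R\<close> with exponent \<open>K t\<close> dominate any fixed power of \<open>ln (n t)\<close>.
\<close>

lemma approximation_schedule:
  fixes R K0 :: nat and \<epsilon> :: real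
  assumes \<alpha>: "\<alpha> \<in> K_set" and R: "R \<ge> 10" and eps: "0 < \<epsilon>" "\<epsilon> \<le> 1"
  obtains n K k M :: "nat \<Rightarrow> nat" and c :: real where
    "strict_mono n" "\<And>t. n t \<ge> 2" "\<And>t. dist_int (real (n t) * \<alpha> - \<gamma>) \<le> 6 / real (n t)"
    "\<And>t. real R ^ (8 * K t + 2 * k t) \<le> real (n t)" "\<And>t. real (n t) \<le> real R ^ (8 * K t + 2 * k t + 2)"
    "\<And>t. 2 / (1 / (18 * ln (real (n t))))\<^sup>2 < real (M t)" "\<And>t. real (M t) ^ 4 \<le> real R ^ K t"
    "\<And>t. K0 \<le> K t" "\<And>t. 2 \<le> K t" "\<And>t. K t < K (Suc t)"
    "5 * real (K 0) \<le> \<epsilon> * real (k 0)" "\<And>t. 5 * real (K (Suc t)) \<le> \<epsilon> * (real (k (Suc t)) - real (k t))"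
    "c > 0" "\<forall>\<^sub>F N in sequentially. c * ln (ln (real N)) \<le> real (card {t. n t \<le> N})"
proof -
  obtain C where C: "C \<ge> 1"
    "\<And>X. X \<ge> 1 \<Longrightarrow> \<exists>n::nat. X \<le> ln (real n) \<and> ln (real n) \<le> C * X \<and> dist_int (real n * \<alpha> - \<gamma>) \<le> 6 / real n"
    using good_approximations_at_every_scale[OF \<alpha>, of \<gamma>] by metis
  define B where "B = nat \<lceil>2 * C\<rceil>"
  have B1: "real B \<ge> 2 * C" unfolding B_def by (rule real_nat_ceiling_ge)
  then have "real B \<ge> 2" using C(1) by linarith
  then have B: "real B \<ge> 2 * C" "B \<ge> 2" using B1 by simp_all
  define L where "L = 9 * B"
  have lnR: "ln (real R) > 0" using R by simp
  define W where "W = 4 * ln (real R) * (4 * real L + 1 + 5 * real L / \<epsilon>) + (650 * C\<^sup>2) ^ 4"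
  obtain i1 where i1: "i1 \<ge> 1" "\<And>i. i \<ge> i1 \<Longrightarrow> W * (real i + 1) \<le> 2 ^ i" using linear_le_exponential by blast
  define i0 where "i0 = max i1 (max K0 2)"
  have BW: "W * (real i + 1) \<le> real B ^ i" if "i \<ge> i0" for i
  proof -
    have "(2::real) ^ i \<le> real B ^ i" using B by (intro power_mono) auto
    moreover have "i1 \<le> i" using that by (simp add: i0_def)
    ultimately show ?thesis using i1(2)[of i] by linarith
  qed
  have Wp: "4 * ln (real R) * (4 * real L + 1 + 5 * real L / \<epsilon>) \<le> W" "(650 * C\<^sup>2) ^ 4 \<le> W" "W \<ge> 0"
    using lnR eps C by (simp_all add: W_def)
  have "\<exists>n::nat. real B ^ i \<le> ln (real n) \<and> ln (real n) \<le> C * real B ^ i \<and> dist_int (real n * \<alpha> - \<gamma>) \<le> 6 / real n" for i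
    using B by (intro C(2) one_le_power) simp
  then obtain n' where n': "\<And>i. real B ^ i \<le> ln (real (n' i))" "\<And>i. ln (real (n' i)) \<le> C * real B ^ i"
    "\<And>i. dist_int (real (n' i) * \<alpha> - \<gamma>) \<le> 6 / real (n' i)" by metis
  have Bi: "1 \<le> real B ^ i" for i using B by (intro one_le_power) simp
  have n'0: "real (n' i) > 0" for i
  proof (rule ccontr)
    assume "\<not> ?thesis"
    then have "ln (real (n' i)) = 0" by simp
    then show False using n'(1)[of i] Bi[of i] by linarith
  qed
  define k' where "k' i = nat \<lfloor>(ln (real (n' i)) / ln (real R) - 8 * real (L * i)) / 2\<rfloor>" for i
  define M' where "M' i = nat \<lceil>648 * (C * real B ^ i)\<^sup>2\<rceil> + 1" for i
  have main: "real B ^ i \<ge> 16 * real (L * i) * ln (real R)"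
    "real B ^ i / (4 * ln (real R)) \<ge> 4 * real (L * i) + 1 + 5 * real (L * i) / \<epsilon>"
    "(650 * C\<^sup>2) ^ 4 \<le> real B ^ i"
    if i: "i \<ge> i0" for i
  proof -
    have "4 * ln (real R) * (4 * real L + 1 + 5 * real L / \<epsilon>) * (real i + 1) \<le> W * (real i + 1)"
      using Wp by (intro mult_right_mono) auto
    moreover have "4 * ln (real R) * (4 * real (L * i) + 1 + 5 * real (L * i) / \<epsilon>) \<le> 4 * ln (real R) * (4 * real L + 1 + 5 * real L / \<epsilon>) * (real i + 1)"
    proof -
      have "4 * real (L * i) + 1 + 5 * real (L * i) / \<epsilon> \<le> (4 * real L + 1 + 5 * real L / \<epsilon>) * (real i + 1)"
      proof -
        have "(4 * real L + 1 + 5 * real L / \<epsilon>) * (real i + 1)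
          = (4 * real (L * i) + 1 + 5 * real (L * i) / \<epsilon>) + (4 * real L + real i + 5 * real L / \<epsilon>)"
          by (simp add: algebra_simps add_divide_distrib)
        moreover have "0 \<le> 4 * real L + real i + 5 * real L / \<epsilon>" using eps by simp
        ultimately show ?thesis by linarith
      qed
      then have "4 * ln (real R) * (4 * real (L * i) + 1 + 5 * real (L * i) / \<epsilon>) \<le> 4 * ln (real R) * ((4 * real L + 1 + 5 * real L / \<epsilon>) * (real i + 1))"
        using lnR by (intro mult_left_mono) auto
      then show ?thesis by (simp only: mult.assoc)
    qed
    ultimately have 1: "4 * ln (real R) * (4 * real (L * i) + 1 + 5 * real (L * i) / \<epsilon>) \<le> real B ^ i"
      using BW[OF i] by linarith
    then show 2: "real B ^ i / (4 * ln (real R)) \<ge> 4 * real (L * i) + 1 + 5 * real (L * i) / \<epsilon>"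
      using lnR by (simp add: pos_le_divide_eq mult.commute)
    have "0 \<le> 5 * real (L * i) / \<epsilon>" using eps by simp
    then have "4 * real (L * i) \<le> real B ^ i / (4 * ln (real R))" using 2 by linarith
    then show "real B ^ i \<ge> 16 * real (L * i) * ln (real R)" using lnR by (simp add: pos_le_divide_eq mult_ac)
    have "(650 * C\<^sup>2) ^ 4 * 1 \<le> W * (real i + 1)" using Wp by (intro mult_mono) auto
    then show "(650 * C\<^sup>2) ^ 4 \<le> real B ^ i" using BW[OF i] by linarith
  qed
  have k'0: "(ln (real (n' i)) / ln (real R) - 8 * real (L * i)) / 2 \<ge> 0" if i: "i \<ge> i0" for i
  proof -
    have "8 * real (L * i) * ln (real R) \<le> 16 * real (L * i) * ln (real R)" using lnR by (intro mult_right_mono) auto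
    then have "8 * real (L * i) * ln (real R) \<le> ln (real (n' i))" using main(1)[OF i] n'(1)[of i] by linarith
    then show ?thesis using lnR by (simp add: pos_le_divide_eq)
  qed
  have k': "2 * real (k' i) \<le> ln (real (n' i)) / ln (real R) - 8 * real (L * i)"
    "ln (real (n' i)) / ln (real R) - 8 * real (L * i) < 2 * real (k' i) + 2" if i: "i \<ge> i0" for i
  proof -
    define Y where "Y = ln (real (n' i)) / ln (real R) - 8 * real (L * i)"
    have "real (k' i) = of_int \<lfloor>Y / 2\<rfloor>" using k'0[OF i] by (simp add: k'_def Y_def)
    moreover have "of_int \<lfloor>Y / 2\<rfloor> \<le> Y / 2" "Y / 2 < of_int \<lfloor>Y / 2\<rfloor> + 1" by linarith+
    ultimately have "2 * real (k' i) \<le> Y" "Y < 2 * real (k' i) + 2" by linarith+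
    then show "2 * real (k' i) \<le> ln (real (n' i)) / ln (real R) - 8 * real (L * i)"
      "ln (real (n' i)) / ln (real R) - 8 * real (L * i) < 2 * real (k' i) + 2" by (simp_all only: Y_def)
  qed
  have lnpow: "real R ^ j = exp (real j * ln (real R))" for j
    using R by (simp add: exp_of_nat_mult)
  have nlow: "real R ^ (8 * (L * i) + 2 * k' i) \<le> real (n' i)" if i: "i \<ge> i0" for i
  proof -
    have "real (8 * (L * i) + 2 * k' i) \<le> ln (real (n' i)) / ln (real R)" using k'(1)[OF i] by simp
    then have "real (8 * (L * i) + 2 * k' i) * ln (real R) \<le> ln (real (n' i))" using lnR by (simp only: pos_le_divide_eq)
    then have "exp (real (8 * (L * i) + 2 * k' i) * ln (real R)) \<le> exp (ln (real (n' i)))" by (simp only: exp_le_cancel_iff)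
    then show ?thesis using n'0[of i] by (simp only: lnpow exp_ln)
  qed
  have nup: "real (n' i) \<le> real R ^ (8 * (L * i) + 2 * k' i + 2)" if i: "i \<ge> i0" for i
  proof -
    have "ln (real (n' i)) / ln (real R) \<le> real (8 * (L * i) + 2 * k' i + 2)" using k'(2)[OF i] by simp
    then have "ln (real (n' i)) \<le> real (8 * (L * i) + 2 * k' i + 2) * ln (real R)" using lnR by (simp only: pos_divide_le_eq)
    then have "exp (ln (real (n' i))) \<le> exp (real (8 * (L * i) + 2 * k' i + 2) * ln (real R))" by (simp only: exp_le_cancel_iff)
    then show ?thesis using n'0[of i] by (simp only: lnpow exp_ln)
  qed
  have kgap: "5 * real (L * i) \<le> \<epsilon> * (real (k' i) - z)" if i: "i \<ge> i0" and z: "z \<le> real B ^ i / (4 * ln (real R))" for i z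
  proof -
    have "real B ^ i / ln (real R) \<le> ln (real (n' i)) / ln (real R)" using n'(1) lnR by (intro divide_right_mono) auto
    then have "real B ^ i / ln (real R) - 8 * real (L * i) < 2 * real (k' i) + 2" using k'(2)[OF i] by linarith
    moreover have "real B ^ i / ln (real R) = 4 * (real B ^ i / (4 * ln (real R)))" by simp
    ultimately have "5 * real (L * i) / \<epsilon> \<le> real (k' i) - z" using main(2)[OF i] z by linarith
    then show ?thesis using eps by (simp add: pos_divide_le_eq mult.commute)
  qed
  have kprev: "real (k' i) \<le> real B ^ Suc i / (4 * ln (real R))" if i: "i \<ge> i0" for i
  proof -
    have "2 * real (k' i) \<le> ln (real (n' i)) / ln (real R)"
      using k'(1)[OF i] of_nat_0_le_iff[of "L * i", where 'a = real] by linarith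
    also have "\<dots> \<le> (C * real B ^ i) / ln (real R)" using n'(2) lnR by (intro divide_right_mono) auto
    also have "\<dots> \<le> (real B / 2 * real B ^ i) / ln (real R)" using B lnR by (intro divide_right_mono mult_right_mono) auto
    finally show ?thesis by simp
  qed
  have ninc: "n' i < n' (Suc i)" for i
  proof -
    have "ln (real (n' i)) \<le> C * real B ^ i" by (rule n'(2))
    also have "\<dots> < real B * real B ^ i" using B C by (intro mult_strict_right_mono) auto
    also have "\<dots> \<le> ln (real (n' (Suc i)))" using n'(1)[of "Suc i"] by simp
    finally have "real (n' i) < real (n' (Suc i))" using n'0 by (simp add: ln_less_cancel_iff)
    then show ?thesis by simp
  qed
  have lnn1: "ln (real (n' i)) \<ge> 1" for i using n'(1)[of i] Bi[of i] by linarith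
  have n2: "n' i \<ge> 2" for i
  proof (rule ccontr)
    assume "\<not> ?thesis"
    then have "real (n' i) \<le> 1" by simp
    then have "ln (real (n' i)) \<le> 0" using n'0[of i] by simp
    then show False using lnn1[of i] by linarith
  qed
  have M1: "2 / (1 / (18 * ln (real (n' i))))\<^sup>2 < real (M' i)" for i
  proof -
    have "2 / (1 / (18 * ln (real (n' i))))\<^sup>2 = 648 * (ln (real (n' i)))\<^sup>2" by (simp add: power_divide power_mult_distrib)
    also have "\<dots> \<le> 648 * (C * real B ^ i)\<^sup>2" using n'(2)[of i] lnn1[of i] by (intro mult_left_mono power_mono) auto
    also have "\<dots> < real (M' i)" unfolding M'_def by linarith
    finally show ?thesis .
  qed
  have M2: "real (M' i) ^ 4 \<le> real R ^ (L * i)" if i: "i \<ge> i0" for i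
  proof -
    have CB: "1 \<le> (C * real B ^ i)\<^sup>2"
    proof -
      have "1 * 1 \<le> C * real B ^ i" using C B by (intro mult_mono one_le_power) auto
      then show ?thesis by (intro one_le_power) simp
    qed
    have "real (M' i) \<le> 648 * (C * real B ^ i)\<^sup>2 + 2" unfolding M'_def by (simp add: of_nat_ceiling) linarith?
    also have "\<dots> \<le> 650 * (C * real B ^ i)\<^sup>2" using CB by linarith
    finally have "real (M' i) ^ 4 \<le> (650 * (C * real B ^ i)\<^sup>2) ^ 4" by (intro power_mono) auto
    also have "\<dots> = (650 * C\<^sup>2) ^ 4 * (real B ^ i) ^ 8" by (simp add: power_mult_distrib mult.commute flip: power_mult)
    also have "\<dots> \<le> real B ^ i * (real B ^ i) ^ 8" using main(3)[OF i] by (intro mult_right_mono) auto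
    also have "\<dots> = (real B ^ 9) ^ i" by (simp add: power_mult[symmetric] mult.commute flip: power_add)
    also have "\<dots> \<le> (real R ^ L) ^ i"
    proof (rule power_mono)
      have "real B \<le> 2 ^ B" using of_nat_less_two_power[of B, where 'a = real] by simp
      also have "(2::real) ^ B \<le> real R ^ B" using R by (intro power_mono) auto
      finally have "real B ^ 9 \<le> (real R ^ B) ^ 9" by (intro power_mono) auto
      then show "real B ^ 9 \<le> real R ^ L" by (simp add: L_def mult.commute flip: power_mult)
    qed simp
    finally show ?thesis by (simp add: power_mult)
  qed
  define n K k M where "n t = n' (i0 + t)" and "K t = L * (i0 + t)" and "k t = k' (i0 + t)" and "M t = M' (i0 + t)" for t
  have L: "L \<ge> 1" using B by (simp add: L_def)
  have Kge: "K t \<ge> i0" for t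
  proof -
    have "1 * i0 \<le> L * (i0 + t)" using L by (intro mult_le_mono) auto
    then show ?thesis by (simp add: K_def)
  qed
  define c where "c = 1 / (2 * ln (real B))"
  have lnB: "ln (real B) > 0" using B by simp
  have count: "\<forall>\<^sub>F N in sequentially. c * ln (ln (real N)) \<le> real (card {t. n t \<le> N})"
  proof -
    have "filterlim (\<lambda>N. ln (ln (real N))) at_top sequentially"
      by (intro filterlim_compose[OF ln_at_top] filterlim_compose[OF ln_at_top filterlim_real_sequentially])
    then have "\<forall>\<^sub>F N in sequentially. ln (ln (real N)) \<ge> 2 * (ln C + real i0 * ln (real B))"
      unfolding filterlim_at_top by blast
    moreover have "\<forall>\<^sub>F N in sequentially. N \<ge> (3::nat)" by (rule eventually_ge_at_top)
    ultimately show ?thesis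
    proof eventually_elim
      case (elim N)
      define y where "y = (ln (ln (real N)) - ln C - real i0 * ln (real B)) / ln (real B)"
      have lnN: "ln (real N) > 0" using elim by simp
      have sub: "{t. real t \<le> y} \<subseteq> {t. n t \<le> N}"
      proof
        fix t assume "t \<in> {t. real t \<le> y}"
        then have "real t * ln (real B) \<le> ln (ln (real N)) - ln C - real i0 * ln (real B)"
          using lnB by (simp add: y_def pos_le_divide_eq)
        then have "ln C + real (i0 + t) * ln (real B) \<le> ln (ln (real N))" by (simp add: algebra_simps)
        moreover have "ln (C * real B ^ (i0 + t)) = ln C + real (i0 + t) * ln (real B)"
          using C B by (subst ln_mult) (auto simp: ln_realpow)
        ultimately have "ln (C * real B ^ (i0 + t)) \<le> ln (ln (real N))" by simp
        moreover have "C * real B ^ (i0 + t) > 0" using C B by simp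
        ultimately have "C * real B ^ (i0 + t) \<le> ln (real N)" using lnN by (simp add: ln_le_cancel_iff)
        then have "ln (real (n t)) \<le> ln (real N)" using n'(2)[of "i0 + t"] by (simp add: n_def)
        then have "real (n t) \<le> real N" using n'0[of "i0 + t"] elim by (simp add: n_def)
        then show "t \<in> {t. n t \<le> N}" by simp
      qed
      have inj: "strict_mono n" unfolding strict_mono_Suc_iff n_def using ninc by simp
      have fin: "finite {t. n t \<le> N}"
      proof (rule finite_subset)
        show "{t. n t \<le> N} \<subseteq> {..N}" using strict_mono_imp_increasing[OF inj] by (auto intro: order_trans)
      qed simp
      have "y \<le> real (card {t. real t \<le> y})"
      proof (cases "y \<ge> 0")
        case True
        then have "{..nat \<lfloor>y\<rfloor>} \<subseteq> {t. real t \<le> y}" by (auto simp: le_nat_iff le_floor_iff)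
        then have "card {..nat \<lfloor>y\<rfloor>} \<le> card {t. real t \<le> y}" using finite_subset[OF sub fin] by (intro card_mono)
        then have "real (nat \<lfloor>y\<rfloor>) + 1 \<le> real (card {t. real t \<le> y})" by simp
        then show ?thesis using True by linarith
      qed auto
      also have "\<dots> \<le> real (card {t. n t \<le> N})" using card_mono[OF fin sub] by simp
      finally have yc: "y \<le> real (card {t. n t \<le> N})" .
      have half: "x / 2 \<le> x - a - b" if "2 * (a + b) \<le> x" for a b x :: real
        using that by (simp add: field_simps)
      have "ln (ln (real N)) / 2 \<le> ln (ln (real N)) - ln C - real i0 * ln (real B)" by (rule half[OF elim(1)])
      then have "(ln (ln (real N)) / 2) / ln (real B) \<le> y" unfolding y_def using lnB by (intro divide_right_mono) auto
      then show ?case using yc by (simp add: c_def mult.commute)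
    qed
  qed
  show thesis
  proof (rule that[of n K k M c])
    show "strict_mono n" unfolding strict_mono_Suc_iff n_def using ninc by simp
    show "n t \<ge> 2" for t by (simp add: n_def n2)
    show "dist_int (real (n t) * \<alpha> - \<gamma>) \<le> 6 / real (n t)" for t unfolding n_def by (rule n')
    show "real R ^ (8 * K t + 2 * k t) \<le> real (n t)" "real (n t) \<le> real R ^ (8 * K t + 2 * k t + 2)" for t
      unfolding n_def K_def k_def by (rule nlow nup; simp)+
    show "2 / (1 / (18 * ln (real (n t))))\<^sup>2 < real (M t)" for t unfolding n_def M_def by (rule M1)
    show "real (M t) ^ 4 \<le> real R ^ K t" for t unfolding M_def K_def by (rule M2) simp
    show "K0 \<le> K t" "2 \<le> K t" for t using Kge[of t] by (simp_all add: i0_def)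
    show "K t < K (Suc t)" for t using L by (simp add: K_def)
    show "5 * real (K 0) \<le> \<epsilon> * real (k 0)" using kgap[of i0 0] lnR by (simp add: K_def k_def)
    show "5 * real (K (Suc t)) \<le> \<epsilon> * (real (k (Suc t)) - real (k t))" for t
      using kgap[of "i0 + Suc t" "real (k' (i0 + t))"] kprev[of "i0 + t"] unfolding K_def k_def by simp
    show "c > 0" using lnB by (simp add: c_def)
  qed (rule count)
qed

text \<open>
  Each window is charged to the levels between the start of the previous window and its own start.
\<close>

lemma special_level_count:
  fixes k D :: "nat \<Rightarrow> nat" and \<epsilon> :: real
  assumes eps: "0 \<le> \<epsilon>" and first: "real (D 0) \<le> \<epsilon> * real (k 0)"
    and incr: "\<And>t. real (D (Suc t)) \<le> \<epsilon> * (real (k (Suc t)) - real (k t))"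
    and mono: "strict_mono k"
  shows "real (card {l. l < h \<and> (\<exists>t. k t \<le> l \<and> l < k t + D t)}) \<le> \<epsilon> * real h"
proof -
  have sum: "(\<Sum>t\<le>T. real (D t)) \<le> \<epsilon> * real (k T)" for T
  proof (induction T)
    case (Suc T)
    then show ?case using incr[of T] by (simp add: algebra_simps)
  qed (use first in simp)
  define A where "A = {t. k t < h}"
  have "A \<subseteq> {..<h}" using strict_mono_imp_increasing[OF mono] by (auto simp: A_def intro: le_less_trans)
  then have fin: "finite A" by (rule finite_subset) simp
  show ?thesis
  proof (cases "A = {}")
    case True
    then have "{l. l < h \<and> (\<exists>t. k t \<le> l \<and> l < k t + D t)} = {}"
      by (fastforce simp: A_def dest: le_less_trans)
    then show ?thesis using eps by (simp only: card.empty) simp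
  next
    case False
    define T where "T = Max A"
    have T: "T \<in> A" "\<And>t. t \<in> A \<Longrightarrow> t \<le> T" using False fin by (auto simp: T_def)
    have "{l. l < h \<and> (\<exists>t. k t \<le> l \<and> l < k t + D t)} \<subseteq> (\<Union>t\<in>{..T}. {k t..<k t + D t})"
    proof
      fix l assume "l \<in> {l. l < h \<and> (\<exists>t. k t \<le> l \<and> l < k t + D t)}"
      then obtain t where t: "l < h" "k t \<le> l" "l < k t + D t" by auto
      then have "t \<le> T" by (intro T(2)) (simp add: A_def)
      then show "l \<in> (\<Union>t\<in>{..T}. {k t..<k t + D t})" using t by auto
    qed
    then have "card {l. l < h \<and> (\<exists>t. k t \<le> l \<and> l < k t + D t)} \<le> card (\<Union>t\<in>{..T}. {k t..<k t + D t})"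
      by (intro card_mono) auto
    also have "\<dots> \<le> (\<Sum>t\<in>{..T}. card {k t..<k t + D t})" by (intro card_UN_le) auto
    finally have "real (card {l. l < h \<and> (\<exists>t. k t \<le> l \<and> l < k t + D t)}) \<le> (\<Sum>t\<le>T. real (D t))"
      by (simp flip: of_nat_sum)
    also have "\<dots> \<le> \<epsilon> * real (k T)" by (rule sum)
    also have "\<dots> \<le> \<epsilon> * real h" using T(1) eps by (intro mult_left_mono) (auto simp: A_def)
    finally show ?thesis .
  qed
qed

section \<open>Construction of the tree\<close>

text \<open>
  For two denominators \<open>q\<close> and \<open>q0\<close> in the given range, bad approximability applied to \<open>q - q0\<close> keeps \<open>q x\<close>
  and \<open>q0 x\<close> further apart modulo \<open>1\<close> than the length of the row. So a single point endangers the row.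
\<close>

lemma good_subrows:
  fixes R k :: nat and a' j :: int
  assumes R: "R \<ge> 2"
    and bad: "\<And>x. x \<in> gridcell (R\<^sup>2) (Suc k) a' \<Longrightarrow> bad_between cb 0 (\<kappa> * real R ^ Suc k) x"
    and cb: "0 < cb" "cb \<le> 1" and \<kappa>: "0 < \<kappa>" "\<kappa> \<le> 1/8" "\<kappa> \<le> cb / (2 * real R)" and c: "c \<le> \<kappa> / (8 * real R)"
  shows "\<exists>B\<subseteq>subcells R j. card B = R - 3 \<and> (\<forall>j'\<in>B. \<forall>x\<in>gridcell (R\<^sup>2) (Suc k) a'. \<forall>y\<in>gridcell R (Suc k) j'.
     \<forall>q::nat. \<forall>p::int. \<kappa> * real R ^ k \<le> real q \<and> real q < \<kappa> * real R ^ Suc k \<longrightarrow> c / real q \<le> \<bar>real q * x - y - of_int p\<bar>)"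
proof -
  define P where "P j' \<longleftrightarrow> (\<exists>x\<in>gridcell (R\<^sup>2) (Suc k) a'. \<exists>y\<in>gridcell R (Suc k) j'.
     \<exists>q::nat. \<exists>p::int. \<kappa> * real R ^ k \<le> real q \<and> real q < \<kappa> * real R ^ Suc k \<and> \<bar>real q * x - y - of_int p\<bar> < c / real q)" for j'
  define x0 where "x0 = real_of_int a' / real (R\<^sup>2) ^ Suc k"
  have x0: "x0 \<in> gridcell (R\<^sup>2) (Suc k) a'" by (auto simp: x0_def gridcell_def intro!: divide_right_mono)
  have R0: "R > 0" and Rr: "real R \<ge> 2" using R by auto
  define r where "r = real R ^ Suc k"
  have r0: "r > 0" using R0 by (simp add: r_def)
  have rk: "real R ^ k = r / real R" using R0 by (simp add: r_def)
  have "real (R\<^sup>2) ^ Suc k = real R ^ (2 * Suc k)" by (simp only: of_nat_power power_mult)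
  also have "\<dots> = r\<^sup>2" unfolding r_def by (simp only: mult.commute[of 2] power_mult)
  finally have m: "real (R\<^sup>2) ^ Suc k = r\<^sup>2" .
  have wit: "\<exists>y\<in>gridcell R (Suc k) j'. \<exists>(q::nat) (p::int). 0 < q \<and> real q < \<kappa> * r \<and> \<bar>(real q * x0 - of_int p) - y\<bar> < 1 / (4 * r)"
    if j': "P j'" for j'
  proof -
    obtain x y q p where w: "x \<in> gridcell (R\<^sup>2) (Suc k) a'" "y \<in> gridcell R (Suc k) j'"
      "\<kappa> * real R ^ k \<le> real q" "real q < \<kappa> * r" "\<bar>real q * x - y - of_int p\<bar> < c / real q"
      using j' unfolding P_def r_def by blast
    have q0: "real q > 0"
    proof -
      have "\<kappa> * real R ^ k > 0" using \<kappa> R0 by simp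
      then show ?thesis using w(3) by linarith
    qed
    have "\<bar>x - x0\<bar> \<le> 1 / r\<^sup>2" using gridcell_dist[OF w(1) x0] unfolding m .
    then have "real q * \<bar>x - x0\<bar> \<le> (\<kappa> * r) * (1 / r\<^sup>2)" using w(4) q0 by (intro mult_mono) auto
    also have "\<dots> = \<kappa> / r" using r0 by (simp add: power2_eq_square)
    also have "\<dots> \<le> (1/8) / r" using \<kappa> r0 by (intro divide_right_mono) auto
    finally have 1: "\<bar>real q * x - real q * x0\<bar> \<le> 1 / (8 * r)" using q0 by (simp add: abs_mult flip: right_diff_distrib)
    have "c / real q \<le> (\<kappa> / (8 * real R)) / real q" using c q0 by (intro divide_right_mono) auto
    also have "\<dots> \<le> (\<kappa> / (8 * real R)) / (\<kappa> * (r / real R))"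
      using w(3) \<kappa> R0 r0 q0 unfolding rk by (intro divide_left_mono) auto
    also have "\<dots> = 1 / (8 * r)" using \<kappa> R0 r0 by simp
    finally have 2: "c / real q \<le> 1 / (8 * r)" .
    have "1 / (4 * r) = 1 / (8 * r) + 1 / (8 * r)" by simp
    then have "\<bar>(real q * x0 - of_int p) - y\<bar> < 1 / (4 * r)" using 1 2 w(5) by linarith
    then show ?thesis using w(2,4) q0 by (intro bexI[of _ y] exI[of _ q] exI[of _ p]) auto
  qed
  have "card {j' \<in> subcells R j. P j'} \<le> 3"
  proof (cases "\<exists>j'\<in>subcells R j. P j'")
    case False
    then have e: "{j' \<in> subcells R j. P j'} = {}" by auto
    show ?thesis unfolding e by simp
  next
    case True
    then obtain j0 where j0: "j0 \<in> subcells R j" "P j0" by auto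
    obtain y0 q0 p0 where 0: "y0 \<in> gridcell R (Suc k) j0" "0 < q0" "real q0 < \<kappa> * r"
      "\<bar>(real q0 * x0 - of_int p0) - y0\<bar> < 1 / (4 * r)" using wit[OF j0(2)] by blast
    show ?thesis
    proof (rule card_cells_near_point(2)[OF R0, of _ "Suc k" "real q0 * x0 - of_int p0"])
      fix j' assume "j' \<in> {j' \<in> subcells R j. P j'}"
      then have j': "j' \<in> subcells R j" "P j'" by auto
      obtain y q p where 1: "y \<in> gridcell R (Suc k) j'" "0 < q" "real q < \<kappa> * r"
        "\<bar>(real q * x0 - of_int p) - y\<bar> < 1 / (4 * r)" using wit[OF j'(2)] by blast
      have "y \<in> gridcell R k j" "y0 \<in> gridcell R k j"
        using gridcell_subcell[OF j'(1) R0, of k] gridcell_subcell[OF j0(1) R0, of k] 0(1) 1(1) by auto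
      then have yy: "\<bar>y - y0\<bar> \<le> real R / r" using gridcell_dist[of y R k j y0] R0 by (simp add: rk)
      have "1 / (4 * r) + 1 / (4 * r) < 1 / r" using r0 by (simp add: field_simps)
      moreover have "1 / r \<le> real R / r" using R r0 by (intro divide_right_mono) auto
      ultimately have close: "\<bar>(real q * x0 - of_int p) - (real q0 * x0 - of_int p0)\<bar> < 2 * (real R / r)"
        using yy 0(4) 1(4) by linarith
      have eq: "(real q * x0 - of_int p) - (real q0 * x0 - of_int p0) = of_int (int q - int q0) * x0 - of_int (p - p0)"
        by (simp add: algebra_simps)
      have "int q - int q0 = 0"
      proof (rule ccontr)
        assume ne: "int q - int q0 \<noteq> 0"
        have abs: "\<bar>real_of_int (int q - int q0)\<bar> < \<kappa> * r" using 0(2,3) 1(2,3) by simp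
        have pos: "\<bar>real_of_int (int q - int q0)\<bar> > 0" using ne by linarith
        have "cb / \<bar>of_int (int q - int q0)\<bar> \<le> \<bar>of_int (int q - int q0) * x0 - of_int (p - p0)\<bar>"
          using abs by (intro bad_between_int[OF bad[OF x0]]) (auto simp: r_def)
        also have "\<dots> < 2 * (real R / r)" using close unfolding eq .
        finally have "cb / \<bar>of_int (int q - int q0)\<bar> < 2 * (real R / r)" .
        moreover have "cb / (\<kappa> * r) \<le> cb / \<bar>real_of_int (int q - int q0)\<bar>"
          using abs pos cb \<kappa> r0 by (intro divide_left_mono) auto
        moreover have "2 * (real R / r) \<le> cb / (\<kappa> * r)"
        proof -
          have "\<kappa> * (2 * real R) \<le> cb" using \<kappa>(3) R0 by (simp add: pos_le_divide_eq)
          then show ?thesis using \<kappa> r0 by (simp add: field_simps)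
        qed
        ultimately show False by linarith
      qed
      then have qq: "q = q0" by simp
      have "p = p0"
      proof -
        have "\<kappa> * r > 1" using 1(2,3) by linarith
        moreover have "\<kappa> * (2 * real R) \<le> 1" using \<kappa>(3) cb R0 by (simp add: pos_le_divide_eq)
        then have "\<kappa> * r * (2 * real R) \<le> r" using mult_right_mono[of "\<kappa> * (2 * real R)" 1 r] r0 by (simp add: mult_ac)
        moreover have "1 * (2 * real R) < \<kappa> * r * (2 * real R)" using \<open>\<kappa> * r > 1\<close> R0 by (intro mult_strict_right_mono) auto
        ultimately have "2 * real R < r" by linarith
        then have "2 * (real R / r) < 1" using r0 by (simp add: pos_divide_less_eq)
        then have "\<bar>real_of_int (p - p0)\<bar> < 1" using close unfolding eq qq by simp
        then show ?thesis by linarith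
      qed
      have "\<bar>y - (real q0 * x0 - of_int p0)\<bar> < 1 / (4 * r)" using 1(4) unfolding qq \<open>p = p0\<close> by (simp add: abs_minus_commute)
      also have "\<dots> \<le> 1 / r" using r0 by (simp add: field_simps)
      finally show "\<exists>x\<in>gridcell R (Suc k) j'. \<bar>x - (real q0 * x0 - of_int p0)\<bar> < 1 / real R ^ Suc k"
        using 1(1) unfolding r_def by blast
    qed
  qed
  from unkilled_subcells[OF this] obtain B where
    B: "B \<subseteq> subcells R j" "card B = R - 3" "\<And>j'. j' \<in> B \<Longrightarrow> \<not> P j'" by auto
  show ?thesis
  proof (intro exI[of _ B] conjI ballI allI impI B)
    fix j' x y and q :: nat and p :: int
    assume "j' \<in> B" "x \<in> gridcell (R\<^sup>2) (Suc k) a'" "y \<in> gridcell R (Suc k) j'"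
      "\<kappa> * real R ^ k \<le> real q \<and> real q < \<kappa> * real R ^ Suc k"
    then show "c / real q \<le> \<bar>real q * x - y - of_int p\<bar>" using B(3)[of j'] unfolding P_def by (meson not_less)
  qed
qed

lemma dist_int_lipschitz: "dist_int x \<le> dist_int y + \<bar>x - y\<bar>"
  unfolding dist_int_def using infdist_triangle[of x \<int> y] by (simp add: dist_real_def)

lemma dist_int_nonneg: "dist_int x \<ge> 0"
  by (simp add: dist_int_def infdist_nonneg)

lemma dist_int_greatest:
  assumes "\<And>p::int. b \<le> \<bar>x - of_int p\<bar>"
  shows "b \<le> dist_int x"
proof -
  have "b \<le> (INF a\<in>\<int>. dist x a)"
  proof (rule cINF_greatest)
    fix a :: real assume "a \<in> \<int>"
    then obtain p where "a = of_int p" by (auto elim: Ints_cases)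
    then show "b \<le> dist x a" using assms[of p] by (simp add: dist_real_def)
  qed auto
  then show ?thesis by (simp add: dist_int_def infdist_def) (metis Ints_0 empty_iff)
qed

text \<open>
  \<open>P = R/2\<close> is a lower bound for \<open>R - 3\<close> and for the square root of \<open>R\<^sup>2 - 3\<close>. The factors \<open>2\<close> that are
  lost in this way are absorbed by the largeness of \<open>R\<close>.
\<close>

lemma product_growth:
  fixes R :: nat and s :: real
  assumes s: "0 < s" "s < 2" and R: "R \<ge> 10" "real R powr ((2 - s) / 2) \<ge> 4"
    and count: "\<And>h. real (card {l. l < h \<and> Sp l}) \<le> (2 - s) / 2 * real h"
  defines "cols \<equiv> \<lambda>l. if Sp l then 1 else R\<^sup>2 - 3"
  shows "(1 / real R) * real R powr (s * real k) \<le> (\<Prod>l<k div 2. real (cols l)) * real (R - 3) ^ k"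
proof -
  define \<epsilon> where "\<epsilon> = (2 - s) / 2"
  define h where "h = k div 2"
  define P where "P = real R / 2"
  have P: "P \<ge> 5" using R by (simp add: P_def)
  have m3: "real (R\<^sup>2 - 3) \<ge> P\<^sup>2"
  proof -
    have "R\<^sup>2 \<ge> 100" using R power_mono[of 10 R 2] by simp
    then have "real (R\<^sup>2 - 3) = real R ^ 2 - 3" "real R ^ 2 \<ge> 100" by (simp_all add: of_nat_diff) (metis of_nat_le_iff of_nat_numeral of_nat_power)
    then show ?thesis by (simp add: P_def power_divide)
  qed
  have R3: "real (R - 3) \<ge> P" using R by (simp add: P_def of_nat_diff)
  let ?S = "{l. l < h \<and> Sp l}" and ?N = "{l. l < h \<and> \<not> Sp l}"
  have fin: "finite ?S" "finite ?N" by simp_all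
  have split: "{..<h} = ?S \<union> ?N" by auto
  have "(\<Prod>l<h. real (cols l)) = (\<Prod>l\<in>?S. real (cols l)) * (\<Prod>l\<in>?N. real (cols l))"
    unfolding split by (intro prod.union_disjoint) auto
  also have "\<dots> = real (R\<^sup>2 - 3) ^ card ?N" by (simp add: cols_def)
  also have "\<dots> \<ge> (P\<^sup>2) ^ card ?N" using m3 P by (intro power_mono) auto
  finally have prod: "P ^ (2 * card ?N) \<le> (\<Prod>l<h. real (cols l))" by (simp add: power_mult)
  have cardN: "real (card ?N) = real h - real (card ?S)"
  proof -
    have "h = card ?S + card ?N" using card_Un_disjoint[of ?S ?N] split by (metis (no_types, lifting) card_lessThan disjoint_iff fin mem_Collect_eq)
    then show ?thesis by linarith
  qed
  have low: "real (card ?N) \<ge> (1 - \<epsilon>) * real h" using count[of h] unfolding cardN by (simp add: \<epsilon>_def algebra_simps)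
  have eps: "0 < \<epsilon>" "\<epsilon> < 1" "2 - \<epsilon> = s / 2 + 1" "s = 2 - 2 * \<epsilon>" using s by (simp_all add: \<epsilon>_def field_simps)
  have h2: "2 * real h \<ge> real k - 1" unfolding h_def by linarith
  have expo: "(2 - \<epsilon>) * real k - 1 \<le> 2 * real (card ?N) + real k"
  proof -
    have "(1 - \<epsilon>) * (real k - 1) \<le> (1 - \<epsilon>) * (2 * real h)" using h2 eps by (intro mult_left_mono) auto
    then have "(1 - \<epsilon>) * real k - (1 - \<epsilon>) \<le> 2 * real (card ?N)" using low by (simp add: algebra_simps)
    then show ?thesis using eps by (simp add: algebra_simps)
  qed
  have key: "real R powr s \<le> P powr (2 - \<epsilon>)"
  proof -
    have "4 * real R powr s \<le> real R powr \<epsilon> * real R powr s" using R by (intro mult_right_mono) (auto simp: \<epsilon>_def)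
    also have "\<dots> = real R powr (2 - \<epsilon>)" using eps by (simp flip: powr_add)
    finally have "4 * real R powr s \<le> real R powr (2 - \<epsilon>)" .
    moreover have "(2::real) powr (2 - \<epsilon>) \<le> 2 powr 2" using eps by (intro powr_mono) auto
    moreover have "P powr (2 - \<epsilon>) = real R powr (2 - \<epsilon>) / 2 powr (2 - \<epsilon>)" by (simp add: P_def powr_divide)
    moreover have "real R powr (2 - \<epsilon>) / 4 \<le> real R powr (2 - \<epsilon>) / 2 powr (2 - \<epsilon>)"
      using calculation(2) by (intro divide_left_mono) auto
    ultimately show ?thesis by linarith
  qed
  have "(1 / real R) * real R powr (s * real k) = (1 / real R) * (real R powr s) powr real k" by (simp add: powr_powr)
  also have "\<dots> \<le> (1 / P) * (P powr (2 - \<epsilon>)) powr real k"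
    using key P R by (intro mult_mono powr_mono2 divide_left_mono) (auto simp: P_def)
  also have "\<dots> = P powr ((2 - \<epsilon>) * real k - 1)"
  proof -
    have "(1 / P) * P powr y = P powr (y - 1)" for y using P by (simp add: powr_diff)
    then show ?thesis by (simp only: powr_powr)
  qed
  also have "\<dots> \<le> P powr (2 * real (card ?N) + real k)" using expo P by (intro powr_mono) auto
  also have "\<dots> = P ^ (2 * card ?N) * P ^ k" using P by (simp add: powr_add flip: powr_realpow)
  also have "\<dots> \<le> (\<Prod>l<h. real (cols l)) * real (R - 3) ^ k"
    using prod R3 P by (intro mult_mono power_mono prod_nonneg) auto
  finally show ?thesis by (simp add: h_def)
qed

lemma hausdorff_measure_empty: "hausdorff_measure s {} = 0"
proof -
  have "hausdorff_premeasure s \<epsilon> ({} :: 'a set) \<le> (\<Sum>i::nat. hausdorff_weight s ({} :: 'a set))" if "\<epsilon> > 0" for \<epsilon>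
    unfolding hausdorff_premeasure_def using that by (intro INF_lower2[of "\<lambda>_. {}"]) auto
  then have "hausdorff_measure s ({} :: 'a set) \<le> 0"
    unfolding hausdorff_measure_def by (intro SUP_least) (auto simp: hausdorff_weight_def)
  then show ?thesis by simp
qed

text \<open>
  The invariant of the tree has to deal with a subtlety inside a special window. There all columns
  but those leading to the target \<open>\<tau>\<close> are dropped, and every point of a cell of level \<open>l\<close> inherits bad
  approximability from \<open>\<tau>\<close> only for denominators up to \<open>\<kappa> R\<^sup>l\<close>, with \<open>\<kappa>\<close> smaller than \<open>1 / (2 R)\<close>. The gap
  up to \<open>R\<^sup>l / (2 R)\<close> is closed at the first ordinary level after the window.
\<close>

lemma R_set_hausdorff_measure:
  fixes \<alpha> \<gamma> s :: real
  assumes \<alpha>: "\<alpha> \<in> K_set" and s: "0 < s" "s < 2"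
  shows "hausdorff_measure s (R_set \<alpha> \<gamma>) \<noteq> 0"
proof -
  define \<epsilon> where "\<epsilon> = (2 - s) / 2"
  have eps: "0 < \<epsilon>" "\<epsilon> \<le> 1" using s by (auto simp: \<epsilon>_def)
  define R where "R = nat \<lceil>max 10 (4 powr (1 / \<epsilon>))\<rceil>"
  have Rr: "real R \<ge> max 10 (4 powr (1 / \<epsilon>))" unfolding R_def by (rule real_nat_ceiling_ge)
  have R: "R \<ge> 10" using Rr by simp
  have R4: "real R powr \<epsilon> \<ge> 4"
  proof -
    have "(4 powr (1 / \<epsilon>)) powr \<epsilon> \<le> real R powr \<epsilon>" using Rr eps by (intro powr_mono2) auto
    then show ?thesis using eps by (simp add: powr_powr)
  qed
  define m where "m = R\<^sup>2"
  have R0: "real R > 0" and R1: "real R \<ge> 1" and R2: "R \<ge> 2" and Rn: "R > 0" using R by simp_all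
  have m0: "m > 0" using R by (simp add: m_def)
  have mpow: "real m ^ l = (real R ^ l)\<^sup>2" for l by (simp add: m_def power_even_eq power2_eq_square power_mult_distrib)
  obtain cs where cs: "0 < cs" "cs \<le> 1" "\<And>cb. 0 < cb \<Longrightarrow> \<exists>K0. \<forall>K\<ge>K0. strips_reachable R cs cb K"
    using bad_number_in_strip[OF R] by blast
  \<comment> \<open>If \<open>q \<le> \<kappa> R\<^sup>l\<close>, moving \<open>\<tau>\<close> within a cell of level \<open>l\<close> changes \<open>q \<tau>\<close> by at most \<open>\<kappa>\<^sup>2 / q\<close>, that is, by at
    most half of what the constant \<open>cs\<close> provides. The two bounds in \<open>cb\<close> come from this and from
    \<open>good_subcolumns\<close>.\<close>
  define \<kappa> where "\<kappa> = min (1 / (2 * real R)) (cs / 2)"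
  have kap: "0 < \<kappa>" "\<kappa> \<le> 1 / (2 * real R)" "\<kappa> < 1" "\<kappa>\<^sup>2 \<le> cs / 2"
  proof -
    show 1: "0 < \<kappa>" "\<kappa> \<le> 1 / (2 * real R)" using cs R0 by (auto simp: \<kappa>_def)
    have 2: "\<kappa> \<le> cs / 2" by (simp add: \<kappa>_def)
    then show 3: "\<kappa> < 1" using cs by linarith
    have "\<kappa> * \<kappa> \<le> 1 * \<kappa>" using 1 3 by (intro mult_right_mono) auto
    then show "\<kappa>\<^sup>2 \<le> cs / 2" using 2 by (simp add: power2_eq_square)
  qed
  define cb where "cb = min (cs / 2) (\<kappa>\<^sup>2 / (2 * real m))"
  have cb: "0 < cb" "cb \<le> cs / 2" "cb \<le> \<kappa>\<^sup>2 / (2 * real m)" "cb \<le> 1"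
    using cs kap m0 by (auto simp: cb_def)
  define \<kappa>2 where "\<kappa>2 = min (1/8) (min \<kappa> (cb / (2 * real R)))"
  have kap2: "0 < \<kappa>2" "\<kappa>2 \<le> 1/8" "\<kappa>2 \<le> \<kappa>" "\<kappa>2 \<le> cb / (2 * real R)"
    using kap cb R0 by (auto simp: \<kappa>2_def)
  define c2 where "c2 = \<kappa>2 / (8 * real R)"
  have c2: "c2 > 0" using kap2 R0 by (simp add: c2_def)
  obtain K0 where K0: "\<And>K. K \<ge> K0 \<Longrightarrow> strips_reachable R cs cb K"
    using cs(3)[OF cb(1)] by blast
  obtain n K kk M :: "nat \<Rightarrow> nat" and cN :: real where sched: "strict_mono n" "\<And>t. n t \<ge> 2"
    "\<And>t. dist_int (real (n t) * \<alpha> - \<gamma>) \<le> 6 / real (n t)"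
    "\<And>t. real R ^ (8 * K t + 2 * kk t) \<le> real (n t)" "\<And>t. real (n t) \<le> real R ^ (8 * K t + 2 * kk t + 2)"
    "\<And>t. 2 / (1 / (18 * ln (real (n t))))\<^sup>2 < real (M t)" "\<And>t. real (M t) ^ 4 \<le> real R ^ K t"
    "\<And>t. K0 \<le> K t" "\<And>t. 2 \<le> K t" "\<And>t. K t < K (Suc t)"
    "5 * real (K 0) \<le> \<epsilon> * real (kk 0)" "\<And>t. 5 * real (K (Suc t)) \<le> \<epsilon> * (real (kk (Suc t)) - real (kk t))"
    "cN > 0" "\<forall>\<^sub>F N in sequentially. cN * ln (ln (real N)) \<le> real (card {t. n t \<le> N})"
    by (rule approximation_schedule[OF \<alpha> R eps, of \<gamma> K0]) (rule that)
  define D where "D t = 5 * K t" for t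
  define r where "r t = 1 / (18 * ln (real (n t)))" for t
  have Dpos: "D t > 0" for t using sched(9)[of t] by (simp add: D_def)
  have lnn: "ln (real (n t)) \<ge> 2 / 3" for t
  proof -
    have "ln 2 \<le> ln (real (n t))" using sched(2)[of t] by simp
    then show ?thesis using ln2_ge_two_thirds by linarith
  qed
  have r: "0 < r t" "r t \<le> 1" for t using lnn[of t] by (auto simp: r_def divide_le_eq)
  have rK: "1 / real R ^ K t \<le> r t" for t
  proof -
    have "real (M t) > 0" using sched(6)[of t] r[of t] by (smt (verit) divide_nonneg_nonneg zero_le_power2)
    then have "real (M t) ^ 1 \<le> real (M t) ^ 4" by (intro power_increasing) auto
    then have "2 / (r t)\<^sup>2 \<le> real R ^ K t" using sched(6)[of t] sched(7)[of t]
      unfolding r_def power_one_right by linarith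
    moreover have "1 / r t \<le> 2 / (r t)\<^sup>2"
    proof -
      have "(r t)\<^sup>2 \<le> r t" using r[of t] by (simp add: power2_eq_square mult_le_cancel_left1 mult_left_le)
      then show ?thesis using r[of t] by (intro frac_le) auto
    qed
    ultimately have "1 / r t \<le> real R ^ K t" by linarith
    then show ?thesis using r[of t] R0 by (simp add: field_simps)
  qed
  have kstep: "kk t + D t < kk (Suc t)" for t
  proof -
    have "0 \<le> \<epsilon> * (real (kk (Suc t)) - real (kk t))" using sched(12)[of t] by (meson of_nat_0_le_iff order_trans mult_nonneg_nonneg zero_le_numeral)
    then have "0 \<le> real (kk (Suc t)) - real (kk t)" using eps by (simp add: zero_le_mult_iff)
    then have "\<epsilon> * (real (kk (Suc t)) - real (kk t)) \<le> 1 * (real (kk (Suc t)) - real (kk t))" using eps by (intro mult_right_mono)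
    from order_trans[OF sched(12)[of t] this] have "5 * real (K (Suc t)) \<le> real (kk (Suc t)) - real (kk t)" by simp
    moreover have "real (D t) < 5 * real (K (Suc t))" using sched(10)[of t] by (simp add: D_def)
    ultimately have "real (kk t + D t) < real (kk (Suc t))" by simp
    then show ?thesis by (simp only: of_nat_less_iff)
  qed
  have kmono: "strict_mono kk" unfolding strict_mono_Suc_iff using kstep by (metis add_lessD1)
  have kjump: "kk t + D t < kk u" if "t < u" for t u
    using kstep[of t] strict_mono_less_eq[OF kmono, of "Suc t" u] that by (auto intro: less_le_trans)
  have kK: "K t \<le> kk t" for t
  proof (cases t)
    case 0
    have "\<epsilon> * real (kk 0) \<le> 1 * real (kk 0)" using eps by (intro mult_right_mono) auto
    from order_trans[OF sched(11) this] show ?thesis using 0 by simp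
  next
    case (Suc u)
    have "0 \<le> real (kk (Suc u)) - real (kk u)" using kstep[of u] by simp
    then have "\<epsilon> * (real (kk (Suc u)) - real (kk u)) \<le> 1 * (real (kk (Suc u)) - real (kk u))" using eps by (intro mult_right_mono) auto
    from order_trans[OF sched(12)[of u] this] show ?thesis using Suc by simp
  qed
  have rk: "1 / real R ^ kk t \<le> r t" for t
  proof -
    have "1 / real R ^ kk t \<le> 1 / real R ^ K t" using kK[of t] R by (intro divide_left_mono power_increasing) auto
    then show ?thesis using rK[of t] by linarith
  qed
  define win where "win t l \<longleftrightarrow> kk t < l \<and> l \<le> kk t + D t" for t l
  define Sp where "Sp l \<longleftrightarrow> (\<exists>t. kk t \<le> l \<and> l < kk t + D t)" for l
  have win_unique: "t = u" if "win t l" "win u l" for t u l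
    using that kjump[of t u] kjump[of u t] by (cases t u rule: linorder_cases) (auto simp: win_def)
  have win_start: "\<not> win u (kk t)" for t u
    using kjump[of u t] strict_mono_less[OF kmono, of u t] by (auto simp: win_def)
  define cols where "cols l = (if Sp l then 1 else R\<^sup>2 - 3)" for l
  define Tau where "Tau t \<tau> l j \<longleftrightarrow> bad_between cs (real R ^ kk t / (2 * real R)) (real R ^ (kk t + D t)) \<tau> \<and>
     (\<forall>y\<in>gridcell R l j. dist_int (real (n t) * \<tau> - y) \<le> 2 * r t)" for t \<tau> l j
  \<comment> \<open>The clauses concern: all levels; ordinary levels; levels inside a window; inhomogeneous
    approximation; the strips of the windows that are completed.\<close>
  define Inv where "Inv l a j \<longleftrightarrow>
     (\<forall>x\<in>gridcell m l a. bad_between cb 0 (\<kappa> * real R ^ l) x) \<and>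
     ((\<forall>t. \<not> win t l) \<longrightarrow> (\<forall>x\<in>gridcell m l a. bad_between cb 0 (real R ^ l / (2 * real R)) x)) \<and>
     (\<forall>t. win t l \<longrightarrow> (\<forall>x\<in>gridcell m l a. bad_between cb 0 (real R ^ kk t / (2 * real R)) x) \<and> (\<exists>\<tau>\<in>gridcell m l a. Tau t \<tau> l j)) \<and>
     (\<forall>x\<in>gridcell m l a. \<forall>y\<in>gridcell R l j. \<forall>q::nat. \<forall>p::int. real q < \<kappa>2 * real R ^ l \<longrightarrow> c2 / real q \<le> \<bar>real q * x - y - of_int p\<bar>) \<and>
     (\<forall>t. kk t + D t \<le> l \<longrightarrow> (\<forall>x\<in>gridcell m l a. \<forall>y\<in>gridcell R l j. dist_int (real (n t) * x - y) \<le> 3 * r t))" for l a j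
  have colstep: "\<exists>A\<subseteq>subcells m a. card A = cols l \<and> (\<forall>a'\<in>A.
       (\<forall>x\<in>gridcell m (Suc l) a'. bad_between cb 0 (\<kappa> * real R ^ Suc l) x) \<and>
       ((\<forall>t. \<not> win t (Suc l)) \<longrightarrow> (\<forall>x\<in>gridcell m (Suc l) a'. bad_between cb 0 (real R ^ Suc l / (2 * real R)) x)) \<and>
       (\<forall>t. win t (Suc l) \<longrightarrow> (\<forall>x\<in>gridcell m (Suc l) a'. bad_between cb 0 (real R ^ kk t / (2 * real R)) x) \<and> (\<exists>\<tau>\<in>gridcell m (Suc l) a'. Tau t \<tau> l j)))"
    if inv: "Inv l a j" for l a j
  proof (cases "Sp l")
    case True
    then obtain t where t: "kk t \<le> l" "l < kk t + D t" by (auto simp: Sp_def)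
    have bads: "bad_between cb 0 (real R ^ kk t / (2 * real R)) x" if "x \<in> gridcell m l a" for x
    proof (cases "l = kk t")
      case True
      then show ?thesis using inv that win_start unfolding Inv_def by blast
    next
      case False
      then have "win t l" using t by (simp add: win_def)
      then show ?thesis using inv that unfolding Inv_def by blast
    qed
    obtain \<tau> where tau: "\<tau> \<in> gridcell m l a" "Tau t \<tau> l j"
    proof (cases "l = kk t")
      case True
      define \<omega> where "\<omega> = of_int j / real R ^ l"
      have om: "\<omega> \<in> gridcell R l j" by (auto simp: \<omega>_def gridcell_def intro!: divide_right_mono)
      have start: "bad_between cb 0 (real R ^ kk t / (2 * real R)) x" if "x \<in> gridcell (R\<^sup>2) (kk t) a" for x
        using bads[of x] that True by (simp add: m_def)
      obtain \<tau> where \<tau>: "\<tau> \<in> gridcell m (kk t) a" "dist_int (real (n t) * \<tau> - \<omega>) < r t"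
        "bad_between cs (real R ^ kk t / (2 * real R)) (real R ^ (kk t + 5 * K t)) \<tau>"
        by (rule strips_reachableE[where a = a and k = "kk t" and n = "real (n t)" and M = "M t" and \<omega> = \<omega>,
              OF K0[OF sched(8)] start sched(4,5) r(1) sched(6)[folded r_def] sched(7)])
          (assumption, rule that[unfolded m_def])
      have "dist_int (real (n t) * \<tau> - y) \<le> 2 * r t" if y: "y \<in> gridcell R l j" for y
      proof -
        have "\<bar>y - \<omega>\<bar> \<le> 1 / real R ^ kk t" using gridcell_dist[OF y om] True by simp
        then have "\<bar>(real (n t) * \<tau> - y) - (real (n t) * \<tau> - \<omega>)\<bar> \<le> r t" using rk[of t] by simp
        then show ?thesis using dist_int_lipschitz[of "real (n t) * \<tau> - y" "real (n t) * \<tau> - \<omega>"] \<tau>(2) by linarith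
      qed
      then show thesis using that[of \<tau>] \<tau> True by (simp add: Tau_def D_def)
    next
      case False
      then have "win t l" using t by (simp add: win_def)
      then show thesis using inv that unfolding Inv_def by blast
    qed
    obtain a' where a': "a' \<in> subcells m a" "\<tau> \<in> gridcell m (Suc l) a'"
      by (rule gridcell_cover[OF tau(1) m0])
    have sub: "gridcell m (Suc l) a' \<subseteq> gridcell m l a" by (rule gridcell_subcell[OF a'(1) m0])
    have wt: "win t (Suc l)" using t by (simp add: win_def)
    have "bad_between cb 0 (\<kappa> * real R ^ Suc l) x" if x: "x \<in> gridcell m (Suc l) a'" for x
      unfolding bad_between_def
    proof (intro allI impI)
      fix q :: nat and p :: int
      assume q: "0 \<le> real q \<and> real q < \<kappa> * real R ^ Suc l"
      show "cb / real q \<le> \<bar>real q * x - of_int p\<bar>"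
      proof (cases "real q < real R ^ kk t / (2 * real R)")
        case True
        then show ?thesis using bads[of x] sub x by (intro bad_betweenD[of cb 0]) auto
      next
        case False
        have "real R ^ kk t / (2 * real R) > 0" using R0 by simp
        then have q0: "real q > 0" using False by linarith
        have "\<kappa> * real R ^ Suc l \<le> 1 * real R ^ Suc l" using kap by (intro mult_right_mono) auto
        moreover have "real R ^ Suc l \<le> real R ^ (kk t + D t)" using t R1 by (intro power_increasing) auto
        ultimately have "real q < real R ^ (kk t + D t)" using q by linarith
        then have 1: "cs / real q \<le> \<bar>real q * \<tau> - of_int p\<bar>"
          using tau(2) False unfolding Tau_def by (intro bad_betweenD[of cs "real R ^ kk t / (2 * real R)"]) auto
        have "\<bar>x - \<tau>\<bar> \<le> 1 / real m ^ Suc l" by (rule gridcell_dist[OF x a'(2)])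
        then have "real q * \<bar>x - \<tau>\<bar> \<le> real q * (1 / (real R ^ Suc l)\<^sup>2)" unfolding mpow by (intro mult_left_mono) auto
        also have "\<dots> = ((real q)\<^sup>2 / (real R ^ Suc l)\<^sup>2) / real q" using q0 by (simp add: power2_eq_square)
        also have "\<dots> \<le> \<kappa>\<^sup>2 / real q"
        proof (rule divide_right_mono)
          have "(real q)\<^sup>2 \<le> (\<kappa> * real R ^ Suc l)\<^sup>2" using q by (intro power_mono) auto
          then show "(real q)\<^sup>2 / (real R ^ Suc l)\<^sup>2 \<le> \<kappa>\<^sup>2" using R0 by (simp add: pos_divide_le_eq power_mult_distrib)
        qed simp
        finally have 2: "\<bar>real q * x - real q * \<tau>\<bar> \<le> \<kappa>\<^sup>2 / real q" by (simp add: abs_mult flip: right_diff_distrib)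
        have "cb / real q \<le> (cs - \<kappa>\<^sup>2) / real q" using cb(2) kap(4) q0 by (intro divide_right_mono) auto
        also have "\<dots> = cs / real q - \<kappa>\<^sup>2 / real q" by (rule diff_divide_distrib)
        also have "\<dots> \<le> \<bar>real q * x - of_int p\<bar>" using 1 2 by linarith
        finally show ?thesis .
      qed
    qed
    moreover have "(\<forall>x\<in>gridcell m (Suc l) a'. bad_between cb 0 (real R ^ kk u / (2 * real R)) x) \<and> (\<exists>\<tau>\<in>gridcell m (Suc l) a'. Tau u \<tau> l j)"
      if "win u (Suc l)" for u
    proof -
      have "u = t" using win_unique[OF that wt] .
      then show ?thesis using bads sub tau(2) a'(2) by blast
    qed
    ultimately show ?thesis using wt a'(1) True by (intro exI[of _ "{a'}"]) (auto simp: cols_def)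
  next
    case False
    have lo: "\<kappa> * real R ^ l > 0" using kap R0 by simp
    have hi: "(real R ^ l / 2)\<^sup>2 \<le> real m ^ l / 4" "real R ^ l / 2 > 0" using R0 by (simp_all add: mpow power_divide)
    have cc: "cb \<le> (\<kappa> * real R ^ l)\<^sup>2 / (2 * real m ^ Suc l)"
    proof -
      have "(\<kappa> * real R ^ l)\<^sup>2 / (2 * real m ^ Suc l) = \<kappa>\<^sup>2 / (2 * real m)"
        using R0 m0 unfolding power_Suc mpow by (simp add: power_mult_distrib)
      then show ?thesis using cb(3) by simp
    qed
    obtain S where S: "S \<subseteq> subcells m a" "card S = m - 3"
      "\<And>a' x. a' \<in> S \<Longrightarrow> x \<in> gridcell m (Suc l) a' \<Longrightarrow> bad_between cb (\<kappa> * real R ^ l) (real R ^ l / 2) x"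
      by (rule good_subcolumns[OF m0 lo hi cc, of a]) (rule that)
    have full: "bad_between cb 0 (real R ^ Suc l / (2 * real R)) x" if "a' \<in> S" "x \<in> gridcell m (Suc l) a'" for a' x
    proof -
      have "x \<in> gridcell m l a" using gridcell_subcell[OF _ m0, of a' a l] S(1) that by blast
      then have "bad_between cb 0 (\<kappa> * real R ^ l) x" using inv unfolding Inv_def by blast
      from bad_between_join[OF this S(3)[OF that]] show ?thesis using R0 by simp
    qed
    moreover have "\<kappa> * real R ^ Suc l \<le> real R ^ Suc l / (2 * real R)"
      using mult_right_mono[OF kap(2), of "real R ^ Suc l"] by simp
    then have "bad_between cb 0 (\<kappa> * real R ^ Suc l) x" if "a' \<in> S" "x \<in> gridcell m (Suc l) a'" for a' x
      using bad_between_mono[OF full[OF that]] by blast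
    moreover have "\<not> win t (Suc l)" for t using False by (auto simp: win_def Sp_def less_Suc_eq_le)
    ultimately show ?thesis using S(1,2) False by (intro exI[of _ S]) (auto simp: cols_def m_def)
  qed
  have step: "\<exists>A\<subseteq>subcells m a. card A = cols l \<and>
        (\<forall>a'\<in>A. \<exists>B\<subseteq>subcells R j. card B = R - 3 \<and> (\<forall>j'\<in>B. Inv (Suc l) a' j'))" if inv: "Inv l a j" for l a j
  proof -
    obtain A where A: "A \<subseteq> subcells m a" "card A = cols l"
      and A1: "\<And>a' x. a' \<in> A \<Longrightarrow> x \<in> gridcell m (Suc l) a' \<Longrightarrow> bad_between cb 0 (\<kappa> * real R ^ Suc l) x"
      and A2: "\<And>a' x. a' \<in> A \<Longrightarrow> (\<forall>t. \<not> win t (Suc l)) \<Longrightarrow> x \<in> gridcell m (Suc l) a' \<Longrightarrow> bad_between cb 0 (real R ^ Suc l / (2 * real R)) x"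
      and A3: "\<And>a' t x. a' \<in> A \<Longrightarrow> win t (Suc l) \<Longrightarrow> x \<in> gridcell m (Suc l) a' \<Longrightarrow> bad_between cb 0 (real R ^ kk t / (2 * real R)) x"
      and A4: "\<And>a' t. a' \<in> A \<Longrightarrow> win t (Suc l) \<Longrightarrow> \<exists>\<tau>\<in>gridcell m (Suc l) a'. Tau t \<tau> l j"
      using colstep[OF inv] by blast
    have "\<exists>B\<subseteq>subcells R j. card B = R - 3 \<and> (\<forall>j'\<in>B. Inv (Suc l) a' j')" if a': "a' \<in> A" for a'
    proof -
      have asub: "gridcell m (Suc l) a' \<subseteq> gridcell m l a" using A(1) a' by (intro gridcell_subcell m0) blast
      have bad2: "bad_between cb 0 (\<kappa>2 * real R ^ Suc l) x" if "x \<in> gridcell (R\<^sup>2) (Suc l) a'" for x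
      proof (rule bad_between_mono[OF A1[OF a']])
        show "x \<in> gridcell m (Suc l) a'" using that by (simp add: m_def)
        show "\<kappa>2 * real R ^ Suc l \<le> \<kappa> * real R ^ Suc l" using kap2(3) by (intro mult_right_mono) auto
      qed auto
      have "\<exists>B\<subseteq>subcells R j. card B = R - 3 \<and> (\<forall>j'\<in>B. \<forall>x\<in>gridcell (R\<^sup>2) (Suc l) a'. \<forall>y\<in>gridcell R (Suc l) j'.
          \<forall>q::nat. \<forall>p::int. \<kappa>2 * real R ^ l \<le> real q \<and> real q < \<kappa>2 * real R ^ Suc l \<longrightarrow> c2 / real q \<le> \<bar>real q * x - y - of_int p\<bar>)"
        by (rule good_subrows[OF R2 bad2 cb(1,4) kap2(1,2,4)]) (simp_all add: c2_def)
      then obtain B where B: "B \<subseteq> subcells R j" "card B = R - 3"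
        and B0: "\<forall>j'\<in>B. \<forall>x\<in>gridcell (R\<^sup>2) (Suc l) a'. \<forall>y\<in>gridcell R (Suc l) j'.
          \<forall>q::nat. \<forall>p::int. \<kappa>2 * real R ^ l \<le> real q \<and> real q < \<kappa>2 * real R ^ Suc l \<longrightarrow> c2 / real q \<le> \<bar>real q * x - y - of_int p\<bar>"
        by (elim exE conjE)
      have B1: "c2 / real q \<le> \<bar>real q * x - y - of_int p\<bar>"
        if "j' \<in> B" "x \<in> gridcell m (Suc l) a'" "y \<in> gridcell R (Suc l) j'"
          "\<kappa>2 * real R ^ l \<le> real q" "real q < \<kappa>2 * real R ^ Suc l" for j' x y q p
        using B0[rule_format, of j' x y q p] that unfolding m_def by blast
      have "Inv (Suc l) a' j'" if j': "j' \<in> B" for j'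
      proof -
        have jsub: "gridcell R (Suc l) j' \<subseteq> gridcell R l j" using B(1) j' by (intro gridcell_subcell Rn) blast
        have t3: "\<exists>\<tau>\<in>gridcell m (Suc l) a'. Tau t \<tau> (Suc l) j'" if "win t (Suc l)" for t
          using A4[OF a' that] jsub unfolding Tau_def by blast
        have i4: "c2 / real q \<le> \<bar>real q * x - y - of_int p\<bar>"
          if "x \<in> gridcell m (Suc l) a'" "y \<in> gridcell R (Suc l) j'" "real q < \<kappa>2 * real R ^ Suc l" for x y and q :: nat and p :: int
        proof (cases "real q < \<kappa>2 * real R ^ l")
          case True
          then show ?thesis using inv that asub jsub unfolding Inv_def by blast
        next
          case False
          then show ?thesis using B1[OF j' that(1,2) _ that(3)] by simp
        qed
        have i5: "dist_int (real (n t) * x - y) \<le> 3 * r t"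
          if "kk t + D t \<le> Suc l" "x \<in> gridcell m (Suc l) a'" "y \<in> gridcell R (Suc l) j'" for t x y
        proof (cases "kk t + D t \<le> l")
          case True
          then show ?thesis using inv that asub jsub unfolding Inv_def by blast
        next
          case False
          then have eq: "Suc l = kk t + D t" using that(1) by simp
          then have w: "win t (Suc l)" using Dpos[of t] by (simp add: win_def)
          obtain \<tau> where \<tau>: "\<tau> \<in> gridcell m (Suc l) a'" "Tau t \<tau> (Suc l) j'" using t3[OF w] by blast
          have "\<bar>x - \<tau>\<bar> \<le> 1 / (real R ^ (kk t + D t))\<^sup>2" using gridcell_dist[OF that(2) \<tau>(1)] unfolding mpow eq .
          then have "real (n t) * \<bar>x - \<tau>\<bar> \<le> real R ^ (8 * K t + 2 * kk t + 2) * (1 / (real R ^ (kk t + D t))\<^sup>2)"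
            using sched(5) by (intro mult_mono) auto
          also have "(real R ^ (kk t + D t))\<^sup>2 = real R ^ (8 * K t + 2 * kk t + 2) * real R ^ (2 * K t - 2)"
          proof -
            have "2 * (kk t + D t) = (8 * K t + 2 * kk t + 2) + (2 * K t - 2)" using sched(9)[of t] by (simp add: D_def)
            then show ?thesis by (simp only: power_even_eq[symmetric] power_add[symmetric])
          qed
          also have "real R ^ (8 * K t + 2 * kk t + 2) * (1 / (real R ^ (8 * K t + 2 * kk t + 2) * real R ^ (2 * K t - 2))) = 1 / real R ^ (2 * K t - 2)"
            using R0 by simp
          also have "\<dots> \<le> 1 / real R ^ K t" using sched(9)[of t] R1 R0 by (intro divide_left_mono power_increasing) auto
          also have "\<dots> \<le> r t" by (rule rK)
          finally have "\<bar>(real (n t) * x - y) - (real (n t) * \<tau> - y)\<bar> \<le> r t" by (simp add: abs_mult flip: right_diff_distrib)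
          moreover have "dist_int (real (n t) * \<tau> - y) \<le> 2 * r t" using \<tau>(2) that(3) unfolding Tau_def by blast
          ultimately show ?thesis using dist_int_lipschitz[of "real (n t) * x - y" "real (n t) * \<tau> - y"] by linarith
        qed
        show ?thesis unfolding Inv_def using A1[OF a'] A2[OF a'] A3[OF a'] t3 i4 i5 by blast
      qed
      then show ?thesis using B by blast
    qed
    then show ?thesis using A by blast
  qed
  have root: "Inv 0 0 0"
  proof -
    have triv: "bad_between cb 0 h x" if "h \<le> 1" for h x
      unfolding bad_between_def
    proof (intro allI impI)
      fix q :: nat and p :: int assume "0 \<le> real q \<and> real q < h"
      then have "q = 0" using that by simp
      then show "cb / real q \<le> \<bar>real q * x - of_int p\<bar>" by simp
    qed
    have "real R ^ 0 / (2 * real R) \<le> 1" using R by simp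
    moreover have "\<kappa> * real R ^ 0 \<le> 1" using kap by simp
    moreover have "\<not> kk t + D t \<le> 0" for t using Dpos[of t] by simp
    moreover have "\<not> win t 0" for t by (simp add: win_def)
    moreover have "c2 / real q \<le> \<bar>real q * x - y - of_int p\<bar>" if "real q < \<kappa>2 * real R ^ 0" for q :: nat and x y and p :: int
    proof -
      have "q = 0" using that kap2 by simp
      then show ?thesis by simp
    qed
    ultimately show ?thesis unfolding Inv_def using triv by blast
  qed
  have growth: "1 / real R * real R powr (s * real l) \<le> (\<Prod>k<l div 2. real (cols k)) * real (R - 3) ^ l" for l
    unfolding cols_def
  proof (rule product_growth[OF s R])
    show "4 \<le> real R powr ((2 - s) / 2)" using R4 by (simp add: \<epsilon>_def)
    show "real (card {l. l < h \<and> Sp l}) \<le> (2 - s) / 2 * real h" for h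
      unfolding Sp_def \<epsilon>_def[symmetric]
      using sched(11,12) by (intro special_level_count kmono) (use eps in \<open>auto simp: D_def\<close>)
  qed
  show ?thesis
  proof (rule anisotropic_tree_measure[where Inv = Inv and cols = cols and R = R and m = m and \<rho> = "R - 3" and c = "1 / real R",
        OF R2 m_def s(1) _ _ _ root step growth])
    show "0 < 1 / real R" using R0 by simp
    show "0 < R - 3" using R by simp
    show "0 < cols k" for k
    proof -
      have "R\<^sup>2 > 3" using R power_mono[of 10 R 2] by simp
      then show ?thesis by (simp add: cols_def)
    qed
    fix \<beta> \<delta> assume path: "\<And>k. \<exists>a j. Inv k a j \<and> \<beta> \<in> gridcell m k a \<and> \<delta> \<in> gridcell R k j"
    have large: "\<exists>l. y < x * real R ^ l" if "x > 0" for x y :: real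
    proof -
      obtain l where "y / x < real R ^ l" using real_arch_pow[of "real R" "y / x"] R by auto
      then show ?thesis using that by (auto simp: divide_less_eq mult.commute)
    qed
    have B1: "cb \<le> real q * dist_int (real q * \<beta>)" if q: "q \<ge> 1" for q
    proof -
      obtain l where l: "real q < \<kappa> * real R ^ l" using large[OF kap(1)] by blast
      obtain a j where "Inv l a j" "\<beta> \<in> gridcell m l a" using path[of l] by blast
      then have "bad_between cb 0 (\<kappa> * real R ^ l) \<beta>" unfolding Inv_def by blast
      then have "cb / real q \<le> dist_int (real q * \<beta>)" using l by (intro dist_int_greatest bad_betweenD[of cb 0]) auto
      then show ?thesis using q by (simp add: pos_divide_le_eq mult.commute)
    qed
    have B2: "c2 \<le> real q * dist_int (real q * \<beta> - \<delta>)" if q: "q \<ge> 1" for q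
    proof -
      obtain l where l: "real q < \<kappa>2 * real R ^ l" using large[OF kap2(1)] by blast
      obtain a j where "Inv l a j" "\<beta> \<in> gridcell m l a" "\<delta> \<in> gridcell R l j" using path[of l] by blast
      then have "c2 / real q \<le> \<bar>real q * \<beta> - \<delta> - of_int p\<bar>" for p using l unfolding Inv_def by blast
      then have "c2 / real q \<le> dist_int (real q * \<beta> - \<delta>)" by (rule dist_int_greatest)
      then show ?thesis using q by (simp add: pos_divide_le_eq mult.commute)
    qed
    have "cb \<le> (INF q\<in>{1::nat..}. real q * dist_int (real q * \<beta>))" using B1 by (intro cINF_greatest) auto
    moreover have "c2 \<le> (INF q\<in>{1::nat..}. real q * dist_int (real q * \<beta> - \<delta>))" using B2 by (intro cINF_greatest) auto
    ultimately have pairs: "(\<beta>, \<delta>) \<in> Bad_pairs"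
      using cb(1) c2 by (auto simp: Bad_pairs_def Bad_def Bad_inhom_def)
    have hit: "dist_int (real (n t) * \<alpha> - \<gamma>) * dist_int (real (n t) * \<beta> - \<delta>) \<le> 1 / (real (n t) * ln (real (n t)))" for t
    proof -
      obtain a j where "Inv (kk t + D t) a j" "\<beta> \<in> gridcell m (kk t + D t) a" "\<delta> \<in> gridcell R (kk t + D t) j"
        using path[of "kk t + D t"] by blast
      then have "dist_int (real (n t) * \<beta> - \<delta>) \<le> 3 * r t" unfolding Inv_def by blast
      then have "dist_int (real (n t) * \<alpha> - \<gamma>) * dist_int (real (n t) * \<beta> - \<delta>) \<le> (6 / real (n t)) * (3 * r t)"
        using sched(3)[of t] by (intro mult_mono) (auto simp: dist_int_nonneg)
      then show ?thesis by (simp add: r_def)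
    qed
    have "\<forall>\<^sub>F N in sequentially. real (N_tilde \<alpha> \<beta> \<gamma> \<delta> N) \<ge> cN * ln (ln (real N))"
      using sched(14)
    proof eventually_elim
      case (elim N)
      have "card {t. n t \<le> N} = card (n ` {t. n t \<le> N})"
        using strict_mono_imp_inj_on[OF sched(1)] by (intro card_image[symmetric]) (auto simp: inj_on_def)
      also have "\<dots> \<le> N_tilde \<alpha> \<beta> \<gamma> \<delta> N"
        unfolding N_tilde_def using sched(2) hit by (intro card_mono) auto
      finally show ?case using elim by linarith
    qed
    then show "(\<beta>, \<delta>) \<in> R_set \<alpha> \<gamma>" using pairs sched(13) by (auto simp: R_set_def)
  qed
qed

theorem theorem1p14:
  fixes \<alpha> \<gamma> :: real
  assumes "\<alpha> \<in> K_set"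
  shows "hausdorff_dim (R_set \<alpha> \<gamma>) = 2"
proof (rule hausdorff_dim_eq_2I)
  show "R_set \<alpha> \<gamma> \<noteq> {}"
    using R_set_hausdorff_measure[OF assms, of 1 \<gamma>] hausdorff_measure_empty[of 1] by force
  show "hausdorff_measure s (R_set \<alpha> \<gamma>) \<noteq> 0" if "0 < s" "s < 2" for s
    by (rule R_set_hausdorff_measure[OF assms that])
qed

end
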